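(* Let $f$ be a transcendental entire function of finite order $\rho$ with Borel exceptional value $0$. Let $\alpha\in\mathbb{C}\setminus\{0\}$ be a constant, and let $\beta$ and $b_j$ $(j=0,1,\ldots,m)$ be entire functions that are $\lambda$-small functions of $f$. Let $$L(z,f)=\sum_{j=0}^{m} b_j(z)\, f^{(k_j)}(z+c_j),$$ where the $c_j$ are distinct complex numbers and the $k_j$ are non-negative integers, and assume $L(z,f)\not\equiv 0$. Put $\Phi_2(z)=L(z,f)-\alpha f(z)^2$. Then $\lambda(\Phi_2-\beta)=\rho$. In particular, if $\beta\equiv 0$, then $$N\left(r,\frac{1}{\Phi_2}\right)=T(r,f)+S_\lambda(r,f).$$
   Context: Standard notation of Nevanlinna theory is used: $T(r,\cdot)$ is the characteristic function and $N(r,\cdot)$ the integrated counting function. $\rho(f)$ denotes the order of growth of $f$. For a meromorphic function $g\not\equiv 0$, $\lambda(g)$ (with a function as argument) denotes the exponent of convergence of the zeros of $g$, i.e. $\limsup_{r\to\infty}\frac{\log^+ N(r,1/g)}{\log r}$. This is different from the real number $\lambda$ in "$\lambda$-small" and $S_\lambda$. $S(r,f)$ denotes any quantity satisfying $S(r,f)=o(T(r,f))$ as $r\to\infty$ outside a possible exceptional set $F$ of finite logarithmic measure. $\lambda$-small function: let $f$ be a meromorphic function of finite order $\rho$ and let $\lambda<\rho$ be a real number. A meromorphic function $a$ on $\mathbb{C}$ is a $\lambda$-small function of $f$ if for every $\varepsilon\in(0,\rho-\lambda)$ one has $T(r,a)=O(r^{\lambda+\varepsilon})+S(r,f)$ outside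 a possible exceptional set $F$ of finite logarithmic measure. A quantity of the form of this right-hand side, $O(r^{\lambda+\varepsilon})+S(r,f)$, is denoted $S_\lambda(r,f)$. In the claim, all $\lambda$-small functions are taken with respect to a common $\lambda<\rho$. The value $0$ is a Borel exceptional value of $f$ if $\lambda(f)<\rho(f)$. *)

theory Defs
  imports "HOL-Complex_Analysis.Complex_Analysis" "HOL-Library.Landau_Symbols"
begin

definition log_plus :: "real \<Rightarrow> real" where
  "log_plus x = ln (max 1 x)"

section \<open>Nevanlinna functions\<close>

text \<open>
  For \<^term>\<open>f\<close> meromorphic on the plane. Neither \<^const>\<open>is_pole\<close> nor \<^const>\<open>zorder\<close> depends on the
  value of \<^term>\<open>f\<close> at the point itself, so with the convention \<open>1 / 0 = 0\<close> the poles of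
  \<open>\<lambda>z. 1 / g z\<close> are exactly the zeros of \<open>g\<close>, with the same multiplicities, provided \<open>g\<close> is not
  identically zero.
\<close>

definition proximity :: "real \<Rightarrow> (complex \<Rightarrow> complex) \<Rightarrow> real" where
  "proximity r f =
     1 / (2 * pi) * integral {0..2 * pi} (\<lambda>\<theta>. log_plus (cmod (f (of_real r * exp (\<i> * of_real \<theta>)))))"

definition pole_count :: "real \<Rightarrow> (complex \<Rightarrow> complex) \<Rightarrow> nat" where
  "pole_count t f = (\<Sum>z | cmod z \<le> t \<and> is_pole f z. nat (- zorder f z))"

definition int_count :: "real \<Rightarrow> (complex \<Rightarrow> complex) \<Rightarrow> real" where
  "int_count r f =
     integral {0..r} (\<lambda>t. (real (pole_count t f) - real (pole_count 0 f)) / t)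
       + real (pole_count 0 f) * ln r"

definition nev_char :: "real \<Rightarrow> (complex \<Rightarrow> complex) \<Rightarrow> real" where
  "nev_char r f = proximity r f + int_count r f"

definition growth_order :: "(complex \<Rightarrow> complex) \<Rightarrow> ereal" where
  "growth_order f = Limsup at_top (\<lambda>r::real. ereal (log_plus (nev_char r f) / ln r))"

definition zero_exponent :: "(complex \<Rightarrow> complex) \<Rightarrow> ereal" where
  "zero_exponent g =
     Limsup at_top (\<lambda>r::real. ereal (log_plus (int_count r (\<lambda>z. 1 / g z)) / ln r))"

section \<open>Error terms\<close>

definition finite_log_measure :: "real set \<Rightarrow> bool" where
  "finite_log_measure F \<longleftrightarrow>
     F \<in> sets lebesgue \<and> (\<integral>\<^sup>+t\<in>F \<inter> {1..}. ennreal (1 / t) \<partial>lebesgue) < \<infinity>"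

definition at_top_off :: "real set \<Rightarrow> real filter" where
  "at_top_off F = inf at_top (principal (- F))"

definition S_term :: "(complex \<Rightarrow> complex) \<Rightarrow> (real \<Rightarrow> real) \<Rightarrow> bool" where
  "S_term f s \<longleftrightarrow>
     (\<exists>F. finite_log_measure F \<and> s \<in> o[at_top_off F](\<lambda>r. nev_char r f))"

text \<open>
  \<open>S\<^sub>\<lambda>(r,f)\<close>: of the form \<open>O(r\<^sup>\<lambda>\<^sup>+\<^sup>\<epsilon>) + S(r,f)\<close> off a set of finite logarithmic measure, for every
  \<open>\<epsilon> \<in> (0, \<rho> - \<lambda>)\<close>, where \<open>\<rho>\<close> is the order of \<open>f\<close>. The exceptional set may depend on \<open>\<epsilon>\<close>.
\<close>

definition S_lambda_term :: "real \<Rightarrow> (complex \<Rightarrow> complex) \<Rightarrow> (real \<Rightarrow> real) \<Rightarrow> bool" where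
  "S_lambda_term lam f q \<longleftrightarrow>
     (\<forall>\<epsilon>::real. 0 < \<epsilon> \<and> ereal \<epsilon> < growth_order f - ereal lam \<longrightarrow>
        (\<exists>F u s. finite_log_measure F \<and>
           u \<in> O[at_top_off F](\<lambda>r. r powr (lam + \<epsilon>)) \<and> S_term f s \<and>
           (\<forall>\<^sub>F r in at_top_off F. q r = u r + s r)))"

definition lambda_small :: "real \<Rightarrow> (complex \<Rightarrow> complex) \<Rightarrow> (complex \<Rightarrow> complex) \<Rightarrow> bool" where
  "lambda_small lam f a \<longleftrightarrow> a meromorphic_on UNIV \<and> S_lambda_term lam f (\<lambda>r. nev_char r a)"

section \<open>Functions\<close>

definition transcendental_entire :: "(complex \<Rightarrow> complex) \<Rightarrow> bool" where
  "transcendental_entire f \<longleftrightarrow>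
     f holomorphic_on UNIV \<and> \<not> (\<exists>p :: complex poly. \<forall>z. f z = poly p z)"

definition borel_exceptional_zero :: "(complex \<Rightarrow> complex) \<Rightarrow> bool" where
  "borel_exceptional_zero f \<longleftrightarrow> zero_exponent f < growth_order f"

definition diff_difference_op ::
  "nat \<Rightarrow> (nat \<Rightarrow> complex \<Rightarrow> complex) \<Rightarrow> (nat \<Rightarrow> nat) \<Rightarrow> (nat \<Rightarrow> complex) \<Rightarrow>
     (complex \<Rightarrow> complex) \<Rightarrow> complex \<Rightarrow> complex" where
  "diff_difference_op m b k c f z = (\<Sum>j\<le>m. b j z * (deriv ^^ k j) f (z + c j))"

definition Phi2 ::
  "nat \<Rightarrow> (nat \<Rightarrow> complex \<Rightarrow> complex) \<Rightarrow> (nat \<Rightarrow> nat) \<Rightarrow> (nat \<Rightarrow> complex) \<Rightarrow> complex \<Rightarrow>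
     (complex \<Rightarrow> complex) \<Rightarrow> complex \<Rightarrow> complex" where
  "Phi2 m b k c \<alpha> f z = diff_difference_op m b k c f z - \<alpha> * (f z)\<^sup>2"

end

theory Submission
  imports Defs
begin

text \<open>
  A Hadamard argument writes \<open>f = h e\<^sup>P\<close> with \<open>P = a z\<^sup>q\<close>, \<open>q = \<rho>\<close> and \<open>log M(r, h) = o(r\<^sup>q)\<close>. It needs no
  canonical products: on \<open>\<bar>z\<bar> \<le> R = 2\<^sup>j\<close> divide \<open>f\<close> by the polynomial of its zeros there. Since \<open>f\<close> has only
  \<open>O(R\<^sup>\<sigma>)\<close> zeros, \<open>\<sigma> < \<rho>\<close>, the Taylor coefficients of the logarithm of the quotient converge geometrically
  as \<open>j\<close> grows when their index exceeds \<open>\<sigma>\<close>, and the limits are the coefficients of \<open>P\<close>. Exceptional sets of finite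
  logarithmic measure contain no interval \<open>[r, K r]\<close> for a fixed large \<open>K\<close>, so a \<open>\<lambda>\<close>-small entire function
  also satisfies \<open>log M(r) = o(r\<^sup>q)\<close>. Hence \<open>L(z, f) = H e\<^sup>P\<close> and
  \<open>\<Phi>\<^sub>2 - \<beta> = - \<beta> + H e\<^sup>P - \<alpha> h\<^sup>2 e\<^sup>2\<^sup>P\<close> with coefficients of this kind.

  By Jensen's formula the theorem is about circle means of \<open>log \<bar>G\<bar>\<close> for \<open>G = A\<^sub>0 + A\<^sub>1 e\<^sup>P + A\<^sub>2 e\<^sup>2\<^sup>P\<close>. Off a set of
  directions of small measure one of the outer terms dominates. The exceptional directions are harmless because
  \<open>log \<bar>G(r e\<^sup>i\<^sup>\<theta>)\<bar> / r\<^sup>q\<close> is uniformly integrable from below: \<open>G\<close> has \<open>O(r\<^sup>q)\<close> zeros in \<open>\<bar>z\<bar> \<le> 2 r\<close>, each contributing a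
  logarithmic peak, and Borel-Caratheodory controls the zero-free factor. For \<open>\<beta> = 0\<close> one divides by \<open>e\<^sup>P\<close>, whose
  mean logarithm vanishes, and applies the same estimate with \<open>P / 2\<close>.
\<close>

section \<open>Means over circles\<close>

text \<open>The coefficients \<open>h\<close>, \<open>H\<close> and \<open>\<beta>\<close> may have
  zeros anywhere, so ln|A| has no pointwise lower bound. What survives is a bound in mean: smallness
  gives an upper bound, Jensen's formula bounds the mean below, and together the mean of |ln|A|| is
  o(r^q). The bad directions are therefore never measured as a set. Instead ln|G| is bounded below
  pointwise by its expected value minus penalties, multiples of |ln|A||, which outweigh the crude
  loss wherever the good estimate fails and whose means are small. Directions where Re(a z^q) is
  near 0 are penalised by ln|Re(a z^q)| in the same way.

  The comparison exponent \<open>\<sigma>\<close> for the zeros is taken strictly between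
  consecutive integers p and p + 1, because the k-th Taylor coefficient changes from one dyadic
  radius to the next at the rate 2^(\<sigma> - k), and the rate 1 would lead neither to a limit nor
  to the required bound.

  With K = \<open>indicator_mean a q\<close> one gets T(r,f) ~ K r^q, while N ~ 2 K r^q if
  \<open>\<beta>\<close> is not identically 0 and N ~ K r^q if it is. Hence the case distinction,
  and hence N is compared with T only in the second case.\<close>

abbreviation (input) entire :: "(complex \<Rightarrow> complex) \<Rightarrow> bool" where
  "entire g \<equiv> g holomorphic_on UNIV"

abbreviation (input) nonnull :: "(complex \<Rightarrow> complex) \<Rightarrow> bool" where
  "nonnull g \<equiv> \<exists>z. g z \<noteq> 0"

abbreviation circ :: "real \<Rightarrow> real \<Rightarrow> complex" where
  "circ r \<theta> \<equiv> of_real r * exp (\<i> * of_real \<theta>)"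

definition circle_integrable :: "real \<Rightarrow> (complex \<Rightarrow> real) \<Rightarrow> bool" where
  "circle_integrable r F \<longleftrightarrow> (\<lambda>\<theta>. F (circ r \<theta>)) absolutely_integrable_on {0..2 * pi}"

definition circle_mean :: "real \<Rightarrow> (complex \<Rightarrow> real) \<Rightarrow> real" where
  "circle_mean r F = 1 / (2 * pi) * integral {0..2 * pi} (\<lambda>\<theta>. F (circ r \<theta>))"

lemma norm_circ [simp]: "norm (circ r \<theta>) = \<bar>r\<bar>"
  by (simp add: norm_mult)

abbreviation (input) log_mean :: "real \<Rightarrow> (complex \<Rightarrow> complex) \<Rightarrow> real" where
  "log_mean r g \<equiv> circle_mean r (\<lambda>z. ln (norm (g z)))"

lemma proximity_eq_circle_mean: "proximity r f = circle_mean r (\<lambda>z. log_plus (cmod (f z)))"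
  by (simp add: proximity_def circle_mean_def)

lemma circle_integrable_imp_integrable:
  "circle_integrable r F \<Longrightarrow> (\<lambda>\<theta>. F (circ r \<theta>)) integrable_on {0..2 * pi}"
  unfolding circle_integrable_def by (rule set_lebesgue_integral_eq_integral)

lemma circle_integrable_const [simp]: "circle_integrable r (\<lambda>_. c)"
  unfolding circle_integrable_def by simp

lemma circle_mean_const [simp]: "circle_mean r (\<lambda>_. c) = c"
  unfolding circle_mean_def by simp

lemma circle_integrable_add:
  "circle_integrable r F \<Longrightarrow> circle_integrable r G \<Longrightarrow> circle_integrable r (\<lambda>z. F z + G z)"
  unfolding circle_integrable_def by (rule set_integral_add)

lemma circle_integrable_diff:
  "circle_integrable r F \<Longrightarrow> circle_integrable r G \<Longrightarrow> circle_integrable r (\<lambda>z. F z - G z)"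
  unfolding circle_integrable_def by (rule set_integral_diff)

lemma circle_integrable_cmult:
  "circle_integrable r F \<Longrightarrow> circle_integrable r (\<lambda>z. c * F z)"
  unfolding circle_integrable_def by (rule set_integrable_mult_right)

lemma circle_integrable_abs:
  "circle_integrable r F \<Longrightarrow> circle_integrable r (\<lambda>z. \<bar>F z\<bar>)"
  unfolding circle_integrable_def by (rule set_integrable_abs)

lemma circle_integrable_sum:
  assumes "finite I" "\<And>i. i \<in> I \<Longrightarrow> circle_integrable r (F i)"
  shows "circle_integrable r (\<lambda>z. \<Sum>i\<in>I. F i z)"
  using assms unfolding circle_integrable_def by (intro absolutely_integrable_sum) auto

lemma circle_mean_add:
  "circle_integrable r F \<Longrightarrow> circle_integrable r G \<Longrightarrow>
     circle_mean r (\<lambda>z. F z + G z) = circle_mean r F + circle_mean r G"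
  unfolding circle_mean_def
  by (subst integral_add) (simp_all add: circle_integrable_imp_integrable distrib_left right_diff_distrib)

lemma circle_mean_diff:
  "circle_integrable r F \<Longrightarrow> circle_integrable r G \<Longrightarrow>
     circle_mean r (\<lambda>z. F z - G z) = circle_mean r F - circle_mean r G"
  unfolding circle_mean_def
  by (subst integral_diff) (simp_all add: circle_integrable_imp_integrable distrib_left right_diff_distrib)

lemma circle_mean_cmult: "circle_mean r (\<lambda>z. c * F z) = c * circle_mean r F"
  unfolding circle_mean_def by simp

lemma circle_mean_sum:
  assumes "finite I" "\<And>i. i \<in> I \<Longrightarrow> circle_integrable r (F i)"
  shows "circle_mean r (\<lambda>z. \<Sum>i\<in>I. F i z) = (\<Sum>i\<in>I. circle_mean r (F i))"
  using assms unfolding circle_mean_def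
  by (subst integral_sum) (simp_all add: circle_integrable_imp_integrable sum_distrib_left)

lemma continuous_circle_integrable:
  assumes "continuous_on (sphere 0 r) F" "r > 0"
  shows "circle_integrable r F"
proof -
  have "continuous_on {0..2*pi} (\<lambda>\<theta>. F (circ r \<theta>))"
    by (rule continuous_on_compose2[OF assms(1)]) (use assms(2) in \<open>auto intro!: continuous_intros\<close>)
  thus ?thesis unfolding circle_integrable_def
    by (rule absolutely_integrable_continuous_real)
qed

lemma finite_circ_vimage:
  assumes "finite S" "r > 0"
  shows "finite {\<theta>\<in>{0..2*pi}. circ r \<theta> \<in> S}"
proof -
  have inj: "inj_on (circ r) {0..<2*pi}"
  proof (rule inj_onI)
    fix x y assume xy: "x \<in> {0..<2*pi}" "y \<in> {0..<2*pi}" "circ r x = circ r y"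
    have "exp (\<i> * of_real x) = exp (\<i> * of_real y)" using xy(3) assms by simp
    then obtain n :: int where n: "\<i> * of_real x = \<i> * of_real y + (of_int (2 * n) * pi) * \<i>"
      using exp_eq[of "\<i> * of_real x" "\<i> * of_real y"] by auto
    have eq: "x = y + 2 * n * pi" using arg_cong[OF n, of Im] by simp
    hence "\<bar>2 * n * pi\<bar> < 2 * pi" using xy by auto
    hence "\<bar>real_of_int n\<bar> < 1" by (simp add: abs_mult)
    hence "n = 0" by linarith
    thus "x = y" using eq by simp
  qed
  have "finite (circ r -` S \<inter> {0..<2*pi})" by (rule finite_vimage_IntI[OF assms(1) inj])
  moreover have "{\<theta>\<in>{0..2*pi}. circ r \<theta> \<in> S} \<subseteq> insert (2*pi) (circ r -` S \<inter> {0..<2*pi})" by auto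
  ultimately show ?thesis by (meson finite_insert finite_subset)
qed

lemma circle_spike:
  assumes "finite S" "r > 0" "\<And>z. norm z = r \<Longrightarrow> z \<notin> S \<Longrightarrow> F z = G z"
  shows "circle_integrable r F \<longleftrightarrow> circle_integrable r G" "circle_mean r F = circle_mean r G"
proof -
  let ?N = "{\<theta>\<in>{0..2*pi}. circ r \<theta> \<in> S}"
  have N: "negligible ?N" using finite_circ_vimage[OF assms(1,2)] by (rule negligible_finite)
  have eq: "\<And>\<theta>. \<theta> \<in> {0..2*pi} - ?N \<Longrightarrow> G (circ r \<theta>) = F (circ r \<theta>)"
    using assms by auto
  show "circle_integrable r F \<longleftrightarrow> circle_integrable r G"
    unfolding circle_integrable_def
    by (rule absolutely_integrable_spike_eq[OF N]) (use eq in auto)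
  show "circle_mean r F = circle_mean r G"
    unfolding circle_mean_def using integral_spike[OF N, of "{0..2*pi}" "\<lambda>\<theta>. G (circ r \<theta>)" "\<lambda>\<theta>. F (circ r \<theta>)"] eq by auto
qed

text \<open>The convention \<open>ln 0 = 0\<close> makes inequalities between logarithms of moduli
  unreliable at zeros, so the comparison is required only off a finite set. \<open>F'\<close>
  repairs the integrand there without changing its mean.\<close>

lemma circle_mean_mono:
  assumes "finite S" "r > 0" "\<And>z. norm z = r \<Longrightarrow> z \<notin> S \<Longrightarrow> F z \<le> G z"
    "circle_integrable r F" "circle_integrable r G"
  shows "circle_mean r F \<le> circle_mean r G"
proof -
  define F' where "F' z = (if z \<in> S then G z else F z)" for z
  have *: "circle_integrable r F'" "circle_mean r F' = circle_mean r F"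
    using circle_spike[OF assms(1,2), of F' F] assms(4) by (auto simp: F'_def)
  have "integral {0..2*pi} (\<lambda>\<theta>. F' (circ r \<theta>)) \<le> integral {0..2*pi} (\<lambda>\<theta>. G (circ r \<theta>))"
  proof (rule integral_le)
    show "F' (circ r \<theta>) \<le> G (circ r \<theta>)" for \<theta> using assms(2,3) by (simp add: F'_def)
  qed (use assms(5) *(1) circle_integrable_imp_integrable in blast)+
  thus ?thesis using *(2) unfolding circle_mean_def by (simp add: divide_right_mono)
qed

section \<open>Cauchy's formula in the angle, and the means of ln|z - a|\<close>

lemma Cauchy_circle_has_integral:
  fixes L :: "complex \<Rightarrow> complex"
  assumes "continuous_on (cball 0 r) L" "L holomorphic_on ball 0 r" "norm w < r"
  shows "((\<lambda>t. L (circ r t) * (circ r t / (circ r t - w))) has_integral (2 * pi * L w)) {0..2*pi}"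
proof -
  have "((\<lambda>u. L u / (u - w)) has_contour_integral (2 * of_real pi * \<i> * L w)) (circlepath 0 r)"
    using Cauchy_integral_circlepath[of 0 r L w] assms by simp
  hence "((\<lambda>u. L u / (u - w)) has_contour_integral (2 * of_real pi * \<i> * L w)) (part_circlepath 0 r 0 (2*pi))"
    by (simp add: circlepath_def)
  hence "((\<lambda>t. L (0 + of_real r * cis t) / (0 + of_real r * cis t - w) * of_real r * \<i> * cis t) has_integral (2 * of_real pi * \<i> * L w)) {0..2*pi}"
    by (subst (asm) has_contour_integral_part_circlepath_iff) auto
  from has_integral_mult_right[OF this, of "-\<i>"] show ?thesis
    by (simp add: cis_conv_exp mult_ac)
qed

lemma mean_value_circle:
  assumes "continuous_on (cball 0 r) L" "L holomorphic_on ball 0 r" "r > 0"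
  shows "circle_mean r (\<lambda>z. Re (L z)) = Re (L 0)"
proof -
  have "((\<lambda>t. L (circ r t)) has_integral (2 * pi * L 0)) {0..2*pi}"
    using Cauchy_circle_has_integral[OF assms(1,2), of 0] assms(3) by simp
  from has_integral_linear[OF this bounded_linear_Re]
  have "((\<lambda>t. Re (L (circ r t))) has_integral (2 * pi * Re (L 0))) {0..2*pi}"
    by (simp add: o_def)
  thus ?thesis unfolding circle_mean_def by (simp add: integral_unique)
qed

text \<open>A holomorphic logarithm lives on an open disc, while zero-freeness is known on a closed
  one; compactness of \<open>cball 0 r\<close> leaves a margin \<open>e\<close>.\<close>

lemma zero_free_neighbourhood:
  assumes "entire E" "\<And>z. z \<in> cball 0 r \<Longrightarrow> E z \<noteq> 0" "r \<ge> 0"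
  obtains t where "t > r" "\<And>z. z \<in> ball 0 t \<Longrightarrow> E z \<noteq> 0"
proof -
  have cont: "continuous_on UNIV E" using assms(1) by (rule holomorphic_on_imp_continuous_on)
  have "open (- E -` {0})"
    using cont by (metis open_vimage vimage_Compl closed_singleton open_Compl)
  moreover have "cball 0 r \<subseteq> - E -` {0}" using assms(2) by auto
  ultimately obtain e where e: "e > 0" "(\<Union>x\<in>cball 0 r. ball x e) \<subseteq> - E -` {0}"
    using compact_subset_open_imp_ball_epsilon_subset[of "cball 0 r" "- E -` {0}"] by auto
  show ?thesis
  proof (rule that[of "r + e"])
    fix z :: complex assume z: "z \<in> ball 0 (r + e)"
    have "z \<in> (\<Union>x\<in>cball 0 r. ball x e)"
    proof (cases "norm z \<le> r")
      case True thus ?thesis using e by force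
    next
      case False
      define x where "x = of_real (r / norm z) * z"
      have nz: "norm z > 0" using False assms(3) by linarith
      have "norm x = r" using nz assms(3) by (simp add: x_def norm_mult norm_divide)
      moreover have "x - z = of_real (r / norm z - 1) * z" by (simp add: x_def algebra_simps)
      hence "norm (x - z) = \<bar>r / norm z - 1\<bar> * norm z" by (simp add: norm_mult del: of_real_diff of_real_divide)
      hence "norm (x - z) = norm z - r" using nz False by (simp add: abs_if left_diff_distrib)
      ultimately show ?thesis using z by (auto simp: dist_norm intro!: bexI[of _ x])
    qed
    hence "z \<in> - E -` {0}" using e(2) by (rule subsetD[rotated])
    thus "E z \<noteq> 0" by simp
  qed (use e in auto)
qed

lemma circle_ln_zero_free:
  assumes "entire E" "\<And>z. z \<in> cball 0 r \<Longrightarrow> E z \<noteq> 0" "r > 0"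
  shows "circle_integrable r (\<lambda>z. ln (norm (E z)))" "log_mean r E = ln (norm (E 0))"
proof -
  obtain t where t: "t > r" "\<And>z. z \<in> ball 0 t \<Longrightarrow> E z \<noteq> 0"
    using zero_free_neighbourhood[of E r] assms by auto
  have "E holomorphic_on ball 0 t" using assms(1) holomorphic_on_subset by blast
  then obtain L where L: "L holomorphic_on ball 0 t" "\<And>z. z \<in> ball 0 t \<Longrightarrow> exp (L z) = E z"
    using holomorphic_logarithm_exists[of "ball 0 t" E 0] t assms(3) by (auto)
  have ln: "ln (norm (E z)) = Re (L z)" if "norm z < t" for z
    using L(2)[of z] that by (metis ln_exp mem_ball_0 norm_exp_eq_Re)
  have sub: "cball 0 r \<subseteq> ball (0::complex) t" "ball 0 r \<subseteq> ball (0::complex) t" using t by auto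
  have contL: "continuous_on (cball 0 r) L" "L holomorphic_on ball 0 r"
    using L(1) sub holomorphic_on_imp_continuous_on holomorphic_on_subset continuous_on_subset by blast+
  have sp: "sphere 0 r \<subseteq> cball (0::complex) r" by auto
  have "circle_integrable r (\<lambda>z. Re (L z))"
    by (rule continuous_circle_integrable)
       (use assms(3) continuous_on_subset[OF contL(1) sp] in \<open>auto intro!: continuous_intros\<close>)
  thus "circle_integrable r (\<lambda>z. ln (norm (E z)))"
    using circle_spike(1)[of "{}" r "\<lambda>z. Re (L z)" "\<lambda>z. ln (norm (E z))"] ln t assms(3) by auto
  have "log_mean r E = circle_mean r (\<lambda>z. Re (L z))"
    by (rule circle_spike(2)[of "{}"]) (use ln t assms(3) in auto)
  also have "\<dots> = ln (norm (E 0))" using mean_value_circle[OF contL assms(3)] ln[of 0] t assms(3) by simp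
  finally show "log_mean r E = ln (norm (E 0))" .
qed

text \<open>The reflected factor \<open>?E\<close> has the modulus of z - a on the circle, no zero
  in the closed disc, and the value \<open>r\<close> at the origin. This is why the mean does not
  depend on \<open>a\<close>.\<close>

lemma circle_mean_ln_inside:
  assumes "norm a < r"
  shows "circle_integrable r (\<lambda>z. ln (norm (z - a)))" "circle_mean r (\<lambda>z. ln (norm (z - a))) = ln r"
proof -
  have r: "r > 0" using assms norm_ge_zero[of a] by linarith
  let ?E = "\<lambda>z. of_real r - cnj a * z / of_real r"
  have E: "?E z \<noteq> 0" if "z \<in> cball 0 r" for z
  proof
    assume "?E z = 0"
    hence "of_real r = cnj a * z / of_real r" by simp
    hence "norm (of_real r :: complex) = norm (cnj a * z / of_real r)" by simp
    hence "r = norm a * norm z / r" using r by (simp add: norm_mult norm_divide)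
    hence "r * r = norm a * norm z" using r by (simp add: field_simps)
    moreover have "norm a * norm z \<le> norm a * r" using that by (intro mult_left_mono) auto
    moreover have "norm a * r < r * r" using assms r by simp
    ultimately show False by linarith
  qed
  have eq: "norm (?E z) = norm (z - a)" if "norm z = r" for z
  proof -
    have "z * cnj z = of_real (r^2)" using that by (metis complex_norm_square of_real_power)
    hence "z * cnj z = of_real r * of_real r" by (simp add: power2_eq_square)
    hence "of_real r * ?E z = z * cnj z - z * cnj a" using r by (simp add: field_simps)
    hence "of_real r * ?E z = z * cnj (z - a)" by (simp add: algebra_simps)
    hence "norm (of_real r * ?E z) = norm (z * cnj (z - a))" by simp
    hence "r * norm (?E z) = r * norm (z - a)" using that r unfolding norm_mult complex_mod_cnj by simp
    thus ?thesis using r by simp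
  qed
  have hol: "?E holomorphic_on UNIV" using r by (auto intro!: holomorphic_intros)
  note * = circle_ln_zero_free[OF hol E r]
  show "circle_integrable r (\<lambda>z. ln (norm (z - a)))"
    using *(1) circle_spike(1)[of "{}" r "\<lambda>z. ln (norm (?E z))" "\<lambda>z. ln (norm (z - a))"] eq r by auto
  show "circle_mean r (\<lambda>z. ln (norm (z - a))) = ln r"
    using *(2) circle_spike(2)[of "{}" r "\<lambda>z. ln (norm (?E z))" "\<lambda>z. ln (norm (z - a))"] eq r by auto
qed

lemma tendsto_scaled_norm:
  "(\<lambda>n. norm (z - of_real (1 - 1 / real (Suc n)) * a)) \<longlonglongrightarrow> norm (z - a :: complex)"
proof -
  have "(\<lambda>n. 1 - 1 / real (Suc n)) \<longlonglongrightarrow> 1 - 0"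
    using LIMSEQ_inverse_real_of_nat by (intro tendsto_diff tendsto_const) (simp add: inverse_eq_divide)
  hence "(\<lambda>n. norm (z - of_real (1 - 1 / real (Suc n)) * a)) \<longlonglongrightarrow> norm (z - of_real (1 - 0) * a)"
    by (rule tendsto_norm[OF tendsto_diff[OF tendsto_const tendsto_mult[OF tendsto_of_real tendsto_const]]])
  thus ?thesis by simp
qed

text \<open>Pulling \<open>a\<close> inward moves it by (1 - s)|a|, which the reverse triangle
  inequality bounds by the new distance to \<open>z\<close>. This supplies a dominating function as
  \<open>s\<close> tends to 1.\<close>

lemma norm_diff_scaled_ge:
  assumes "norm z = norm (a::complex)" "0 \<le> s" "s \<le> 1"
  shows "norm (z - a) \<le> 2 * norm (z - of_real s * a)"
proof -
  have "norm (z - a) \<le> norm (z - of_real s * a) + norm (of_real s * a - a)"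
    by (metis diff_add_cancel add_diff_eq norm_triangle_ineq)
  moreover have "norm (of_real s * a - a) = (1 - s) * norm a"
  proof -
    have "of_real s * a - a = of_real (s - 1) * a" by (simp add: algebra_simps)
    thus ?thesis using assms by (simp only: norm_mult norm_of_real) auto
  qed
  moreover have "norm z - norm (of_real s * a) \<le> norm (z - of_real s * a)" by (rule norm_triangle_ineq2)
  hence "(1 - s) * norm a \<le> norm (z - of_real s * a)" using assms by (simp add: norm_mult algebra_simps)
  ultimately show ?thesis by linarith
qed

text \<open>The singularity lies on the circle, so the interior case is applied to
  \<open>s n\<close> times \<open>a\<close> and \<open>s n\<close> tends to 1. Integrability of the
  limit \<open>v\<close> comes first, by truncation and monotone convergence; only then can |v|
  serve as a dominating function for the value of the mean.\<close>

lemma circle_ln_boundary: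
  assumes "norm a = r" "r > 0"
  shows "circle_integrable r (\<lambda>z. ln (norm (z - a)))" "circle_mean r (\<lambda>z. ln (norm (z - a))) = ln r"
proof -
  define N where "N = {\<theta>\<in>{0..2*pi}. circ r \<theta> \<in> {a}}"
  define S where "S = {0..2*pi} - N"
  have N: "negligible N" unfolding N_def using finite_circ_vimage[of "{a}" r] assms by (intro negligible_finite) auto
  define s where "s n = 1 - 1 / real (Suc n)" for n
  have s: "0 \<le> s n" "s n < 1" for n unfolding s_def by (auto simp: field_simps)
  define u where "u n \<theta> = ln (norm (circ r \<theta> - of_real (s n) * a))" for n \<theta>
  define v where "v \<theta> = ln (norm (circ r \<theta> - a))" for \<theta>
  have sp: "negligible (sym_diff S {0..2*pi})"
    using N by (auto simp: S_def intro: negligible_subset)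
  have to_S: "g integrable_on S \<longleftrightarrow> g integrable_on {0..2*pi}" "integral S g = integral {0..2*pi} g" for g :: "real \<Rightarrow> real"
    using integrable_spike_set_eq[OF sp] by (auto intro!: integral_spike_set negligible_subset[OF sp])
  have na: "norm (of_real (s n) * a) < r" for n
    using s[of n] assms by (simp add: norm_mult)
  have uint: "u n integrable_on S" "integral S (u n) = 2 * pi * ln r" for n
    using circle_mean_ln_inside[OF na[of n]] unfolding to_S u_def
    by (auto dest: circle_integrable_imp_integrable simp: circle_mean_def field_simps)
  have ub: "u n \<theta> \<le> \<bar>ln (2 * r)\<bar>" for n \<theta>
  proof -
    have "norm (circ r \<theta> - of_real (s n) * a) \<le> 2 * r"
      using norm_triangle_ineq4[of "circ r \<theta>" "of_real (s n) * a"] na[of n] assms by simp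
    thus ?thesis unfolding u_def
      by (cases "norm (circ r \<theta> - of_real (s n) * a) = 0") (auto intro!: order_trans[OF ln_mono abs_ge_self] simp: norm_mult)
  qed
  have nz: "circ r \<theta> \<noteq> a" if "\<theta> \<in> S" for \<theta> using that by (auto simp: S_def N_def)
  have ulim: "(\<lambda>n. u n \<theta>) \<longlonglongrightarrow> v \<theta>" if "\<theta> \<in> S" for \<theta>
    unfolding u_def v_def s_def using nz[OF that] by (intro tendsto_ln tendsto_scaled_norm) auto
  \<comment> \<open>Truncation at -M makes the convergence in \<open>n\<close> bounded. It only
    raises the integrand, so 2 pi ln r stays a lower bound for every \<open>M\<close> and keeps the
    monotone limit finite.\<close>
  define h where "h M \<theta> = max (v \<theta>) (- real M)" for M \<theta>
  have hint: "h M integrable_on S \<and> integral S (h M) \<ge> 2 * pi * ln r" for M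
  proof -
    let ?f = "\<lambda>n \<theta>. max (u n \<theta>) (- real M)"
    have umint: "?f n integrable_on S" for n
    proof -
      have "continuous_on {0..2*pi} (u n)"
        unfolding u_def
      proof (intro continuous_intros ballI)
        fix \<theta> show "norm (circ r \<theta> - of_real (s n) * a) \<noteq> 0"
        proof
          assume "norm (circ r \<theta> - of_real (s n) * a) = 0"
          hence "norm (circ r \<theta>) = norm (of_real (s n) * a)" by simp
          thus False using na[of n] assms by simp
        qed
      qed
      hence "continuous_on {0..2*pi} (?f n)" by (intro continuous_intros)
      thus ?thesis unfolding to_S by (rule integrable_continuous_real)
    qed
    have bint: "(\<lambda>_. \<bar>ln (2 * r)\<bar> + real M) integrable_on S"
      unfolding to_S by (rule integrable_const_ivl)
    have bd: "norm (?f n \<theta>) \<le> \<bar>ln (2 * r)\<bar> + real M" for n \<theta>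
      using ub[of n \<theta>] by (auto simp: max_def abs_if)
    have lim: "(\<lambda>n. ?f n \<theta>) \<longlonglongrightarrow> h M \<theta>" if "\<theta> \<in> S" for \<theta>
      unfolding h_def using ulim[OF that] by (intro tendsto_intros)
    note dc = dominated_convergence[OF umint bint bd lim]
    have "integral S (?f n) \<ge> 2 * pi * ln r" for n
      unfolding uint(2)[symmetric, of n] by (rule integral_le[OF uint(1) umint]) auto
    hence "integral S (h M) \<ge> 2 * pi * ln r"
      by (intro LIMSEQ_le_const[OF dc(2)]) auto
    with dc(1) show ?thesis by simp
  qed
  have hle: "h M \<theta> \<le> \<bar>ln (2 * r)\<bar>" for M \<theta>
  proof -
    have "norm (circ r \<theta> - a) \<le> 2 * r"
      using norm_triangle_ineq4[of "circ r \<theta>" a] assms by simp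
    hence "v \<theta> \<le> \<bar>ln (2 * r)\<bar>" unfolding v_def
      by (cases "norm (circ r \<theta> - a) = 0") (auto intro!: order_trans[OF ln_mono abs_ge_self])
    thus ?thesis by (auto simp: h_def)
  qed
  have "v integrable_on S \<and> (\<lambda>M. integral S (h M)) \<longlonglongrightarrow> integral S v"
  proof (rule monotone_convergence_decreasing)
    show "h M integrable_on S" for M using hint by blast
    show "h (Suc M) \<theta> \<le> h M \<theta>" for M \<theta> by (auto simp: h_def max_def)
    show "(\<lambda>M. h M \<theta>) \<longlonglongrightarrow> v \<theta>" for \<theta>
    proof (rule tendsto_eventually)
      obtain M0 :: nat where M0: "- v \<theta> \<le> real M0" using real_arch_simple by blast
      show "\<forall>\<^sub>F M in sequentially. h M \<theta> = v \<theta>"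
        using eventually_ge_at_top[of M0] by eventually_elim (use M0 in \<open>auto simp: h_def max_def\<close>)
    qed
    show "bounded (range (\<lambda>M. integral S (h M)))"
    proof -
      have "integral S (h M) \<le> integral S (\<lambda>_. \<bar>ln (2 * r)\<bar>)" for M
        using hint hle by (intro integral_le) (auto simp: to_S)
      hence "integral S (h M) \<in> {2 * pi * ln r .. integral S (\<lambda>_. \<bar>ln (2 * r)\<bar>)}" for M using hint by auto
      thus ?thesis by (intro bounded_subset[OF bounded_closed_interval]) blast
    qed
  qed
  hence v: "v integrable_on {0..2*pi}" using to_S by blast
  have "(\<lambda>\<theta>. \<bar>ln (2 * r)\<bar> - v \<theta>) absolutely_integrable_on {0..2*pi}"
  proof (rule nonnegative_absolutely_integrable_1)
    show "(\<lambda>\<theta>. \<bar>ln (2 * r)\<bar> - v \<theta>) integrable_on {0..2*pi}" using v by (intro integrable_diff) auto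
    show "0 \<le> \<bar>ln (2 * r)\<bar> - v \<theta>" for \<theta> using hle[of 0 \<theta>] by (auto simp: h_def)
  qed
  from set_integral_diff(1)[OF absolutely_integrable_on_const this, of "\<bar>ln (2 * r)\<bar>"]
  have vint: "v absolutely_integrable_on {0..2*pi}" by (simp add: lmeasurable_interval)
  thus "circle_integrable r (\<lambda>z. ln (norm (z - a)))" by (simp add: circle_integrable_def v_def[abs_def])
  \<comment> \<open>The term ln 2 pays for the factor 2 in \<open>norm_diff_scaled_ge\<close>; the
    last term covers the upper bound 2 r for the distances.\<close>
  define D where "D \<theta> = \<bar>v \<theta>\<bar> + ln 2 + \<bar>ln (2 * r)\<bar>" for \<theta>
  have "(\<lambda>\<theta>. \<bar>v \<theta>\<bar>) integrable_on {0..2*pi}"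
    using vint by (simp add: absolutely_integrable_on_def)
  hence D: "D integrable_on S" unfolding to_S D_def by (intro integrable_add) auto
  have bd: "norm (u n \<theta>) \<le> D \<theta>" if "\<theta> \<in> S" for n \<theta>
  proof -
    let ?x = "norm (circ r \<theta> - of_real (s n) * a)"
    have x0: "norm (circ r \<theta> - a) > 0" using nz[OF that] by simp
    have x1: "norm (circ r \<theta> - a) / 2 \<le> ?x"
      using norm_diff_scaled_ge[of "circ r \<theta>" a "s n"] s[of n] assms by simp
    have x2: "?x \<le> 2 * r"
      using norm_triangle_ineq4[of "circ r \<theta>" "of_real (s n) * a"] na[of n] assms by simp
    have "ln (norm (circ r \<theta> - a) / 2) \<le> ln ?x" using x0 x1 by (intro ln_mono) auto
    hence "v \<theta> - ln 2 \<le> u n \<theta>" unfolding v_def u_def using x0 by (simp add: ln_div)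
    moreover have "u n \<theta> \<le> ln (2 * r)" unfolding u_def using x0 x1 x2 by (intro ln_mono) linarith+
    moreover have "ln (2::real) \<ge> 0" by simp
    ultimately show ?thesis unfolding D_def real_norm_def by linarith
  qed
  have "(\<lambda>n. integral S (u n)) \<longlonglongrightarrow> integral S v"
    by (rule dominated_convergence(2)[OF uint(1) D bd ulim])
  hence "integral S v = 2 * pi * ln r" unfolding uint(2) using LIMSEQ_unique tendsto_const by blast
  thus "circle_mean r (\<lambda>z. ln (norm (z - a))) = ln r" unfolding to_S v_def circle_mean_def by simp
qed

lemma circle_ln_linear_factor:
  assumes "norm a \<le> r" "r > 0"
  shows "circle_integrable r (\<lambda>z. ln (norm (z - a)))" "circle_mean r (\<lambda>z. ln (norm (z - a))) = ln r"
  using assms circle_mean_ln_inside circle_ln_boundary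
  by (metis le_less)+

section \<open>Uniform integrability of logarithmic peaks\<close>

lemma norm_exp_diff_shift:
  "norm (exp (\<i> * of_real \<theta>) - exp (\<i> * of_real \<phi>)) = norm (exp (\<i> * of_real (\<theta> - \<phi>)) - 1)"
proof -
  have "exp (\<i> * of_real \<theta>) - exp (\<i> * of_real \<phi>) = exp (\<i> * of_real \<phi>) * (exp (\<i> * of_real (\<theta> - \<phi>)) - 1)"
    by (simp add: algebra_simps exp_add[symmetric])
  thus ?thesis by (simp add: norm_mult)
qed

lemma circle_integrable_bounded:
  assumes "F \<in> borel_measurable borel" "circle_integrable r G" "\<And>z. norm z = \<bar>r\<bar> \<Longrightarrow> \<bar>F z\<bar> \<le> G z"
  shows "circle_integrable r F"
proof -
  have "(\<lambda>\<theta>. F (circ r \<theta>)) \<in> borel_measurable borel"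
    by (rule measurable_compose[OF _ assms(1)]) (auto intro!: borel_measurable_continuous_onI continuous_intros)
  hence "(\<lambda>\<theta>. F (circ r \<theta>)) \<in> borel_measurable lebesgue"
    by (simp add: measurable_completion)
  hence "(\<lambda>\<theta>. F (circ r \<theta>)) \<in> borel_measurable (lebesgue_on {0..2*pi})"
    by (rule measurable_restrict_space1)
  thus ?thesis unfolding circle_integrable_def
    by (rule measurable_bounded_by_integrable_imp_absolutely_integrable[where g = "\<lambda>\<theta>. G (circ r \<theta>)"])
       (use assms circle_integrable_imp_integrable in auto)
qed

text \<open>This is ln|z - 1| on the unit circle, extended by periodicity. Two periods are covered
  because a peak at an angle in [0, 2 pi] is later rotated to 0.\<close>

lemma abs_ln_norm_exp_minus_one_integrable:
  "(\<lambda>\<theta>. \<bar>ln (norm (exp (\<i> * of_real \<theta>) - 1))\<bar>) integrable_on {- (2 * pi)..2 * pi}" (is "?f integrable_on _")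
proof -
  have 1: "?f integrable_on {0..2*pi}"
    using circle_integrable_imp_integrable[OF circle_integrable_abs[OF circle_ln_linear_factor(1)[of 1 1]]]
    by simp
  have "exp (\<i> * of_real (2 * pi + \<theta>)) = exp (\<i> * of_real \<theta>)" for \<theta>
    by (simp add: algebra_simps exp_add exp_two_pi_i')
  hence per: "?f \<circ> (+) (2 * pi) = ?f" by (auto simp: o_def)
  have "?f \<circ> (+) (2 * pi) integrable_on cbox (- (2*pi)) 0"
    unfolding integrable_on_shift_cbox using 1 by simp
  hence 2: "?f integrable_on {- (2*pi)..0}" unfolding per by simp
  show ?thesis by (rule Henstock_Kurzweil_Integration.integrable_combine[OF _ _ 2 1]) auto
qed

text \<open>The amount by which minus the logarithm of the chord length exceeds the level -ln
  \<kappa>. At the peak itself division by zero gives the value 0, which affects only a null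
  set.\<close>

abbreviation log_peak :: "real \<Rightarrow> real \<Rightarrow> real" where
  "log_peak \<kappa> \<theta> \<equiv> ln (max 1 (\<kappa> / norm (exp (\<i> * of_real \<theta>) - 1)))"

lemma log_peak_bound: "0 < \<kappa> \<Longrightarrow> \<kappa> \<le> 1 \<Longrightarrow> log_peak \<kappa> \<theta> \<le> \<bar>ln (norm (exp (\<i> * of_real \<theta>) - 1))\<bar>"
proof -
  assume k: "0 < \<kappa>" "\<kappa> \<le> 1"
  define x where "x = norm (exp (\<i> * of_real \<theta>) - 1)"
  have x: "x \<ge> 0" by (simp add: x_def)
  have "ln (max 1 (\<kappa> / x)) \<le> \<bar>ln x\<bar>"
  proof (cases "\<kappa> / x \<le> 1")
    case False
    hence "x > 0" using x by (cases "x = 0") auto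
    moreover have "ln (\<kappa> / x) \<le> - ln x" using \<open>x > 0\<close> k by (simp add: ln_div)
    ultimately show ?thesis using False by (simp add: max_def)
  qed (auto simp: max_def)
  thus ?thesis by (simp add: x_def)
qed

lemma log_peak_integrable:
  assumes "0 < \<kappa>" "\<kappa> \<le> 1"
  shows "log_peak \<kappa> absolutely_integrable_on {- (2 * pi)..2 * pi}"
proof (rule measurable_bounded_by_integrable_imp_absolutely_integrable[OF _ _ abs_ln_norm_exp_minus_one_integrable])
  have "continuous_on UNIV (\<lambda>\<theta>::real. norm (exp (\<i> * of_real \<theta>) - 1))" by (intro continuous_intros)
  hence [measurable]: "(\<lambda>\<theta>::real. norm (exp (\<i> * of_real \<theta>) - 1)) \<in> borel_measurable borel"
    by (rule borel_measurable_continuous_onI)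
  have "log_peak \<kappa> \<in> borel_measurable borel" by measurable
  hence "log_peak \<kappa> \<in> borel_measurable lebesgue" by (simp add: measurable_completion)
  thus "log_peak \<kappa> \<in> borel_measurable (lebesgue_on {- (2 * pi)..2 * pi})" by (rule measurable_restrict_space1)
qed (use log_peak_bound[OF assms] in auto)

text \<open>As \<kappa> decreases to 0 the peaks vanish pointwise and stay below the fixed
  integrable function of \<open>log_peak_bound\<close>, so dominated convergence applies.\<close>

lemma log_peak_integral_small:
  assumes "\<epsilon> > 0"
  obtains \<kappa> where "0 < \<kappa>" "\<kappa> \<le> 1" "integral {- (2 * pi)..2 * pi} (log_peak \<kappa>) < \<epsilon>"
proof -
  define k where "k n = 1 / real (Suc n)" for n
  have k: "0 < k n" "k n \<le> 1" for n by (auto simp: k_def)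
  have klim: "k \<longlonglongrightarrow> 0" unfolding k_def using LIMSEQ_inverse_real_of_nat by (simp add: inverse_eq_divide)
  have "(\<lambda>n. integral {- (2 * pi)..2 * pi} (log_peak (k n))) \<longlonglongrightarrow> integral {- (2 * pi)..2 * pi} (\<lambda>_. 0)"
  proof (rule dominated_convergence(2)[OF _ abs_ln_norm_exp_minus_one_integrable])
    show "log_peak (k n) integrable_on {- (2 * pi)..2 * pi}" for n
      using log_peak_integrable[OF k] by (rule set_lebesgue_integral_eq_integral(1))
    show "norm (log_peak (k n) \<theta>) \<le> \<bar>ln (norm (exp (\<i> * of_real \<theta>) - 1))\<bar>" for n \<theta>
      using log_peak_bound[OF k] by simp
    show "(\<lambda>n. log_peak (k n) \<theta>) \<longlonglongrightarrow> 0" for \<theta>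
    proof (rule tendsto_eventually)
      define x where "x = norm (exp (\<i> * of_real \<theta>) - 1)"
      have x: "x \<ge> 0" by (simp add: x_def)
      have "\<forall>\<^sub>F n in sequentially. ln (max 1 (k n / x)) = 0"
      proof (cases "x = 0")
        case False
        hence "\<forall>\<^sub>F n in sequentially. k n < x" using x klim by (intro order_tendstoD) auto
        thus ?thesis by eventually_elim (use False x in \<open>auto simp: max_def field_simps\<close>)
      qed auto
      thus "\<forall>\<^sub>F n in sequentially. log_peak (k n) \<theta> = 0" by (simp add: x_def)
    qed
  qed
  hence "\<forall>\<^sub>F n in sequentially. integral {- (2 * pi)..2 * pi} (log_peak (k n)) < \<epsilon>"
    using assms by (intro order_tendstoD) auto
  then obtain n where "integral {- (2 * pi)..2 * pi} (log_peak (k n)) < \<epsilon>" by (auto simp: eventually_sequentially)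
  thus ?thesis using that k by blast
qed

text \<open>The choice of \<kappa> must not depend on where the zero \<open>a\<close> lies, inside,
  on or outside the circle. Replacing \<open>a\<close> by its radial projection \<open>b\<close>
  loses a factor 2 in the distance to points of the circle, hence the witness \<open>k / 2\<close>;
  a rotation then leaves one fixed peak.\<close>

lemma circle_log_peak_uniform:
  assumes "\<epsilon> > 0"
  obtains \<kappa> where "0 < \<kappa>" "\<kappa> \<le> 1"
    "\<And>a r. r > 0 \<Longrightarrow> circle_integrable r (\<lambda>z. ln (max 1 (\<kappa> * r / norm (z - a))))"
    "\<And>a r. r > 0 \<Longrightarrow> circle_mean r (\<lambda>z. ln (max 1 (\<kappa> * r / norm (z - a)))) \<le> \<epsilon>"
proof -
  obtain k where k: "0 < k" "k \<le> 1" "integral {- (2 * pi)..2 * pi} (log_peak k) < 2 * pi * \<epsilon>"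
    using log_peak_integral_small[of "2 * pi * \<epsilon>"] assms by auto
  have main: "circle_integrable r (\<lambda>z. ln (max 1 (k / 2 * r / norm (z - a)))) \<and>
     circle_mean r (\<lambda>z. ln (max 1 (k / 2 * r / norm (z - a)))) \<le> \<epsilon>" if r: "r > 0" for a r
  proof -
    define \<phi> where "\<phi> = Arg2pi a"
    have \<phi>: "0 \<le> \<phi>" "\<phi> \<le> 2 * pi" "a = circ (norm a) \<phi>"
      using Arg2pi[of a] by (auto simp: \<phi>_def is_Arg_def)
    define b where "b = circ r \<phi>"
    define F where "F z = ln (max 1 (k / 2 * r / norm (z - a)))" for z
    define G where "G z = ln (max 1 (k * r / norm (z - b)))" for z
    have G: "G (circ r \<theta>) = log_peak k (\<theta> - \<phi>)" for \<theta>
    proof -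
      have "circ r \<theta> - b = of_real r * (exp (\<i> * of_real \<theta>) - exp (\<i> * of_real \<phi>))"
        by (simp add: b_def algebra_simps)
      hence "norm (circ r \<theta> - b) = r * norm (exp (\<i> * of_real (\<theta> - \<phi>)) - 1)"
        using r norm_exp_diff_shift[of \<theta> \<phi>] by (simp only: norm_mult norm_of_real)
      thus ?thesis using r by (simp add: G_def)
    qed
    \<comment> \<open>Rotating the peak from \<phi> to 0 turns [0, 2 pi] into this window, which
      lies inside the two periods where the integral was made small.\<close>
    have sub: "{- \<phi>..2 * pi - \<phi>} \<subseteq> {- (2 * pi)..2 * pi}" using \<phi> by auto
    have ai: "log_peak k absolutely_integrable_on {- \<phi>..2 * pi - \<phi>}"
      by (rule set_integrable_subset[OF log_peak_integrable[OF k(1,2)] _ sub]) auto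
    hence hi: "(log_peak k has_integral integral {- \<phi>..2 * pi - \<phi>} (log_peak k)) {- \<phi>..2 * pi - \<phi>}"
      using set_lebesgue_integral_eq_integral(1) by (intro integrable_integral)
    hence hi2: "((\<lambda>\<theta>. G (circ r \<theta>)) has_integral integral {- \<phi>..2 * pi - \<phi>} (log_peak k)) {0..2 * pi}"
      using has_integral_shift_Icc_real[of "log_peak k" "- \<phi>" _ 0 "2 * pi"] by (simp add: G o_def)
    have G0: "G z \<ge> 0" for z by (simp add: G_def)
    have Gint: "circle_integrable r G"
      unfolding circle_integrable_def
      by (rule nonnegative_absolutely_integrable_1) (use hi2 G0 in \<open>auto simp: integrable_on_def\<close>)
    have "integral {- \<phi>..2 * pi - \<phi>} (log_peak k) \<le> integral {- (2 * pi)..2 * pi} (log_peak k)"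
      by (rule integral_subset_le[OF sub])
         (use ai log_peak_integrable[OF k(1,2)] set_lebesgue_integral_eq_integral(1) in auto)
    hence "integral {0..2*pi} (\<lambda>\<theta>. G (circ r \<theta>)) \<le> 2 * pi * \<epsilon>"
      using k(3) hi2 by (simp add: integral_unique)
    hence Gmean: "circle_mean r G \<le> \<epsilon>" by (simp add: circle_mean_def field_simps)
    have FG: "F z \<le> G z" if z: "norm z = r" "z \<notin> {b}" for z
    proof -
      have eqb: "of_real (norm a / r) * b = a" using r \<phi>(3) by (simp add: b_def)
      have pos: "norm (z - b) > 0" using z by simp
      have "norm (z - b) \<le> 2 * norm (z - a)"
      proof (cases "norm a \<le> r")
        case True
        thus ?thesis using norm_diff_scaled_ge[of z b "norm a / r"] z r unfolding eqb by (simp add: b_def norm_mult)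
      next
        case False
        have "norm (z - b) \<le> norm (z - a) + norm (a - b)" by (metis diff_add_cancel add_diff_eq norm_triangle_ineq)
        also have "a - b = of_real (norm a / r - 1) * b" using eqb by (simp add: algebra_simps)
        hence "norm (a - b) = \<bar>norm a / r - 1\<bar> * norm b" by (simp only: norm_mult norm_of_real)
        hence "norm (a - b) = (norm a / r - 1) * r" using False r by (simp add: b_def)
        hence "norm (a - b) = norm a - r" using r by (simp add: left_diff_distrib)
        also have "norm a - r \<le> norm (z - a)" using norm_triangle_ineq2[of a z] z by (simp add: norm_minus_commute)
        finally show ?thesis by simp
      qed
      hence "k / 2 * r / norm (z - a) \<le> k * r / norm (z - b)"
      proof -
        have "k * r / (2 * norm (z - a)) \<le> k * r / norm (z - b)"
          using \<open>norm (z - b) \<le> 2 * norm (z - a)\<close> pos k(1) r by (intro divide_left_mono mult_pos_pos) auto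
        thus ?thesis by simp
      qed
      thus ?thesis unfolding F_def G_def by (intro ln_mono) auto
    qed
    \<comment> \<open>At \<open>b\<close> division by zero makes \<open>G\<close> vanish, possibly
      below \<open>F\<close>. Changing this one value gives a majorant on the whole circle.\<close>
    define G' where "G' z = (if z \<in> {b} then F z else G z)" for z
    have "F \<in> borel_measurable borel" unfolding F_def by measurable
    moreover have "circle_integrable r G'"
      using circle_spike(1)[of "{b}" r G' G] Gint r by (auto simp: G'_def)
    moreover have "\<bar>F z\<bar> \<le> G' z" if "norm z = \<bar>r\<bar>" for z
      using FG[of z] that r by (auto simp: G'_def F_def)
    ultimately have Fint: "circle_integrable r F" by (rule circle_integrable_bounded[of F r G'])
    have "circle_mean r F \<le> circle_mean r G"
      by (rule circle_mean_mono[of "{b}"]) (use FG r Fint Gint in auto)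
    thus ?thesis using Gmean Fint by (simp add: F_def[abs_def])
  qed
  show ?thesis by (rule that[of "k / 2"]) (use k main in auto)
qed

section \<open>Zeros and Jensen's formula\<close>

definition zeros_in :: "(complex \<Rightarrow> complex) \<Rightarrow> real \<Rightarrow> complex set" where
  "zeros_in g R = {a. norm a \<le> R \<and> g a = 0}"

definition zmult :: "(complex \<Rightarrow> complex) \<Rightarrow> complex \<Rightarrow> nat" where
  "zmult g a = nat (zorder g a)"

section \<open>Factoring zeros out of an entire function\<close>

lemma holomorphic_eventually_nonzero:
  assumes "entire g" "nonnull g"
  shows "eventually (\<lambda>w. g w \<noteq> 0) (at z)"
proof -
  obtain b where "g b \<noteq> 0" using assms by auto
  thus ?thesis using non_zero_neighbour_alt[OF assms(1), of z b] by auto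
qed

lemma finite_zeros_in:
  assumes "entire g" "nonnull g"
  shows "finite (zeros_in g R)"
proof (cases "\<exists>z. g z = 0")
  case True
  have "\<not> g constant_on UNIV" using True assms(2) by (metis constant_on_def UNIV_I)
  hence "finite {z\<in>cball 0 R. g z = 0}"
    using holomorphic_compact_finite_zeros[OF assms(1), of "cball 0 R"] by auto
  thus ?thesis by (rule finite_subset[rotated]) (auto simp: zeros_in_def)
qed (auto simp: zeros_in_def)

lemma factor_out_zero:
  assumes "entire g" "nonnull g"
  obtains h where "entire h" "h a \<noteq> 0" "\<And>z. g z = (z - a) ^ zmult g a * h z"
proof -
  define n where "n = zmult g a"
  define p where "p = zor_poly g a"
  have "(if g a = 0 then zorder g a > 0 else zorder g a = 0) \<and> (\<exists>r. r > 0 \<and> cball a r \<subseteq> UNIV \<and> p holomorphic_on cball a r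
    \<and> (\<forall>w\<in>cball a r. g w  = p w * (w - a) ^ nat (zorder g a) \<and> p w \<noteq> 0))"
    unfolding p_def by (rule zorder_exist_zero) (use assms in auto)
  from conjunct2[OF this] obtain r where r: "r > 0" "p holomorphic_on cball a r"
    and r': "\<forall>w\<in>cball a r. g w  = p w * (w - a) ^ n \<and> p w \<noteq> 0"
    unfolding n_def zmult_def by (elim exE conjE)
  note r = r bspec[OF r']
  define h where "h z = (if z = a then p a else g z / (z - a) ^ n)" for z
  have hp: "h z = p z" if "z \<in> ball a r" for z
    using r(3)[of z] that by (auto simp: h_def)
  have "h holomorphic_on ball a r"
    by (rule holomorphic_transform[OF holomorphic_on_subset[OF r(2) ball_subset_cball]]) (simp add: hp)
  moreover have "h holomorphic_on - {a}"
  proof -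
    have "(\<lambda>z. g z / (z - a) ^ n) holomorphic_on - {a}"
      using assms(1) holomorphic_on_subset by (intro holomorphic_intros) auto
    thus ?thesis by (rule holomorphic_transform) (auto simp: h_def)
  qed
  ultimately have "h holomorphic_on ball a r \<union> (- {a})"
    by (intro holomorphic_on_Un) auto
  moreover have "ball a r \<union> (- {a}) = UNIV" using r by auto
  ultimately have hol: "entire h" by simp
  have eq: "g z = (z - a) ^ n * h z" for z
    using r(1) r(3)[of a] by (cases "z = a") (auto simp: h_def)
  have "h a \<noteq> 0" using r(1) r(3)[of a] by (auto simp: h_def)
  thus ?thesis using that[OF hol, unfolded n_def[symmetric]] eq by blast
qed

lemma zmult_factor_other:
  assumes "entire h" "nonnull h" "\<And>z. g z = (z - a) ^ n * h z" "b \<noteq> a"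
  shows "zmult g b = zmult h b"
proof -
  have "zorder g b = zorder (\<lambda>z. (z - a) ^ n * h z) b" using assms(3) by presburger
  also have "\<dots> = zorder (\<lambda>z. (z - a) ^ n) b + zorder h b"
  proof (rule zorder_times_analytic)
    show "(\<lambda>z. (z - a) ^ n) analytic_on {b}" by (intro analytic_intros)
    show "h analytic_on {b}" using assms(1) analytic_on_holomorphic by blast
    have "eventually (\<lambda>z. z \<noteq> a) (at b)" using assms(4) by (intro eventually_at_in_open'[of "- {a}", simplified]) auto
    thus "eventually (\<lambda>z. (z - a) ^ n * h z \<noteq> 0) (at b)"
      using holomorphic_eventually_nonzero[OF assms(1,2), of b] by eventually_elim auto
  qed
  also have "zorder (\<lambda>z. (z - a) ^ n) b = 0"
    by (rule zorder_eq_0I) (use assms(4) in \<open>auto intro!: analytic_intros\<close>)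
  finally show ?thesis by (simp add: zmult_def)
qed

text \<open>The last clause drives the induction: dividing by one factor leaves the multiplicities
  at all other points unchanged, so every exponent can still be read off \<open>g\<close>.\<close>

lemma factor_out_finite:
  fixes g :: "complex \<Rightarrow> complex"
  assumes "finite Z" "entire g" "nonnull g"
  shows "\<exists>h. h holomorphic_on UNIV \<and> (\<forall>z. g z = (\<Prod>a\<in>Z. (z - a) ^ zmult g a) * h z) \<and> (\<forall>a\<in>Z. h a \<noteq> 0)
       \<and> (\<forall>b. b \<notin> Z \<longrightarrow> zmult h b = zmult g b)"
  using assms(1)
proof induction
  case empty
  show ?case using assms by (intro exI[of _ g]) auto
next
  case (insert a Z)
  then obtain h where h: "entire h" "\<And>z. g z = (\<Prod>a\<in>Z. (z - a) ^ zmult g a) * h z"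
    "\<And>a. a \<in> Z \<Longrightarrow> h a \<noteq> 0" "\<And>b. b \<notin> Z \<Longrightarrow> zmult h b = zmult g b" by blast
  have nz: "nonnull h" using h(2) assms(3) by auto
  obtain k where k: "entire k" "k a \<noteq> 0" "\<And>z. h z = (z - a) ^ zmult h a * k z"
    using factor_out_zero[OF h(1) nz] by blast
  have "zmult h a = zmult g a" using h(4) insert.hyps by blast
  hence "g z = (\<Prod>a\<in>insert a Z. (z - a) ^ zmult g a) * k z" for z
    using insert.hyps h(2)[of z] k(3)[of z] by (simp add: mult_ac)
  moreover have "k b \<noteq> 0" if "b \<in> insert a Z" for b
    using that k(2) h(3)[of b] k(3)[of b] by auto
  moreover have "zmult k b = zmult g b" if b: "b \<notin> insert a Z" for b
  proof -
    have "zmult h b = zmult k b" by (rule zmult_factor_other[OF k(1) _ k(3)]) (use b k(2) in auto)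
    thus ?thesis using h(4)[of b] b by simp
  qed
  ultimately have "entire k \<and> (\<forall>z. g z = (\<Prod>a\<in>insert a Z. (z - a) ^ zmult g a) * k z) \<and>
      (\<forall>a\<in>insert a Z. k a \<noteq> 0) \<and> (\<forall>b. b \<notin> insert a Z \<longrightarrow> zmult k b = zmult g b)"
    using k(1) by simp
  thus ?case by (intro exI[of _ k])
qed

abbreviation (input) zero_prod :: "(complex \<Rightarrow> complex) \<Rightarrow> real \<Rightarrow> complex \<Rightarrow> complex" where
  "zero_prod g R z \<equiv> \<Prod>a\<in>zeros_in g R. (z - a) ^ zmult g a"

abbreviation (input) zero_int_count :: "real \<Rightarrow> (complex \<Rightarrow> complex) \<Rightarrow> real" where
  "zero_int_count r g \<equiv> int_count r (\<lambda>z. 1 / g z)"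

text \<open>Monic factors z - a, rather than 1 - z/a, allow zeros at the origin. The price is a term
  \<open>zero_count g R * ln R\<close> in ln|E|, which has to cancel in every later
  estimate.\<close>

definition cofactor :: "(complex \<Rightarrow> complex) \<Rightarrow> real \<Rightarrow> (complex \<Rightarrow> complex) \<Rightarrow> bool" where
  "cofactor g R E \<longleftrightarrow> E holomorphic_on UNIV \<and>
     (\<forall>z. g z = zero_prod g R z * E z) \<and> (\<forall>z\<in>cball 0 R. E z \<noteq> 0)"

lemma cofactorD:
  assumes "cofactor g R E"
  shows "entire E" "g z = zero_prod g R z * E z"
    "z \<in> cball 0 R \<Longrightarrow> E z \<noteq> 0"
  using assms unfolding cofactor_def by blast+

lemma cofactor_exists:
  assumes "entire g" "nonnull g"
  obtains E where "cofactor g R E"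
proof -
  note fac = factor_out_finite[OF finite_zeros_in[OF assms] assms, of R]
  define E where "E = (SOME h. h holomorphic_on UNIV \<and>
      (\<forall>z. g z = zero_prod g R z * h z) \<and> (\<forall>a\<in>zeros_in g R. h a \<noteq> 0) \<and>
      (\<forall>b. b \<notin> zeros_in g R \<longrightarrow> zmult h b = zmult g b))"
  note E = someI_ex[OF fac, folded E_def]
  have hol: "entire E" using E by (elim conjE)
  have eq: "g z = zero_prod g R z * E z" for z
    using E by (elim conjE allE[of _ z])
  have nz: "E a \<noteq> 0" if "a \<in> zeros_in g R" for a
    using E that by (elim conjE) (rule bspec)
  have nz': "E z \<noteq> 0" if "z \<in> cball 0 R" for z
  proof (cases "g z = 0")
    case True thus ?thesis using nz[of z] that by (simp add: zeros_in_def)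
  next
    case False thus ?thesis using eq[of z] by (metis mult_zero_right)
  qed
  show ?thesis by (rule that[of E], unfold cofactor_def, intro conjI allI ballI hol eq nz')
qed

lemma zmult_pos_iff:
  assumes "entire g" "nonnull g"
  shows "zmult g a > 0 \<longleftrightarrow> g a = 0"
proof -
  have "(if g a = 0 then zorder g a > 0 else zorder g a = 0)"
    using zorder_exist_zero[OF assms(1) open_UNIV connected_UNIV, of a] assms(2) by auto
  thus ?thesis by (auto simp: zmult_def split: if_splits)
qed

lemma inverse_poles:
  assumes "entire g" "nonnull g"
  shows "is_pole (\<lambda>z. 1 / g z) a \<longleftrightarrow> g a = 0" "zorder (\<lambda>z. 1 / g z) a = - zorder g a"
proof -
  have an: "g analytic_on {a}" using assms(1) analytic_on_holomorphic by blast
  have ev: "eventually (\<lambda>w. g w \<noteq> 0) (at a)" by (rule holomorphic_eventually_nonzero[OF assms])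
  have cont: "g \<midarrow>a\<rightarrow> g a"
    using an analytic_at_imp_isCont isCont_def by blast
  have "isolated_zero g a \<longleftrightarrow> g a = 0"
  proof
    assume "isolated_zero g a"
    hence "g \<midarrow>a\<rightarrow> 0" by (simp add: isolated_zero_def)
    thus "g a = 0" using cont LIM_unique by blast
  next
    assume "g a = 0"
    thus "isolated_zero g a" using ev cont by (simp add: isolated_zero_def)
  qed
  thus "is_pole (\<lambda>z. 1 / g z) a \<longleftrightarrow> g a = 0"
    using is_pole_inverse_iff[of g a] by (simp add: inverse_eq_divide)
  have "zorder (\<lambda>z. inverse (g z)) a = - zorder g a"
    by (rule zorder_inverse)
       (simp_all add: an ev isolated_singularity_at_analytic not_essential_analytic eventually_frequently)
  thus "zorder (\<lambda>z. 1 / g z) a = - zorder g a" by (simp add: inverse_eq_divide)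
qed

lemma pole_count_inverse:
  assumes "entire g" "nonnull g"
  shows "pole_count t (\<lambda>z. 1 / g z) = (\<Sum>a\<in>zeros_in g t. zmult g a)"
  unfolding pole_count_def inverse_poles[OF assms] zmult_def zeros_in_def by simp

text \<open>The modulus of the first nonvanishing Taylor coefficient at the origin.\<close>
definition lead :: "(complex \<Rightarrow> complex) \<Rightarrow> real" where
  "lead g = Lim (at 0) (\<lambda>z. norm (g z) / norm z ^ zmult g 0)"

section \<open>The leading coefficient and Jensen's formula\<close>

lemma zeros_in_0: 
  assumes "entire g" "nonnull g"
  shows "(\<Sum>a\<in>zeros_in g 0. zmult g a) = zmult g 0"
proof (cases "g 0 = 0")
  case True
  hence "zeros_in g 0 = {0}" by (auto simp: zeros_in_def)
  thus ?thesis by simp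
next
  case False
  hence "zeros_in g 0 = {}" by (auto simp: zeros_in_def)
  thus ?thesis using False zmult_pos_iff[OF assms, of 0] by simp
qed

lemma sum_zeros_split:
  fixes F :: "complex \<Rightarrow> real"
  assumes "entire g" "nonnull g" "R \<ge> 0"
  shows "(\<Sum>a\<in>zeros_in g R. real (zmult g a) * F a) = real (zmult g 0) * F 0 + (\<Sum>a\<in>zeros_in g R - {0}. real (zmult g a) * F a)"
proof (cases "g 0 = 0")
  case True
  hence "0 \<in> zeros_in g R" using assms(3) by (auto simp: zeros_in_def)
  thus ?thesis using finite_zeros_in[OF assms(1,2)] by (simp add: sum.remove)
next
  case False
  hence "zeros_in g R - {0} = zeros_in g R" by (auto simp: zeros_in_def)
  thus ?thesis using False zmult_pos_iff[OF assms(1,2), of 0] by simp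
qed

lemma prod_zeros_split:
  assumes "entire g" "nonnull g" "R \<ge> 0"
  shows "zero_prod g R z = z ^ zmult g 0 * (\<Prod>a\<in>zeros_in g R - {0}. (z - a) ^ zmult g a)"
proof (cases "g 0 = 0")
  case True
  hence "0 \<in> zeros_in g R" using assms(3) by (auto simp: zeros_in_def)
  thus ?thesis using finite_zeros_in[OF assms(1,2)] by (simp add: prod.remove)
next
  case False
  hence "zeros_in g R - {0} = zeros_in g R" by (auto simp: zeros_in_def)
  thus ?thesis using False zmult_pos_iff[OF assms(1,2), of 0] by simp
qed

text \<open>After division by the power of z the remaining factors are continuous at 0. The constant
  in Jensen's formula is therefore the same for every radius \<open>R\<close>.\<close>

lemma lead_eq:
  assumes "entire g" "nonnull g" "R \<ge> 0"
    "cofactor g R E"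
  shows "lead g = (\<Prod>a\<in>zeros_in g R - {0}. norm a ^ zmult g a) * norm (E 0)"
proof -
  let ?p = "\<lambda>z. (\<Prod>a\<in>zeros_in g R - {0}. norm (z - a) ^ zmult g a) * norm (E z)"
  have "isCont E 0" using holomorphic_on_imp_continuous_on[OF cofactorD(1)[OF assms(4)]] by (simp add: continuous_on_eq_continuous_at)
  hence "isCont ?p 0" by (intro continuous_intros)
  hence "?p \<midarrow>0\<rightarrow> ?p 0" by (simp only: isCont_def)
  moreover have "norm (g z) / norm z ^ zmult g 0 = ?p z" if "z \<noteq> 0" for z
    unfolding cofactorD(2)[OF assms(4), of z] prod_zeros_split[OF assms(1-3)]
    using that by (simp add: norm_mult norm_power prod_norm[symmetric])
  hence "eventually (\<lambda>z. norm (g z) / norm z ^ zmult g 0 = ?p z) (at 0)"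
    by (simp add: eventually_at_filter)
  ultimately have "(\<lambda>z. norm (g z) / norm z ^ zmult g 0) \<midarrow>0\<rightarrow> ?p 0"
    by (simp add: tendsto_cong)
  thus ?thesis unfolding lead_def by (simp add: tendsto_Lim)
qed

lemma ln_lead_eq:
  assumes "entire g" "nonnull g" "R \<ge> 0"
    "cofactor g R E"
  shows "ln (norm (E 0)) = ln (lead g) - (\<Sum>a\<in>zeros_in g R - {0}. real (zmult g a) * ln (norm a))"
proof -
  have "ln (\<Prod>a\<in>zeros_in g R - {0}. norm a ^ zmult g a) = (\<Sum>a\<in>zeros_in g R - {0}. ln (norm a ^ zmult g a))"
    by (rule ln_prod) (use finite_zeros_in[OF assms(1,2)] in auto)
  hence *: "ln (\<Prod>a\<in>zeros_in g R - {0}. norm a ^ zmult g a) = (\<Sum>a\<in>zeros_in g R - {0}. real (zmult g a) * ln (norm a))"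
    by (simp add: ln_realpow)
  have "(\<Prod>a\<in>zeros_in g R - {0}. norm a ^ zmult g a) > 0" by (intro prod_pos) auto
  thus ?thesis unfolding lead_eq[OF assms] using * cofactorD(3)[OF assms(4), of 0] assms(3) by (simp add: ln_mult)
qed

lemma ln_factorization:
  assumes "entire g" "nonnull g"
    "cofactor g R E" "g z \<noteq> 0"
  shows "ln (norm (g z)) = (\<Sum>a\<in>zeros_in g R. real (zmult g a) * ln (norm (z - a))) + ln (norm (E z))"
proof -
  have nz: "E z \<noteq> 0" "zero_prod g R z \<noteq> 0" using cofactorD(2)[OF assms(3), of z] assms(4) by auto
  have ne: "z \<noteq> a" if "a \<in> zeros_in g R" for a using that assms(4) by (auto simp: zeros_in_def)
  have "ln (norm (g z)) = ln (\<Prod>a\<in>zeros_in g R. norm (z - a) ^ zmult g a) + ln (norm (E z))"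
  proof -
    have eq: "(\<Prod>a\<in>zeros_in g R. norm (z - a) ^ zmult g a) = norm (\<Prod>a\<in>zeros_in g R. (z - a) ^ zmult g a)"
      by (simp add: prod_norm[symmetric] norm_power)
    show ?thesis unfolding cofactorD(2)[OF assms(3), of z] norm_mult eq using nz by (subst ln_mult) auto
  qed
  also have "ln (\<Prod>a\<in>zeros_in g R. norm (z - a) ^ zmult g a) = (\<Sum>a\<in>zeros_in g R. ln (norm (z - a) ^ zmult g a))"
    by (rule ln_prod) (use finite_zeros_in[OF assms(1,2)] ne in auto)
  also have "\<dots> = (\<Sum>a\<in>zeros_in g R. real (zmult g a) * ln (norm (z - a)))"
    by (intro sum.cong) (auto simp: ln_realpow ne)
  finally show ?thesis .
qed

lemma has_integral_step_over_t:
  assumes "0 < s" "s \<le> r"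
  shows "((\<lambda>t. if s \<le> t then 1 / t else 0) has_integral (ln r - ln s)) {0..r::real}"
proof -
  have "((\<lambda>t. 1 / t) has_integral (ln r - ln s)) {s..r}"
    by (rule fundamental_theorem_of_calculus)
       (use assms in \<open>auto intro!: derivative_eq_intros simp: has_real_derivative_iff_has_vector_derivative[symmetric]\<close>)
  hence "((\<lambda>t. if t \<in> {s..r} then 1 / t else 0) has_integral (ln r - ln s)) {0..r}"
    by (subst has_integral_restrict) (use assms in auto)
  thus ?thesis by (rule has_integral_eq[rotated]) auto
qed

text \<open>As a function of t, a zero \<open>a\<close> other than 0 contributes 1/t from t = |a|
  onwards, which integrates to ln(r/|a|). The multiplicity at the origin is subtracted in the
  integrand and returns as the ln r term.\<close>

lemma int_count_inverse:
  assumes "entire g" "nonnull g" "r > 0"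
  shows "zero_int_count r g = (\<Sum>a\<in>zeros_in g r - {0}. real (zmult g a) * ln (r / norm a)) + real (zmult g 0) * ln r"
proof -
  have fin: "finite (zeros_in g t)" for t by (rule finite_zeros_in[OF assms(1,2)])
  have p0: "pole_count 0 (\<lambda>z. 1 / g z) = zmult g 0"
    using pole_count_inverse[OF assms(1,2)] zeros_in_0[OF assms(1,2)] by simp
  have eq: "(real (pole_count t (\<lambda>z. 1 / g z)) - real (pole_count 0 (\<lambda>z. 1 / g z))) / t =
      (\<Sum>a\<in>zeros_in g r - {0}. real (zmult g a) * (if norm a \<le> t then 1 / t else 0))" if t: "t \<in> {0..r}" for t
  proof -
    have "(\<Sum>a\<in>zeros_in g r - {0}. real (zmult g a) * (if norm a \<le> t then 1 / t else 0)) =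
      (\<Sum>a\<in>zeros_in g t - {0}. real (zmult g a) * (1 / t))"
      by (rule sum.mono_neutral_cong_right) (use fin t in \<open>auto simp: zeros_in_def\<close>)
    also have "\<dots> = (\<Sum>a\<in>zeros_in g t - {0}. real (zmult g a)) / t" by (simp add: sum_divide_distrib)
    also have "(\<Sum>a\<in>zeros_in g t - {0}. real (zmult g a)) = real (\<Sum>a\<in>zeros_in g t. zmult g a) - real (zmult g 0)"
      using sum_zeros_split[OF assms(1,2), of t "\<lambda>_. 1"] t by simp
    finally show ?thesis unfolding p0 pole_count_inverse[OF assms(1,2), of t] by simp
  qed
  have "((\<lambda>t. \<Sum>a\<in>zeros_in g r - {0}. real (zmult g a) * (if norm a \<le> t then 1 / t else 0)) has_integral
      (\<Sum>a\<in>zeros_in g r - {0}. real (zmult g a) * (ln r - ln (norm a)))) {0..r}"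
    using fin by (intro has_integral_sum has_integral_mult_right has_integral_step_over_t) (auto simp: zeros_in_def)
  hence "((\<lambda>t. (real (pole_count t (\<lambda>z. 1 / g z)) - real (pole_count 0 (\<lambda>z. 1 / g z))) / t) has_integral
      (\<Sum>a\<in>zeros_in g r - {0}. real (zmult g a) * (ln r - ln (norm a)))) {0..r}"
    by (rule has_integral_eq[rotated]) (use eq in simp)
  hence "zero_int_count r g = (\<Sum>a\<in>zeros_in g r - {0}. real (zmult g a) * (ln r - ln (norm a))) + real (zmult g 0) * ln r"
    unfolding int_count_def p0 by (simp add: integral_unique)
  also have "(\<Sum>a\<in>zeros_in g r - {0}. real (zmult g a) * (ln r - ln (norm a))) = (\<Sum>a\<in>zeros_in g r - {0}. real (zmult g a) * ln (r / norm a))"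
    by (intro sum.cong) (use assms(3) in \<open>auto simp: ln_div\<close>)
  finally show ?thesis .
qed

text \<open>In the logarithm of the factorization each z - a with |a| \<le> r has mean ln r,
  wherever \<open>a\<close> lies, and the cofactor contributes ln|E 0|. Zeros on the circle itself
  are included, so no radius is excluded.\<close>

lemma
  assumes "entire g" "nonnull g" "r > 0"
  shows circle_integrable_ln_entire: "circle_integrable r (\<lambda>z. ln (norm (g z)))"
    and Jensen: "log_mean r g = ln (lead g) + zero_int_count r g"
proof -
  obtain E where E: "cofactor g r E"
    using cofactor_exists[OF assms(1,2)] by blast
  have fin: "finite (zeros_in g t)" for t by (rule finite_zeros_in[OF assms(1,2)])
  define F where "F z = (\<Sum>a\<in>zeros_in g r. real (zmult g a) * ln (norm (z - a))) + ln (norm (E z))" for z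
  have lnF: "ln (norm (g z)) = F z" if "norm z = r" "z \<notin> zeros_in g r" for z
    unfolding F_def using that by (intro ln_factorization[OF assms(1,2) E]) (auto simp: zeros_in_def)
  note lin = circle_ln_linear_factor[OF _ assms(3)]
  note Ei = circle_ln_zero_free[OF cofactorD(1)[OF E] cofactorD(3)[OF E] assms(3)]
  have S: "circle_integrable r (\<lambda>z. real (zmult g a) * ln (norm (z - a)))"
    "circle_mean r (\<lambda>z. real (zmult g a) * ln (norm (z - a))) = real (zmult g a) * ln r" if "a \<in> zeros_in g r" for a
    using lin[of a] that by (auto simp: zeros_in_def circle_mean_cmult intro: circle_integrable_cmult)
  have Si: "circle_integrable r (\<lambda>z. \<Sum>a\<in>zeros_in g r. real (zmult g a) * ln (norm (z - a)))"
    using fin S(1) by (rule circle_integrable_sum)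
  have Fi: "circle_integrable r F" unfolding F_def using Si Ei(1) by (rule circle_integrable_add)
  thus "circle_integrable r (\<lambda>z. ln (norm (g z)))"
    using circle_spike(1)[OF fin assms(3) lnF] by simp
  have "log_mean r g = circle_mean r F"
    using circle_spike(2)[OF fin assms(3) lnF] by simp
  also have "\<dots> = (\<Sum>a\<in>zeros_in g r. real (zmult g a) * ln r) + ln (norm (E 0))"
    unfolding F_def using circle_mean_add[OF Si Ei(1)] circle_mean_sum[OF fin S(1)] S(2) Ei(2) by simp
  also have "(\<Sum>a\<in>zeros_in g r. real (zmult g a) * ln r) = real (zmult g 0) * ln r + (\<Sum>a\<in>zeros_in g r - {0}. real (zmult g a) * ln r)"
    using sum_zeros_split[OF assms(1,2), of r "\<lambda>_. ln r"] assms(3) by simp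
  also have "ln (norm (E 0)) = ln (lead g) - (\<Sum>a\<in>zeros_in g r - {0}. real (zmult g a) * ln (norm a))"
    using assms(3) by (intro ln_lead_eq[OF assms(1,2) _ E]) auto
  also have "real (zmult g 0) * ln r + (\<Sum>a\<in>zeros_in g r - {0}. real (zmult g a) * ln r) +
      (ln (lead g) - (\<Sum>a\<in>zeros_in g r - {0}. real (zmult g a) * ln (norm a))) =
      ln (lead g) + ((\<Sum>a\<in>zeros_in g r - {0}. real (zmult g a) * (ln r - ln (norm a))) + real (zmult g 0) * ln r)"
    by (simp add: sum_subtractf right_diff_distrib)
  also have "(\<Sum>a\<in>zeros_in g r - {0}. real (zmult g a) * (ln r - ln (norm a))) = (\<Sum>a\<in>zeros_in g r - {0}. real (zmult g a) * ln (r / norm a))"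
    by (intro sum.cong) (use assms(3) in \<open>auto simp: ln_div\<close>)
  finally show "log_mean r g = ln (lead g) + zero_int_count r g"
    unfolding int_count_inverse[OF assms] .
qed

lemma int_count_nonneg:
  assumes "entire g" "nonnull g" "r \<ge> 1"
  shows "zero_int_count r g \<ge> 0"
proof -
  have r: "r > 0" using assms by simp
  have "real (zmult g a) * ln (r / norm a) \<ge> 0" if "a \<in> zeros_in g r - {0}" for a
    using that r by (intro mult_nonneg_nonneg ln_ge_zero) (auto simp: zeros_in_def field_simps)
  thus ?thesis unfolding int_count_inverse[OF assms(1,2) r] using assms(3)
    by (intro add_nonneg_nonneg sum_nonneg) auto
qed

definition zero_count :: "(complex \<Rightarrow> complex) \<Rightarrow> real \<Rightarrow> real" where
  "zero_count g R = (\<Sum>a\<in>zeros_in g R. real (zmult g a))"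

lemma zero_count_nonneg: "zero_count g R \<ge> 0"
  unfolding zero_count_def by (intro sum_nonneg) auto

text \<open>Enlarging the radius by the factor e gives every zero with |a| \<le> R a weight ln(e R /
  |a|) of at least 1.\<close>

lemma zero_count_le_int_count:
  assumes "entire g" "nonnull g" "R \<ge> 1"
  shows "zero_count g R \<le> zero_int_count (exp 1 * R) g"
proof -
  have e: "exp (1::real) \<ge> 1" by simp
  have R: "R > 0" "exp 1 * R > 0" "R \<le> exp 1 * R" using assms(3) mult_right_mono[OF e, of R] by auto
  have fin: "finite (zeros_in g t)" for t by (rule finite_zeros_in[OF assms(1,2)])
  have "zero_count g R = real (zmult g 0) + (\<Sum>a\<in>zeros_in g R - {0}. real (zmult g a))"
    using sum_zeros_split[OF assms(1,2), of R "\<lambda>_. 1"] R by (simp add: zero_count_def)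
  also have "(\<Sum>a\<in>zeros_in g R - {0}. real (zmult g a)) \<le> (\<Sum>a\<in>zeros_in g R - {0}. real (zmult g a) * ln (exp 1 * R / norm a))"
  proof (rule sum_mono)
    fix a assume a: "a \<in> zeros_in g R - {0}"
    have "exp 1 \<le> exp 1 * R / norm a" using a by (auto simp: zeros_in_def field_simps)
    hence "1 \<le> ln (exp 1 * R / norm a)" using a R by (subst ln_ge_iff) auto
    thus "real (zmult g a) \<le> real (zmult g a) * ln (exp 1 * R / norm a)"
      using mult_left_mono[of 1 "ln (exp 1 * R / norm a)" "real (zmult g a)"] by simp
  qed
  also have "\<dots> \<le> (\<Sum>a\<in>zeros_in g (exp 1 * R) - {0}. real (zmult g a) * ln (exp 1 * R / norm a))"
  proof (rule sum_mono2)
    show "0 \<le> real (zmult g b) * ln (exp 1 * R / norm b)" if "b \<in> zeros_in g (exp 1 * R) - {0} - (zeros_in g R - {0})" for b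
      using that by (intro mult_nonneg_nonneg ln_ge_zero) (auto simp: zeros_in_def field_simps)
  next
    show "zeros_in g R - {0} \<subseteq> zeros_in g (exp 1 * R) - {0}"
      using R(3) by (auto simp: zeros_in_def intro: order_trans)
  qed (use fin in simp)
  also have "real (zmult g 0) \<le> real (zmult g 0) * ln (exp 1 * R)"
    using assms(3) mult_left_mono[of 1 "ln (exp 1 * R)" "real (zmult g 0)"] by (simp add: ln_mult)
  finally show ?thesis unfolding int_count_inverse[OF assms(1,2) R(2)] by simp
qed

section \<open>Borel-Caratheodory and Poisson-Jensen inequalities\<close>

text \<open>The map u / (2 A - u) takes the half-plane Re u < A into the unit disc and fixes 0.
  Schwarz's lemma bounds \<open>\<psi>\<close> by 1/2 at half the radius, and solving |u| \<le> (2 A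
  + |u|) / 2 gives the constant 2.\<close>

lemma Borel_Caratheodory_strict:
  assumes "L holomorphic_on ball 0 R" "\<And>z. z \<in> ball 0 R \<Longrightarrow> Re (L z) < U" "norm z \<le> R / 2" "R > 0"
  shows "norm (L z - L 0) \<le> 2 * (U - Re (L 0))"
proof -
  define A where "A = U - Re (L 0)"
  have A: "A > 0" using assms(2)[of 0] assms(4) by (simp add: A_def)
  define \<psi> where "\<psi> w = (L (of_real R * w) - L 0) / (of_real (2 * A) - (L (of_real R * w) - L 0))" for w
  have in_ball: "of_real R * w \<in> ball (0::complex) R" if "norm w < 1" for w
    using that assms(4) by (simp add: norm_mult)
  have lt: "norm u < norm (of_real (2 * A) - u)" if "Re u < A" for u :: complex
  proof -
    have "norm (of_real (2 * A) - u) ^ 2 - norm u ^ 2 = 4 * A * (A - Re u)"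
      by (simp only: cmod_power2) (simp add: power2_eq_square algebra_simps)
    also have "\<dots> > 0" using that A by simp
    finally have "(norm u)\<^sup>2 < (norm (of_real (2 * A) - u))\<^sup>2" by simp
    thus ?thesis by (rule power2_less_imp_less) simp
  qed
  have lt': "norm (L (of_real R * w) - L 0) < norm (of_real (2 * A) - (L (of_real R * w) - L 0))" if "norm w < 1" for w
    using assms(2)[OF in_ball[OF that]] by (intro lt) (simp add: A_def)
  have den: "of_real (2 * A) - (L (of_real R * w) - L 0) \<noteq> 0" if "norm w < 1" for w
    using lt'[OF that] by auto
  have hol: "\<psi> holomorphic_on ball 0 1"
  proof -
    have "(\<lambda>w. of_real R * w) ` ball 0 1 \<subseteq> ball (0::complex) R"
      by (intro image_subsetI in_ball) simp
    moreover have "(\<lambda>w. of_real R * w :: complex) holomorphic_on ball 0 1" by (intro holomorphic_intros)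
    ultimately have "(L \<circ> (\<lambda>w. of_real R * w)) holomorphic_on ball 0 1"
      using holomorphic_on_compose_gen[OF _ assms(1)] by blast
    hence "(\<lambda>w. L (of_real R * w)) holomorphic_on ball 0 1" by (simp add: o_def)
    thus ?thesis unfolding \<psi>_def using den by (intro holomorphic_intros) auto
  qed
  have \<psi>0: "\<psi> 0 = 0" by (simp add: \<psi>_def)
  have \<psi>1: "norm (\<psi> w) < 1" if "norm w < 1" for w
    using lt'[OF that] den[OF that] by (simp add: \<psi>_def norm_divide)
  define w where "w = z / of_real R"
  have w: "norm w \<le> 1 / 2" using assms(3,4) by (simp add: w_def norm_divide field_simps)
  hence w1: "norm w < 1" by simp
  have "norm (\<psi> w) \<le> norm w" by (rule Schwarz_Lemma(1)[OF hol \<psi>0 \<psi>1 w1])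
  hence small: "norm (\<psi> w) \<le> 1 / 2" using w by simp
  define u where "u = L z - L 0"
  have "of_real R * w = z" using assms(4) by (simp add: w_def)
  hence "\<psi> w * (of_real (2 * A) - u) = u" using den[OF w1] by (simp add: \<psi>_def u_def)
  hence "norm u = norm (\<psi> w) * norm (of_real (2 * A) - u)" by (metis norm_mult)
  also have "\<dots> \<le> 1 / 2 * norm (of_real (2 * A) - u)" using small by (intro mult_right_mono) auto
  also have "norm (of_real (2 * A) - u) \<le> norm (of_real (2 * A) :: complex) + norm u" by (rule norm_triangle_ineq4)
  also have "norm (of_real (2 * A) :: complex) = 2 * A" using A by (simp only: norm_of_real)
  finally show ?thesis by (simp add: u_def A_def)
qed

lemma Borel_Caratheodory:
  assumes "L holomorphic_on ball 0 R" "\<And>z. z \<in> ball 0 R \<Longrightarrow> Re (L z) \<le> U" "norm z \<le> R / 2" "R > 0"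
  shows "norm (L z - L 0) \<le> 2 * (U - Re (L 0))"
proof (rule field_le_epsilon)
  fix e :: real assume e: "e > 0"
  have "Re (L z) < U + e / 2" if "z \<in> ball 0 R" for z using assms(2)[OF that] e by simp
  from Borel_Caratheodory_strict[OF assms(1) this assms(3,4)]
  show "norm (L z - L 0) \<le> 2 * (U - Re (L 0)) + e" by simp
qed

lemma log_plus_nonneg: "log_plus x \<ge> 0" by (simp add: log_plus_def)

lemma ln_le_log_plus: "x \<ge> 0 \<Longrightarrow> ln x \<le> log_plus x"
  by (cases "x = 0") (auto simp: log_plus_def intro: ln_mono)

lemma log_plus_norm_circle_integrable:
  assumes "entire g" "r > 0"
  shows "circle_integrable r (\<lambda>z. log_plus (norm (g z)))"
proof (rule continuous_circle_integrable[OF _ assms(2)])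
  have "continuous_on (sphere 0 r) g" using assms(1) holomorphic_on_imp_continuous_on continuous_on_subset by blast
  thus "continuous_on (sphere 0 r) (\<lambda>z. log_plus (norm (g z)))"
    unfolding log_plus_def by (intro continuous_intros) (auto simp: max_def)
qed

text \<open>For |w| \<le> r/2 the Poisson kernel lies between 0 and (r + |w|) / (r - |w|) \<le> 3. A
  nonnegative majorant \<open>G\<close> is used so that the kernel may be replaced by this
  constant.\<close>

lemma Poisson_inequality:
  fixes L :: "complex \<Rightarrow> complex"
  assumes "L holomorphic_on ball 0 t'" "r < t'" "r > 0" "norm w \<le> r / 2"
    "\<And>z. norm z = r \<Longrightarrow> Re (L z) \<le> G z" "\<And>z. norm z = r \<Longrightarrow> 0 \<le> G z" "circle_integrable r G"
  shows "Re (L w) \<le> 3 * circle_mean r G"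
proof -
  have w: "norm w < r" using assms(3,4) by linarith
  have sub: "cball 0 r \<subseteq> ball (0::complex) t'" using assms(2) by auto
  define k where "k z = of_real (r\<^sup>2 - (norm w)\<^sup>2) / (of_real (r\<^sup>2) - cnj w * z)" for z
  have den: "of_real (r\<^sup>2) - cnj w * z \<noteq> 0" if "norm z \<le> r" for z
  proof
    assume "of_real (r\<^sup>2) - cnj w * z = 0"
    hence "norm (of_real (r\<^sup>2) :: complex) = norm (cnj w * z)" by simp
    hence "r * r = norm w * norm z" by (simp add: norm_mult norm_power power2_eq_square)
    also have "\<dots> \<le> norm w * r" using that by (intro mult_left_mono) auto
    also have "\<dots> < r * r" using w assms(3) by simp
    finally show False by simp
  qed
  have hol: "(\<lambda>z. L z * k z) holomorphic_on cball 0 r"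
    unfolding k_def using holomorphic_on_subset[OF assms(1) sub] den by (intro holomorphic_intros) auto
  \<comment> \<open>Cauchy's formula for \<open>L k\<close> turns the Cauchy kernel into the Poisson kernel \<open>P\<close>, and \<open>k w = 1\<close>.\<close>
  have I: "((\<lambda>t. L (circ r t) * k (circ r t) * (circ r t / (circ r t - w))) has_integral (2 * pi * (L w * k w))) {0..2*pi}"
    by (rule Cauchy_circle_has_integral[of r "\<lambda>z. L z * k z" w])
       (use hol w in \<open>auto intro: holomorphic_on_imp_continuous_on holomorphic_on_subset\<close>)
  have kw: "k w = 1"
  proof -
    have "of_real (r\<^sup>2) - cnj w * w = of_real (r\<^sup>2 - (norm w)\<^sup>2)"
      by (simp add: complex_norm_square mult.commute del: of_real_power)
    thus ?thesis unfolding k_def using den[of w] w by simp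
  qed
  define P where "P z = (r\<^sup>2 - (norm w)\<^sup>2) / (norm (z - w))\<^sup>2" for z
  have kP: "k z * (z / (z - w)) = of_real (P z)" if z: "norm z = r" for z
  proof -
    have zz: "of_real (r\<^sup>2) = z * cnj z" using z complex_norm_square[of z] by simp
    have ne: "z \<noteq> 0" "z - w \<noteq> 0" using z w assms(3) by auto
    have "of_real (r\<^sup>2) - cnj w * z = z * cnj (z - w)" unfolding zz by (simp add: algebra_simps)
    hence "k z * (z / (z - w)) = of_real (r\<^sup>2 - (norm w)\<^sup>2) / (z * cnj (z - w)) * (z / (z - w))"
      unfolding k_def by simp
    also have "\<dots> = of_real (r\<^sup>2 - (norm w)\<^sup>2) / ((z - w) * cnj (z - w))"
      using ne by (simp add: mult_ac)
    also have "\<dots> = of_real (P z)" unfolding complex_norm_square[symmetric] P_def by simp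
    finally show ?thesis .
  qed
  have P: "0 \<le> P z \<and> P z \<le> 3" if z: "norm z = r" for z
  proof -
    have pos: "norm (z - w) > 0" using z w by auto
    have "r - norm w \<le> norm (z - w)" using norm_triangle_ineq2[of z w] z by simp
    hence "(r - norm w)\<^sup>2 \<le> (norm (z - w))\<^sup>2" using w by (intro power_mono) auto
    moreover have "r\<^sup>2 - (norm w)\<^sup>2 \<le> 3 * (r - norm w)\<^sup>2"
    proof -
      have "r + norm w \<le> 3 * (r - norm w)" using assms(4) by simp
      hence "(r + norm w) * (r - norm w) \<le> 3 * (r - norm w) * (r - norm w)"
        using w by (intro mult_right_mono) auto
      thus ?thesis by (simp add: power2_eq_square algebra_simps)
    qed
    ultimately have "r\<^sup>2 - (norm w)\<^sup>2 \<le> 3 * (norm (z - w))\<^sup>2" by linarith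
    moreover have "r\<^sup>2 - (norm w)\<^sup>2 \<ge> 0" using w by (simp add: power_mono)
    ultimately show ?thesis using pos by (simp add: P_def field_simps)
  qed
  have J: "((\<lambda>t. P (circ r t) * Re (L (circ r t))) has_integral (2 * pi * Re (L w))) {0..2*pi}"
  proof -
    have "((\<lambda>t. Re (L (circ r t) * k (circ r t) * (circ r t / (circ r t - w)))) has_integral Re (2 * pi * (L w * k w))) {0..2*pi}"
      using has_integral_linear[OF I bounded_linear_Re] by (simp add: o_def)
    moreover have "Re (L (circ r t) * k (circ r t) * (circ r t / (circ r t - w))) = P (circ r t) * Re (L (circ r t))" for t
    proof -
      have "L (circ r t) * k (circ r t) * (circ r t / (circ r t - w)) = L (circ r t) * (k (circ r t) * (circ r t / (circ r t - w)))"
        by (rule mult.assoc)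
      also have "k (circ r t) * (circ r t / (circ r t - w)) = of_real (P (circ r t))"
        by (rule kP) (use assms(3) in simp)
      finally have "L (circ r t) * k (circ r t) * (circ r t / (circ r t - w)) = L (circ r t) * of_real (P (circ r t))" .
      thus ?thesis by simp
    qed
    ultimately show ?thesis by (simp add: kw)
  qed
  have "2 * pi * Re (L w) \<le> integral {0..2*pi} (\<lambda>t. 3 * G (circ r t))"
    unfolding integral_unique[OF J, symmetric]
  proof (rule integral_le)
    show "(\<lambda>t. P (circ r t) * Re (L (circ r t))) integrable_on {0..2*pi}" using J by blast
    show "(\<lambda>t. 3 * G (circ r t)) integrable_on {0..2*pi}"
      using circle_integrable_imp_integrable[OF circle_integrable_cmult[OF assms(7)]] .
    show "P (circ r t) * Re (L (circ r t)) \<le> 3 * G (circ r t)" for t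
    proof -
      have n: "norm (circ r t) = r" using assms(3) by simp
      have "P (circ r t) * Re (L (circ r t)) \<le> P (circ r t) * G (circ r t)"
        using P[OF n] assms(5)[OF n] by (intro mult_left_mono) auto
      also have "\<dots> \<le> 3 * G (circ r t)" using P[OF n] assms(6)[OF n] by (intro mult_right_mono) auto
      finally show ?thesis .
    qed
  qed
  thus ?thesis by (simp add: circle_mean_def field_simps)
qed

text \<open>The passage from means to pointwise bounds. Zeros inside the disc are reflected away,
  which makes the Poisson inequality applicable to a logarithm; the circle is kept free of zeros so
  that this logarithm exists beyond it.\<close>

lemma norm_le_proximity:
  assumes b: "entire b" and r: "r > 0" and nz: "\<And>z. norm z = r \<Longrightarrow> b z \<noteq> 0" and w: "norm w \<le> r / 2"
  shows "norm (b w) \<le> exp (3 * proximity r b)"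
proof -
  have ex: "nonnull b" using nz[of "of_real r"] r by auto
  obtain E where E: "cofactor b r E" using cofactor_exists[OF b ex] by blast
  have fin: "finite (zeros_in b r)" by (rule finite_zeros_in[OF b ex])
  have ain: "norm a < r" if "a \<in> zeros_in b r" for a
    using that nz[of a] by (auto simp: zeros_in_def less_le)
  define F where "F z = (\<Prod>a\<in>zeros_in b r. ((of_real (r\<^sup>2) - cnj a * z) / of_real r) ^ zmult b a) * E z" for z
  have holF: "entire F"
    unfolding F_def using cofactorD(1)[OF E] r by (intro holomorphic_intros) auto
  \<comment> \<open>\<^term>\<open>F\<close> replaces each factor \<open>z - a\<close> by its Blaschke reflection: same modulus on the circle, larger inside.\<close>
  have eqn: "norm ((of_real (r\<^sup>2) - cnj a * z) / of_real r) = norm (z - a)" if "norm z = r" for a z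
  proof -
    have "of_real (r\<^sup>2) = z * cnj z" using that complex_norm_square[of z] by simp
    hence "of_real (r\<^sup>2) - cnj a * z = z * cnj (z - a)" by (simp add: algebra_simps)
    hence "norm (of_real (r\<^sup>2) - cnj a * z) = r * norm (z - a)"
      using that by (simp only: norm_mult complex_mod_cnj)
    thus ?thesis using r by (simp add: norm_divide)
  qed
  \<comment> \<open>Writing \<open>R\<close> for r^2 makes this a polynomial identity in real and
    imaginary parts. Its right side is nonnegative inside the disc, so reflection cannot decrease
    the modulus there.\<close>
  have gen: "(norm (of_real (r\<^sup>2) - cnj a * z))\<^sup>2 - (r * norm (z - a))\<^sup>2 = (r\<^sup>2 - (norm z)\<^sup>2) * (r\<^sup>2 - (norm a)\<^sup>2)" for a z
  proof -
    have "(norm (of_real R - cnj a * z))\<^sup>2 - R * (norm (z - a))\<^sup>2 = (R - (norm z)\<^sup>2) * (R - (norm a)\<^sup>2)" for R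
      by (simp only: cmod_power2) (simp add: power2_eq_square algebra_simps)
    from this[of "r\<^sup>2"] show ?thesis by (simp only: power_mult_distrib)
  qed
  have ge: "norm (z - a) \<le> norm ((of_real (r\<^sup>2) - cnj a * z) / of_real r)" if "norm z \<le> r" "norm a < r" for a z
  proof -
    have "(r\<^sup>2 - (norm z)\<^sup>2) * (r\<^sup>2 - (norm a)\<^sup>2) \<ge> 0"
      using that by (intro mult_nonneg_nonneg) (auto intro!: power_mono)
    hence "(r * norm (z - a))\<^sup>2 \<le> (norm (of_real (r\<^sup>2) - cnj a * z))\<^sup>2" using gen[of a z] by linarith
    hence "r * norm (z - a) \<le> norm (of_real (r\<^sup>2) - cnj a * z)" by (rule power2_le_imp_le) auto
    thus ?thesis using r by (simp add: norm_divide field_simps)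
  qed
  have nzF: "F z \<noteq> 0" if z: "z \<in> cball 0 r" for z
  proof -
    have "of_real (r\<^sup>2) - cnj a * z \<noteq> 0" if a: "a \<in> zeros_in b r" for a
    proof
      assume "of_real (r\<^sup>2) - cnj a * z = 0"
      hence "norm (of_real (r\<^sup>2) :: complex) = norm (cnj a * z)" by simp
      hence "r * r = norm a * norm z" by (simp add: norm_mult norm_power power2_eq_square)
      also have "\<dots> \<le> norm a * r" using z by (intro mult_left_mono) auto
      also have "\<dots> < r * r" using ain[OF a] r by simp
      finally show False by simp
    qed
    thus ?thesis using cofactorD(3)[OF E z] r fin by (auto simp: F_def)
  qed
  have Fb: "norm (F z) = norm (b z)" if "norm z = r" for z
    unfolding F_def cofactorD(2)[OF E, of z] using eqn[OF that] by (simp add: norm_mult prod_norm[symmetric] norm_power)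
  obtain t where t: "t > r" "\<And>z. z \<in> ball 0 t \<Longrightarrow> F z \<noteq> 0"
    using zero_free_neighbourhood[OF holF nzF less_imp_le[OF r]] by blast
  have "F holomorphic_on ball 0 t" using holF holomorphic_on_subset by blast
  then obtain L where L: "L holomorphic_on ball 0 t" "\<And>z. z \<in> ball 0 t \<Longrightarrow> exp (L z) = F z"
    using holomorphic_logarithm_exists[of "ball 0 t" F 0] t r by (auto)
  have nL: "norm (F z) = exp (Re (L z))" if "norm z < t" for z
    using L(2)[of z] that by (metis mem_ball_0 norm_exp_eq_Re)
  have "Re (L w) \<le> 3 * circle_mean r (\<lambda>z. log_plus (cmod (b z)))"
  proof (rule Poisson_inequality[OF L(1) t(1) r w])
    show "Re (L z) \<le> log_plus (cmod (b z))" if "norm z = r" for z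
    proof -
      have "ln (norm (b z)) = Re (L z)" using nL[of z] Fb[OF that] that t(1) by simp
      thus ?thesis using ln_le_log_plus[of "norm (b z)"] by simp
    qed
    show "circle_integrable r (\<lambda>z. log_plus (cmod (b z)))" by (rule log_plus_norm_circle_integrable[OF b r])
  qed (rule log_plus_nonneg)
  hence 1: "norm (F w) \<le> exp (3 * proximity r b)"
    using nL[of w] w t(1) r by (simp add: proximity_eq_circle_mean)
  have "norm (b w) \<le> norm (F w)"
    unfolding F_def cofactorD(2)[OF E, of w] norm_mult prod_norm[symmetric] norm_power
    by (intro mult_right_mono prod_mono) (use ge[of w] ain w r in \<open>auto intro!: power_mono\<close>)
  thus ?thesis using 1 by simp
qed

lemma nev_char_entire:
  assumes "entire g"
  shows "nev_char r g = proximity r g"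
proof -
  have "\<not> is_pole g z" for z
    using not_is_pole_holomorphic[OF open_UNIV _ assms, of z] by simp
  hence "pole_count t g = 0" for t by (simp add: pole_count_def)
  thus ?thesis by (simp add: nev_char_def int_count_def)
qed

section \<open>Entire functions that are small compared with \<open>exp (r\<^sup>q)\<close>\<close>

text \<open>Growth of order at most \<open>q\<close> and minimal type: log M(r) = o(r^q). Closure
  under sums, products, shifts and derivatives lets this class absorb all factors that accompany
  exp(a z^q).\<close>

definition small :: "nat \<Rightarrow> (complex \<Rightarrow> complex) \<Rightarrow> bool" where
  "small q A \<longleftrightarrow> A holomorphic_on UNIV \<and> (\<forall>e>0. \<exists>R. \<forall>z. norm z \<ge> R \<longrightarrow> norm (A z) \<le> exp (e * norm z ^ q))"

lemma smallI:
  assumes "entire A" "\<And>e. e > 0 \<Longrightarrow> \<exists>R. \<forall>z. norm z \<ge> R \<longrightarrow> norm (A z) \<le> exp (e * norm z ^ q)"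
  shows "small q A"
  using assms unfolding small_def by blast

lemma small_holomorphic: "small q A \<Longrightarrow> A holomorphic_on UNIV"
  unfolding small_def by blast

lemma smallE:
  assumes "small q A" "e > 0"
  obtains R where "R \<ge> 1" "\<And>z. norm z \<ge> R \<Longrightarrow> norm (A z) \<le> exp (e * norm z ^ q)"
proof -
  obtain R where R: "\<forall>z. norm z \<ge> R \<longrightarrow> norm (A z) \<le> exp (e * norm z ^ q)"
    using assms unfolding small_def by blast
  show ?thesis by (rule that[of "max 1 R"]) (use R in auto)
qed

lemma small_polynomial_growth:
  assumes "entire A" "q \<ge> 1" "\<And>z. norm z \<ge> 1 \<Longrightarrow> norm (A z) \<le> C * norm z ^ k"
  shows "small q A"
proof (rule smallI[OF assms(1)])
  fix e :: real assume e: "e > 0"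
  have "((\<lambda>r::real. C * r ^ k / exp (e * r)) \<longlongrightarrow> 0) at_top"
  proof -
    have "((\<lambda>r. (e * r) ^ k / exp (e * r)) \<longlongrightarrow> 0) at_top"
      by (rule filterlim_compose[OF tendsto_power_div_exp_0])
         (use e in \<open>auto intro!: filterlim_tendsto_pos_mult_at_top[OF tendsto_const] filterlim_ident\<close>)
    hence "((\<lambda>r. C / e ^ k * ((e * r) ^ k / exp (e * r))) \<longlongrightarrow> C / e ^ k * 0) at_top"
      by (rule tendsto_mult_left)
    thus ?thesis using e by (simp add: power_mult_distrib)
  qed
  hence "eventually (\<lambda>r::real. C * r ^ k / exp (e * r) < 1) at_top" by (rule order_tendstoD) simp
  then obtain R where R: "\<And>r. r \<ge> R \<Longrightarrow> C * r ^ k / exp (e * r) < 1" by (auto simp: eventually_at_top_linorder)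
  show "\<exists>R. \<forall>z. norm z \<ge> R \<longrightarrow> norm (A z) \<le> exp (e * norm z ^ q)"
  proof (intro exI[of _ "max 1 R"] allI impI)
    fix z :: complex assume z: "norm z \<ge> max 1 R"
    have "norm (A z) \<le> C * norm z ^ k" using assms(3) z by simp
    also have "\<dots> \<le> exp (e * norm z)" using R[of "norm z"] z by (simp add: divide_less_eq)
    also have "\<dots> \<le> exp (e * norm z ^ q)" using e z assms(2) self_le_power[of "norm z" q] by simp
    finally show "norm (A z) \<le> exp (e * norm z ^ q)" .
  qed
qed

lemma const_le_power:
  assumes "e > 0" "q \<ge> 1"
  shows "\<exists>R::real. \<forall>r\<ge>R. c \<le> e * r ^ q"
proof (intro exI[of _ "max 1 (\<bar>c\<bar> / e)"] allI impI)
  fix r :: real assume r: "r \<ge> max 1 (\<bar>c\<bar> / e)"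
  have "c \<le> \<bar>c\<bar>" by simp
  also have "\<dots> \<le> e * r" using r assms by (simp add: field_simps)
  also have "\<dots> \<le> e * r ^ q" using r assms self_le_power[of r q] by simp
  finally show "c \<le> e * r ^ q" .
qed

lemma small_const: "q \<ge> 1 \<Longrightarrow> small q (\<lambda>_. c)"
  by (rule small_polynomial_growth[where k = 0 and C = "norm c"]) auto

lemma small_mult:
  assumes "small q A" "small q B"
  shows "small q (\<lambda>z. A z * B z)"
proof (rule smallI)
  show "(\<lambda>z. A z * B z) holomorphic_on UNIV"
    using assms[THEN small_holomorphic] by (intro holomorphic_intros)
  fix e :: real assume "e > 0"
  hence e: "e / 2 > 0" by simp
  obtain R1 where R1: "\<And>z. norm z \<ge> R1 \<Longrightarrow> norm (A z) \<le> exp (e / 2 * norm z ^ q)" using smallE[OF assms(1) e] by blast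
  obtain R2 where R2: "\<And>z. norm z \<ge> R2 \<Longrightarrow> norm (B z) \<le> exp (e / 2 * norm z ^ q)" using smallE[OF assms(2) e] by blast
  show "\<exists>R. \<forall>z. norm z \<ge> R \<longrightarrow> norm (A z * B z) \<le> exp (e * norm z ^ q)"
  proof (intro exI[of _ "max R1 R2"] allI impI)
    fix z :: complex assume z: "norm z \<ge> max R1 R2"
    have "norm (A z * B z) \<le> exp (e / 2 * norm z ^ q) * exp (e / 2 * norm z ^ q)"
      unfolding norm_mult using R1[of z] R2[of z] z by (intro mult_mono) auto
    thus "norm (A z * B z) \<le> exp (e * norm z ^ q)" by (simp add: exp_add[symmetric])
  qed
qed

lemma small_add:
  assumes "small q A" "small q B" "q \<ge> 1"
  shows "small q (\<lambda>z. A z + B z)"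
proof (rule smallI)
  show "(\<lambda>z. A z + B z) holomorphic_on UNIV"
    using assms(1,2)[THEN small_holomorphic] by (intro holomorphic_intros)
  fix e :: real assume "e > 0"
  hence e: "e / 2 > 0" by simp
  obtain R1 where R1: "\<And>z. norm z \<ge> R1 \<Longrightarrow> norm (A z) \<le> exp (e / 2 * norm z ^ q)" using smallE[OF assms(1) e] by blast
  obtain R2 where R2: "\<And>z. norm z \<ge> R2 \<Longrightarrow> norm (B z) \<le> exp (e / 2 * norm z ^ q)" using smallE[OF assms(2) e] by blast
  obtain R3 where R3: "\<And>r. r \<ge> R3 \<Longrightarrow> ln 2 \<le> e / 2 * r ^ q" using const_le_power[OF e assms(3)] by blast
  show "\<exists>R. \<forall>z. norm z \<ge> R \<longrightarrow> norm (A z + B z) \<le> exp (e * norm z ^ q)"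
  proof (intro exI[of _ "max R1 (max R2 R3)"] allI impI)
    fix z :: complex assume z: "norm z \<ge> max R1 (max R2 R3)"
    have "norm (A z + B z) \<le> norm (A z) + norm (B z)" by (rule norm_triangle_ineq)
    also have "\<dots> \<le> exp (ln 2) * exp (e / 2 * norm z ^ q)" using R1[of z] R2[of z] z by simp
    also have "\<dots> = exp (ln 2 + e / 2 * norm z ^ q)" by (simp add: exp_add)
    also have "\<dots> \<le> exp (e * norm z ^ q)" using R3[of "norm z"] z by simp
    finally show "norm (A z + B z) \<le> exp (e * norm z ^ q)" .
  qed
qed

lemma small_sum:
  assumes "finite I" "\<And>i. i \<in> I \<Longrightarrow> small q (A i)" "q \<ge> 1"
  shows "small q (\<lambda>z. \<Sum>i\<in>I. A i z)"
  using assms(1,2)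
proof (induction rule: finite_induct)
  case empty show ?case using small_const[OF assms(3), of 0] by simp
next
  case (insert x F)
  thus ?case using small_add[OF _ _ assms(3), of "A x" "\<lambda>z. \<Sum>i\<in>F. A i z"] by simp
qed

text \<open>For large |z| the point \<open>w\<close> has modulus at most 2|z|, which
  \<open>e / 2 ^ q\<close> absorbs. The estimate serves translations and, through Cauchy's
  inequality on unit discs, derivatives.\<close>

lemma small_near:
  assumes "small q A" "c \<ge> 0" "e > 0"
  obtains R where "R \<ge> 1" "\<And>z w. norm z \<ge> R \<Longrightarrow> norm (w - z) \<le> c \<Longrightarrow> norm (A w) \<le> exp (e * norm z ^ q)"
proof -
  have e: "e / 2 ^ q > 0" using assms(3) by simp
  obtain R where R: "\<And>z. norm z \<ge> R \<Longrightarrow> norm (A z) \<le> exp (e / 2 ^ q * norm z ^ q)" using smallE[OF assms(1) e] by blast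
  show ?thesis
  proof (rule that[of "max 1 (\<bar>R\<bar> + c)"])
    fix z w :: complex assume z: "norm z \<ge> max 1 (\<bar>R\<bar> + c)" and w: "norm (w - z) \<le> c"
    have "norm w \<le> norm (w - z) + norm z" by (metis diff_add_cancel norm_triangle_ineq)
    hence 1: "norm w \<le> 2 * norm z" using w z by linarith
    have "norm z \<le> norm (w - z) + norm w" by (metis diff_add_cancel norm_minus_commute norm_triangle_ineq)
    hence 2: "norm w \<ge> R" using w z by linarith
    have "norm (A w) \<le> exp (e / 2 ^ q * norm w ^ q)" by (rule R[OF 2])
    also have "\<dots> \<le> exp (e / 2 ^ q * (2 * norm z) ^ q)"
      by (rule iffD2[OF exp_le_cancel_iff], intro mult_left_mono power_mono) (use 1 e in auto)
    finally show "norm (A w) \<le> exp (e * norm z ^ q)" by (simp add: power_mult_distrib)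
  qed auto
qed

lemma small_shift:
  assumes "small q A" shows "small q (\<lambda>z. A (z + c))"
proof (rule smallI)
  have "(A \<circ> (\<lambda>z. z + c)) holomorphic_on UNIV"
    by (rule holomorphic_on_compose_gen[OF _ small_holomorphic[OF assms]]) (auto intro!: holomorphic_intros)
  thus "(\<lambda>z. A (z + c)) holomorphic_on UNIV" by (simp add: o_def)
  fix e :: real assume "e > 0"
  then obtain R where "\<And>z w. norm z \<ge> R \<Longrightarrow> norm (w - z) \<le> norm c \<Longrightarrow> norm (A w) \<le> exp (e * norm z ^ q)"
    using small_near[OF assms norm_ge_zero] by blast
  thus "\<exists>R. \<forall>z. norm z \<ge> R \<longrightarrow> norm (A (z + c)) \<le> exp (e * norm z ^ q)"
    by (intro exI[of _ R]) auto
qed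

lemma small_deriv:
  assumes "small q A" shows "small q (deriv A)"
proof (rule smallI)
  show "deriv A holomorphic_on UNIV" by (rule holomorphic_deriv[OF small_holomorphic[OF assms]]) auto
  fix e :: real assume "e > 0"
  then obtain R where R: "\<And>z w. norm z \<ge> R \<Longrightarrow> norm (w - z) \<le> 1 \<Longrightarrow> norm (A w) \<le> exp (e * norm z ^ q)"
    using small_near[OF assms zero_le_one] by blast
  show "\<exists>R. \<forall>z. norm z \<ge> R \<longrightarrow> norm (deriv A z) \<le> exp (e * norm z ^ q)"
  proof (intro exI[of _ R] allI impI)
    fix z :: complex assume z: "norm z \<ge> R"
    have "norm ((deriv ^^ 1) A z) \<le> fact 1 * exp (e * norm z ^ q) / 1 ^ 1"
    proof (rule Cauchy_inequality)
      show "A holomorphic_on ball z 1" "continuous_on (cball z 1) A"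
        using small_holomorphic[OF assms] holomorphic_on_subset holomorphic_on_imp_continuous_on by blast+
      show "norm (A x) \<le> exp (e * norm z ^ q)" if "norm (z - x) = 1" for x
        using R[OF z, of x] that by (simp add: norm_minus_commute)
    qed auto
    thus "norm (deriv A z) \<le> exp (e * norm z ^ q)" by simp
  qed
qed

lemma small_exp:
  assumes "entire Q" "q \<ge> 1" "\<And>z. norm z \<ge> 1 \<Longrightarrow> norm (Q z) \<le> C * norm z ^ (q - 1)"
  shows "small q (\<lambda>z. exp (Q z))"
proof (rule smallI)
  show "(\<lambda>z. exp (Q z)) holomorphic_on UNIV" using assms(1) by (intro holomorphic_intros)
  fix e :: real assume e: "e > 0"
  show "\<exists>R. \<forall>z. norm z \<ge> R \<longrightarrow> norm (exp (Q z)) \<le> exp (e * norm z ^ q)"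
  proof (intro exI[of _ "max 1 (\<bar>C\<bar> / e)"] allI impI)
    fix z :: complex assume z: "norm z \<ge> max 1 (\<bar>C\<bar> / e)"
    have "Re (Q z) \<le> norm (Q z)" by (rule complex_Re_le_cmod)
    also have "\<dots> \<le> C * norm z ^ (q - 1)" using assms(3) z by simp
    also have "\<dots> \<le> e * norm z * norm z ^ (q - 1)" using z e by (intro mult_right_mono) (auto simp: field_simps)
    also have "\<dots> = e * norm z ^ q" using assms(2) by (cases q) auto
    finally show "norm (exp (Q z)) \<le> exp (e * norm z ^ q)" by simp
  qed
qed

section \<open>Exceptional sets of finite logarithmic measure\<close>

lemma finite_log_measure_empty [simp]: "finite_log_measure {}"
  by (simp add: finite_log_measure_def)

text \<open>The interval [r, K r] has logarithmic measure ln K for every \<open>r\<close>. With ln K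
  = m + 1, where \<open>m\<close> is the logarithmic measure of \<open>F\<close> beyond 1, it is not
  covered by \<open>F\<close> and a finite set.\<close>

lemma log_measure_gap:
  assumes "finite_log_measure F"
  obtains K where "K > 1" "\<And>r Z. r \<ge> 1 \<Longrightarrow> finite Z \<Longrightarrow> \<exists>t\<in>{r..K * r}. t \<notin> F \<and> t \<notin> Z"
proof -
  define M where "M = (\<integral>\<^sup>+t\<in>F \<inter> {1..}. ennreal (1 / t) \<partial>lebesgue)"
  have M: "M < \<infinity>" using assms by (simp add: finite_log_measure_def M_def)
  then obtain m where m: "M = ennreal m" "m \<ge> 0" by (cases M) auto
  define K where "K = exp (m + 1)"
  have K: "K > 1" using m by (simp add: K_def)
  show ?thesis
  proof (rule that[OF K])
    fix r :: real and Z :: "real set" assume r: "r \<ge> 1" and Z: "finite Z"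
    show "\<exists>t\<in>{r..K * r}. t \<notin> F \<and> t \<notin> Z"
    proof (rule ccontr)
      assume "\<not> ?thesis"
      hence sub: "t \<in> F \<or> t \<in> Z" if "t \<in> {r..K * r}" for t using that by blast
      have rK: "r \<le> K * r" using K r by simp
      have "(\<integral>\<^sup>+t. ennreal (1 / t) * indicator {r..K * r} t \<partial>lborel) = ennreal (ln (K * r) - ln r)"
        by (rule nn_integral_FTC_Icc) (use r rK in \<open>auto intro!: derivative_eq_intros\<close>)
      also have "ln (K * r) - ln r = m + 1" using r by (simp add: K_def ln_mult)
      finally have 1: "(\<integral>\<^sup>+t. ennreal (1 / t) * indicator {r..K * r} t \<partial>lebesgue) = ennreal (m + 1)"
        by (subst nn_integral_completion) auto
      have "AE t in lebesgue. t \<notin> Z"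
        using Z by (intro AE_not_in) (simp add: negligible_finite negligible_iff_null_sets[symmetric])
      hence "AE t in lebesgue. ennreal (1 / t) * indicator {r..K * r} t \<le> ennreal (1 / t) * indicator (F \<inter> {1..}) t"
      proof eventually_elim
        case (elim t)
        show ?case
        proof (cases "t \<in> {r..K * r}")
          case True
          hence "t \<in> F \<inter> {1..}" using sub[OF True] elim r by auto
          thus ?thesis using True by simp
        qed simp
      qed
      hence "(\<integral>\<^sup>+t. ennreal (1 / t) * indicator {r..K * r} t \<partial>lebesgue) \<le> M"
        unfolding M_def by (rule nn_integral_mono_AE)
      thus False using 1 m by (simp add: ennreal_le_iff2)
    qed
  qed
qed

lemma eventually_at_top_off:
  "eventually P (at_top_off F) \<longleftrightarrow> (\<exists>N. \<forall>r\<ge>N. r \<notin> F \<longrightarrow> P r)"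
  unfolding at_top_off_def eventually_inf_principal eventually_at_top_linorder by simp

text \<open>An admissible radius \<open>t\<close> is found between 2|w| and a fixed multiple of |w|,
  outside \<open>F\<close> and avoiding the moduli of zeros. Then |w| \<le> t/2, as
  \<open>norm_le_proximity\<close> demands, and monotonicity of \<open>T\<close> moves the bound to
  the end of the interval. The constant \<open>K\<close> depends only on \<open>F\<close>.\<close>

lemma norm_le_on_disc:
  assumes b: "entire b" and F: "finite_log_measure F"
  obtains K where "K > 1"
    "\<And>N T w. \<forall>t\<ge>N. t \<notin> F \<longrightarrow> proximity t b \<le> T t \<Longrightarrow> \<forall>s t. N \<le> s \<longrightarrow> s \<le> t \<longrightarrow> T s \<le> T t \<Longrightarrow>
       norm w \<ge> max 1 N \<Longrightarrow> norm (b w) \<le> exp (3 * T (K * norm w))"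
proof (cases "nonnull b")
  case False
  show ?thesis by (rule that[of 2]) (use False in auto)
next
  case True
  obtain K where K: "K > 1" "\<And>r Z. r \<ge> 1 \<Longrightarrow> finite Z \<Longrightarrow> \<exists>t\<in>{r..K * r}. t \<notin> F \<and> t \<notin> Z"
    using log_measure_gap[OF F] by blast
  show ?thesis
  proof (rule that[of "2 * K"])
    fix N T and w :: complex
    assume T: "\<forall>t\<ge>N. t \<notin> F \<longrightarrow> proximity t b \<le> T t" and mono: "\<forall>s t. N \<le> s \<longrightarrow> s \<le> t \<longrightarrow> T s \<le> T t"
      and w: "norm w \<ge> max 1 N"
    have fin: "finite (norm ` zeros_in b (K * (2 * norm w)))" by (intro finite_imageI finite_zeros_in[OF b True])
    have "2 * norm w \<ge> 1" using w by simp
    from K(2)[OF this fin]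
    obtain t where t: "t \<in> {2 * norm w..K * (2 * norm w)}" "t \<notin> F" "t \<notin> norm ` zeros_in b (K * (2 * norm w))"
      by blast
    have "norm (b w) \<le> exp (3 * proximity t b)"
    proof (rule norm_le_proximity[OF b])
      show "b z \<noteq> 0" if "norm z = t" for z using t(1,3) that by (auto simp: zeros_in_def)
    qed (use t w in auto)
    also have "proximity t b \<le> T t" using t w by (intro T[rule_format]) auto
    also have "T t \<le> T (2 * K * norm w)" using t w by (intro mono[rule_format]) (auto simp: mult_ac)
    finally show "norm (b w) \<le> exp (3 * T (2 * K * norm w))" by simp
  qed (use K in auto)
qed

lemma small_of_proximity:
  assumes b: "entire b" and F: "finite_log_measure F"
    and T: "\<And>\<eta>. \<eta> > 0 \<Longrightarrow> \<forall>\<^sub>F r in at_top_off F. proximity r b \<le> \<eta> * r ^ q"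
  shows "small q b"
proof (rule smallI[OF b])
  fix e :: real assume e: "e > 0"
  obtain K where K: "K > 1"
    "\<And>N T w. \<forall>t\<ge>N. t \<notin> F \<longrightarrow> proximity t b \<le> T t \<Longrightarrow> \<forall>s t. N \<le> s \<longrightarrow> s \<le> t \<longrightarrow> T s \<le> T t \<Longrightarrow>
       norm w \<ge> max 1 N \<Longrightarrow> norm (b w) \<le> exp (3 * T (K * norm w))"
    using norm_le_on_disc[OF b F] by blast
  \<comment> \<open>The 3 comes from the Poisson estimate, and \<open>K ^ q\<close> from evaluating
    the bound at radius K|z|.\<close>
  define \<eta> where "\<eta> = e / (3 * K ^ q)"
  have \<eta>: "\<eta> > 0" using e K by (simp add: \<eta>_def)
  obtain N where N: "\<forall>r\<ge>N. r \<notin> F \<longrightarrow> proximity r b \<le> \<eta> * r ^ q"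
    using T[OF \<eta>] unfolding eventually_at_top_off by blast
  show "\<exists>R. \<forall>z. norm z \<ge> R \<longrightarrow> norm (b z) \<le> exp (e * norm z ^ q)"
  proof (intro exI[of _ "max 1 (max 0 N)"] allI impI)
    fix z :: complex assume z: "norm z \<ge> max 1 (max 0 N)"
    have "norm (b z) \<le> exp (3 * (\<eta> * (K * norm z) ^ q))"
    proof (rule K(2)[OF _ _ z])
      show "\<forall>s t. max 0 N \<le> s \<longrightarrow> s \<le> t \<longrightarrow> \<eta> * s ^ q \<le> \<eta> * t ^ q"
        using \<eta> by (auto intro!: mult_left_mono power_mono)
    qed (use N in auto)
    thus "norm (b z) \<le> exp (e * norm z ^ q)" using K(1) by (simp add: \<eta>_def power_mult_distrib field_simps)
  qed
qed

lemma Limsup_log_ratio_bound: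
  assumes "Limsup at_top (\<lambda>r::real. ereal (log_plus (N r) / ln r)) < ereal \<tau>"
  shows "\<exists>R\<ge>1. \<forall>r\<ge>R. N r \<le> r powr \<tau>"
proof -
  have "\<forall>\<^sub>F r in at_top. ereal (log_plus (N r) / ln r) < ereal \<tau>"
    using assms by (rule Limsup_lessD)
  then obtain R where R: "\<And>r. r \<ge> R \<Longrightarrow> log_plus (N r) / ln r < \<tau>" by (auto simp: eventually_at_top_linorder)
  show ?thesis
  proof (intro exI[of _ "max 2 R"] conjI allI impI)
    fix r assume r: "r \<ge> max 2 R"
    have l: "ln r > 0" using r by simp
    have "log_plus (N r) \<le> \<tau> * ln r" using R[of r] r l by (simp add: field_simps)
    hence "exp (log_plus (N r)) \<le> exp (\<tau> * ln r)" by simp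
    also have "\<dots> = r powr \<tau>" using r by (simp add: powr_def)
    also have "exp (log_plus (N r)) = max 1 (N r)" by (simp add: log_plus_def)
    finally show "N r \<le> r powr \<tau>" by simp
  qed auto
qed

lemma growth_order_bound:
  assumes f: "entire f" and "growth_order f < ereal \<tau>" "\<tau> > 0"
  shows "\<exists>C>0. \<exists>R\<ge>1. \<forall>w. norm w \<ge> R \<longrightarrow> norm (f w) \<le> exp (C * norm w powr \<tau>)"
proof -
  obtain R where R: "R \<ge> 1" "\<forall>r\<ge>R. nev_char r f \<le> r powr \<tau>"
    using Limsup_log_ratio_bound[OF assms(2)[unfolded growth_order_def]] by blast
  obtain K where K: "K > 1"
    "\<And>N T w. \<forall>t\<ge>N. t \<notin> {} \<longrightarrow> proximity t f \<le> T t \<Longrightarrow> \<forall>s t. N \<le> s \<longrightarrow> s \<le> t \<longrightarrow> T s \<le> T t \<Longrightarrow>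
       norm w \<ge> max 1 N \<Longrightarrow> norm (f w) \<le> exp (3 * T (K * norm w))"
    using norm_le_on_disc[OF f finite_log_measure_empty] by blast
  have "\<exists>R\<ge>1. \<forall>w. norm w \<ge> R \<longrightarrow> norm (f w) \<le> exp (3 * K powr \<tau> * norm w powr \<tau>)"
  proof (intro exI[of _ R] conjI allI impI)
    fix w :: complex assume w: "norm w \<ge> R"
    have "norm (f w) \<le> exp (3 * (K * norm w) powr \<tau>)"
      by (rule K(2)[of R]) (use R w assms(3) nev_char_entire[OF f] in \<open>auto intro!: powr_mono2\<close>)
    thus "norm (f w) \<le> exp (3 * K powr \<tau> * norm w powr \<tau>)" using K(1) by (simp add: powr_mult mult.assoc)
  qed (use R in auto)
  moreover have "3 * K powr \<tau> > 0" using K(1) by simp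
  ultimately show ?thesis by blast
qed

lemma finite_log_measure_Un:
  assumes "finite_log_measure F" "finite_log_measure G"
  shows "finite_log_measure (F \<union> G)"
proof -
  have [measurable]: "F \<in> sets lebesgue" "G \<in> sets lebesgue" using assms by (auto simp: finite_log_measure_def)
  have [measurable]: "(\<lambda>t::real. ennreal (1 / t)) \<in> borel_measurable lebesgue"
    by (rule measurable_completion) measurable
  let ?I = "\<lambda>A. (\<integral>\<^sup>+t\<in>A \<inter> {1..}. ennreal (1 / t) \<partial>lebesgue)"
  have "?I (F \<union> G) \<le> (\<integral>\<^sup>+t. ennreal (1 / t) * indicator (F \<inter> {1..}) t + ennreal (1 / t) * indicator (G \<inter> {1..}) t \<partial>lebesgue)"
    by (intro nn_integral_mono) (auto simp: indicator_def)
  also have "\<dots> = ?I F + ?I G" 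
    by (intro nn_integral_add borel_measurable_times_ennreal borel_measurable_indicator sets.Int) auto
  also have "\<dots> < \<infinity>" using assms by (simp add: finite_log_measure_def)
  finally show ?thesis by (simp add: finite_log_measure_def)
qed

section \<open>Hadamard factorization for functions with few zeros\<close>

text \<open>Jensen's formula read at the centre. With n zeros the term n ln R alone may be too large
  by a logarithm; paired with ln|E 0| it leaves only quantities of admissible size.\<close>

lemma cofactor_centre:
  assumes "entire g" "nonnull g" "R > 0" "cofactor g R E"
  shows "ln (norm (E 0)) + zero_count g R * ln R = ln (lead g) + zero_int_count R g"
proof -
  have 1: "ln (norm (E 0)) = ln (lead g) - (\<Sum>a\<in>zeros_in g R - {0}. real (zmult g a) * ln (norm a))"
    using assms by (intro ln_lead_eq) auto
  have 2: "zero_count g R * ln R = real (zmult g 0) * ln R + (\<Sum>a\<in>zeros_in g R - {0}. real (zmult g a) * ln R)"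
    using sum_zeros_split[OF assms(1,2), of R "\<lambda>_. ln R"] assms(3)
    by (simp add: zero_count_def sum_distrib_right)
  have 3: "(\<Sum>a\<in>zeros_in g R - {0}. real (zmult g a) * ln (R / norm a)) =
      (\<Sum>a\<in>zeros_in g R - {0}. real (zmult g a) * ln R) - (\<Sum>a\<in>zeros_in g R - {0}. real (zmult g a) * ln (norm a))"
    unfolding sum_subtractf[symmetric]
    by (intro sum.cong) (use assms(3) in \<open>auto simp: ln_div right_diff_distrib\<close>)
  show ?thesis unfolding int_count_inverse[OF assms(1-3)] 3 1 2 by simp
qed

lemma prod_zeros_const:
  assumes "R > 0"
  shows "(\<Prod>a\<in>zeros_in g S. R ^ zmult g a) = exp (zero_count g S * ln R)"
proof -
  have "(\<Prod>a\<in>zeros_in g S. R ^ zmult g a) = R ^ (\<Sum>a\<in>zeros_in g S. zmult g a)"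
    by (rule power_sum[symmetric])
  also have "R ^ n = exp (real n * ln R)" for n
    using assms by (simp add: exp_of_nat_mult)
  finally show ?thesis by (simp add: zero_count_def)
qed

text \<open>On |w| = 2 R every factor w - a has modulus at least R, so |E| is at most exp U divided
  by one R per zero; the maximum principle carries this inside.\<close>

lemma cofactor_upper:
  assumes "cofactor g R E" "R > 0" "\<And>w. norm w = 2 * R \<Longrightarrow> norm (g w) \<le> exp U" "norm z \<le> R"
  shows "ln (norm (E z)) + zero_count g R * ln R \<le> U"
proof -
  let ?c = "exp (zero_count g R * ln R)"
  have bd: "norm (E w) \<le> exp U / ?c" if w: "w \<in> frontier (ball 0 (2 * R))" for w
  proof -
    have w: "norm w = 2 * R" using w assms(2) by simp
    have "?c = (\<Prod>a\<in>zeros_in g R. R ^ zmult g a)" using prod_zeros_const[OF assms(2)] by simp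
    also have "\<dots> \<le> (\<Prod>a\<in>zeros_in g R. norm (w - a) ^ zmult g a)"
    proof (intro prod_mono conjI power_mono)
      fix a assume "a \<in> zeros_in g R"
      hence "norm a \<le> R" by (simp add: zeros_in_def)
      thus "R \<le> norm (w - a)" using norm_triangle_ineq2[of w a] w by simp
    qed (use assms(2) in auto)
    finally have "?c * norm (E w) \<le> (\<Prod>a\<in>zeros_in g R. norm (w - a) ^ zmult g a) * norm (E w)"
      by (intro mult_right_mono) auto
    also have "\<dots> = norm (g w)"
      unfolding cofactorD(2)[OF assms(1), of w] by (simp add: norm_mult prod_norm[symmetric] norm_power)
    also have "\<dots> \<le> exp U" by (rule assms(3)[OF w])
    finally show ?thesis by (simp add: field_simps)
  qed
  have hol: "E holomorphic_on S" for S using cofactorD(1)[OF assms(1)] holomorphic_on_subset by blast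
  have "norm (E z) \<le> exp U / ?c"
    by (rule maximum_modulus_frontier[of E "ball 0 (2 * R)"])
       (use hol bd assms(2,4) in \<open>auto intro: holomorphic_on_imp_continuous_on\<close>)
  hence "norm (E z) \<le> exp (U - zero_count g R * ln R)" by (simp add: exp_diff)
  moreover have "E z \<noteq> 0" using cofactorD(3)[OF assms(1), of z] assms(4) by simp
  ultimately have "ln (norm (E z)) \<le> U - zero_count g R * ln R" 
    using ln_mono[of "norm (E z)" "exp (U - zero_count g R * ln R)"] by simp
  thus ?thesis by simp
qed

lemma cofactor_log:
  assumes "cofactor g R E" "R > 0"
  obtains L where "L holomorphic_on ball 0 R" "\<And>z. norm z < R \<Longrightarrow> exp (L z) = E z"
    "\<And>z. norm z < R \<Longrightarrow> ln (norm (E z)) = Re (L z)"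
proof -
  have "E holomorphic_on ball 0 R" using cofactorD(1)[OF assms(1)] holomorphic_on_subset by blast
  moreover have "E z \<noteq> 0" if "z \<in> ball 0 R" for z using cofactorD(3)[OF assms(1), of z] that by simp
  ultimately obtain L where L: "L holomorphic_on ball 0 R" "\<And>z. z \<in> ball 0 R \<Longrightarrow> exp (L z) = E z"
    using holomorphic_logarithm_exists[of "ball 0 R" E 0] assms(2) by auto
  show ?thesis
  proof (rule that[OF L(1)])
    show "exp (L z) = E z" if "norm z < R" for z using L(2) that by simp
    thus "ln (norm (E z)) = Re (L z)" if "norm z < R" for z using that by (metis ln_exp norm_exp_eq_Re)
  qed
qed

text \<open>In Borel-Caratheodory for log E the terms n ln R from the upper bound and from the
  centre cancel, and N(R) has the favourable sign. Only the growth of \<open>g\<close> and the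
  constant \<open>lead g\<close> remain.\<close>

lemma cofactor_log_bound:
  assumes "entire g" "nonnull g" "R \<ge> 1" "cofactor g R E"
    "\<And>w. norm w = 2 * R \<Longrightarrow> norm (g w) \<le> exp U"
    "L holomorphic_on ball 0 R" "\<And>z. norm z < R \<Longrightarrow> ln (norm (E z)) = Re (L z)" "norm z \<le> R / 2"
  shows "norm (L z - L 0) \<le> 2 * (U - ln (lead g))"
proof -
  have R: "R > 0" using assms(3) by simp
  have "norm (L z - L 0) \<le> 2 * ((U - zero_count g R * ln R) - Re (L 0))"
  proof (rule Borel_Caratheodory[OF assms(6) _ assms(8) R])
    fix z :: complex assume z: "z \<in> ball 0 R"
    have "ln (norm (E z)) + zero_count g R * ln R \<le> U"
      by (rule cofactor_upper[OF assms(4) R assms(5)]) (use z in auto)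
    thus "Re (L z) \<le> U - zero_count g R * ln R" using assms(7)[of z] z by simp
  qed
  also have "\<dots> = 2 * (U - (ln (norm (E 0)) + zero_count g R * ln R))" using assms(7)[of 0] R by simp
  also have "\<dots> = 2 * (U - ln (lead g) - zero_int_count R g)"
    unfolding cofactor_centre[OF assms(1,2) R assms(4)] by simp
  also have "\<dots> \<le> 2 * (U - ln (lead g))" using int_count_nonneg[OF assms(1-3)] by simp
  finally show ?thesis .
qed

text \<open>Off the zeros of \<open>g\<close> the common product cancels. Those zeros are isolated
  and both sides are continuous.\<close>

lemma cofactor_step:
  assumes "entire g" "nonnull g" "R \<le> R'" "cofactor g R E" "cofactor g R' E'"
  shows "E z = (\<Prod>a\<in>zeros_in g R' - zeros_in g R. (z - a) ^ zmult g a) * E' z"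
proof -
  let ?Q = "\<lambda>z. (\<Prod>a\<in>zeros_in g R' - zeros_in g R. (z - a) ^ zmult g a) * E' z"
  have sub: "zeros_in g R \<subseteq> zeros_in g R'" using assms(3) by (auto simp: zeros_in_def)
  have fin: "finite (zeros_in g R')" by (rule finite_zeros_in[OF assms(1,2)])
  have eq: "E w = ?Q w" if w: "g w \<noteq> 0" for w
  proof -
    have "zero_prod g R w * E w = g w" by (rule cofactorD(2)[OF assms(4), symmetric])
    also have "\<dots> = (\<Prod>a\<in>zeros_in g R'. (w - a) ^ zmult g a) * E' w" by (rule cofactorD(2)[OF assms(5)])
    also have "(\<Prod>a\<in>zeros_in g R'. (w - a) ^ zmult g a) =
        (\<Prod>a\<in>zeros_in g R' - zeros_in g R. (w - a) ^ zmult g a) * zero_prod g R w"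
      by (rule prod.subset_diff[OF sub fin])
    finally have "zero_prod g R w * E w = zero_prod g R w * ?Q w"
      by (simp add: mult_ac)
    moreover have "zero_prod g R w \<noteq> 0" using w cofactorD(2)[OF assms(4), of w] by auto
    ultimately show ?thesis by (metis mult_left_cancel)
  qed
  have c1: "isCont E z" "isCont E' z"
    using holomorphic_on_imp_continuous_on[OF cofactorD(1)[OF assms(4)]]
      holomorphic_on_imp_continuous_on[OF cofactorD(1)[OF assms(5)]]
    by (simp_all add: continuous_on_eq_continuous_at)
  have c2: "isCont ?Q z" by (intro continuous_intros c1)
  have ev: "\<forall>\<^sub>F w in at z. E w = ?Q w"
    using holomorphic_eventually_nonzero[OF assms(1,2)] by eventually_elim (rule eq)
  have "?Q \<midarrow>z\<rightarrow> ?Q z" using c2 by (simp only: isCont_def)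
  hence "E \<midarrow>z\<rightarrow> ?Q z" by (rule iffD2[OF tendsto_cong[OF ev]])
  moreover have "E \<midarrow>z\<rightarrow> E z" using c1 by (simp add: isCont_def)
  ultimately show ?thesis by (rule LIM_unique[rotated])
qed

section \<open>Taylor coefficients along dyadic radii\<close>

lemma geometric_decay_limit:
  fixes x :: "nat \<Rightarrow> complex"
  assumes "\<And>j. j \<ge> j0 \<Longrightarrow> norm (x (Suc j) - x j) \<le> A * q ^ j" "0 < q" "q < 1"
  shows "\<exists>c. x \<longlonglongrightarrow> c \<and> (\<forall>j\<ge>j0. norm (x j - c) \<le> A * q ^ j / (1 - q))"
proof -
  have A: "A \<ge> 0"
  proof -
    have "0 \<le> A * q ^ j0" using assms(1)[of j0] norm_ge_zero order_trans by blast
    thus ?thesis using zero_less_power[OF assms(2), of j0] by (auto simp: zero_le_mult_iff)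
  qed
  \<comment> \<open>Carrying the exact partial sum with 1 - q^n lets the induction close; the bound
    free of n follows afterwards.\<close>
  have step: "norm (x (j + n) - x j) \<le> A * q ^ j * (1 - q ^ n) / (1 - q)" if "j \<ge> j0" for j n
  proof (induction n)
    case (Suc n)
    have "norm (x (j + Suc n) - x j) \<le> norm (x (Suc (j + n)) - x (j + n)) + norm (x (j + n) - x j)"
      by (metis add_Suc_right diff_add_cancel add_diff_eq norm_triangle_ineq)
    also have "\<dots> \<le> A * q ^ (j + n) + A * q ^ j * (1 - q ^ n) / (1 - q)"
      using assms(1)[of "j + n"] that Suc.IH by (intro add_mono) auto
    also have "\<dots> = A * q ^ j * (1 - q ^ Suc n) / (1 - q)"
      using assms(3) by (simp add: field_simps power_add)
    finally show ?case .
  qed auto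
  have step': "norm (x (j + n) - x j) \<le> A * q ^ j / (1 - q)" if "j \<ge> j0" for j n
  proof -
    have "A * q ^ j * (1 - q ^ n) \<le> A * q ^ j * 1"
      using A assms(2) by (intro mult_left_mono) auto
    hence "A * q ^ j * (1 - q ^ n) / (1 - q) \<le> A * q ^ j / (1 - q)"
      using assms(3) by (intro divide_right_mono) auto
    thus ?thesis using step[OF that, of n] by linarith
  qed
  have lim0: "(\<lambda>j. A * q ^ j / (1 - q)) \<longlonglongrightarrow> 0"
    using assms(2,3) by (auto intro!: tendsto_eq_intros LIMSEQ_realpow_zero)
  have "Cauchy x"
  proof (rule CauchyI')
    fix e :: real assume "e > 0"
    then obtain M where M: "\<And>j. j \<ge> M \<Longrightarrow> A * q ^ j / (1 - q) < e"
      using order_tendstoD(2)[OF lim0] by (auto simp: eventually_sequentially)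
    show "\<exists>M. \<forall>m\<ge>M. \<forall>n>m. dist (x m) (x n) < e"
    proof (intro exI[of _ "max M j0"] allI impI)
      fix m n :: nat assume mn: "m \<ge> max M j0" "n > m"
      have "norm (x (m + (n - m)) - x m) \<le> A * q ^ m / (1 - q)" using mn by (intro step') auto
      thus "dist (x m) (x n) < e" using M[of m] mn by (simp add: dist_norm norm_minus_commute)
    qed
  qed
  then obtain c where c: "x \<longlonglongrightarrow> c" using Cauchy_convergent_iff convergent_def by blast
  have "norm (x j - c) \<le> A * q ^ j / (1 - q)" if "j \<ge> j0" for j
  proof (rule LIMSEQ_le_const2)
    have "(\<lambda>n. x (n + j)) \<longlonglongrightarrow> c" using c by (rule LIMSEQ_ignore_initial_segment)
    thus "(\<lambda>n. norm (x j - x (n + j))) \<longlonglongrightarrow> norm (x j - c)" by (intro tendsto_intros)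
    show "\<exists>N. \<forall>n\<ge>N. norm (x j - x (n + j)) \<le> A * q ^ j / (1 - q)"
      using step'[OF that] by (metis add.commute norm_minus_commute)
  qed
  thus ?thesis using c by blast
qed

text \<open>With ratio above 1 the increments add up to a multiple of the last one. Coefficients of
  this kind need no limit, since they stay within the rate already allowed.\<close>

lemma geometric_growth_bound:
  fixes x :: "nat \<Rightarrow> complex"
  assumes "\<And>j. j \<ge> j0 \<Longrightarrow> norm (x (Suc j) - x j) \<le> A * q ^ j" "1 < q" "A \<ge> 0"
  shows "\<exists>B\<ge>0. \<forall>j\<ge>j0. norm (x j) \<le> B * q ^ j"
proof -
  have "norm (x (j0 + n)) \<le> norm (x j0) + A * q ^ j0 * (q ^ n - 1) / (q - 1)" for n
  proof (induction n)
    case (Suc n)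
    have "norm (x (j0 + Suc n)) \<le> norm (x (Suc (j0 + n)) - x (j0 + n)) + norm (x (j0 + n))"
      by (metis add_Suc_right diff_add_cancel norm_triangle_ineq)
    also have "\<dots> \<le> A * q ^ (j0 + n) + (norm (x j0) + A * q ^ j0 * (q ^ n - 1) / (q - 1))"
      using assms(1)[of "j0 + n"] Suc.IH by (intro add_mono) auto
    also have "\<dots> = norm (x j0) + A * q ^ j0 * (q ^ Suc n - 1) / (q - 1)"
      using assms(2) by (simp add: field_simps power_add)
    finally show ?case .
  qed auto
  hence *: "norm (x j) \<le> norm (x j0) + A * q ^ j0 * (q ^ (j - j0) - 1) / (q - 1)" if "j \<ge> j0" for j
    using that by (metis le_add_diff_inverse)
  show ?thesis
  proof (intro exI[of _ "norm (x j0) + A / (q - 1)"] conjI allI impI)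
    fix j assume j: "j \<ge> j0"
    have "A * q ^ j0 * (q ^ (j - j0) - 1) \<le> A * q ^ j0 * q ^ (j - j0)"
      using assms(2,3) by (intro mult_left_mono) auto
    also have "\<dots> = A * q ^ j" using j by (simp add: power_add[symmetric])
    finally have "A * q ^ j0 * (q ^ (j - j0) - 1) / (q - 1) \<le> A * q ^ j / (q - 1)"
      using assms(2) by (intro divide_right_mono) auto
    moreover have "norm (x j0) * 1 \<le> norm (x j0) * q ^ j" using assms(2) by (intro mult_left_mono) auto
    ultimately show "norm (x j) \<le> (norm (x j0) + A / (q - 1)) * q ^ j"
      using *[OF j] by (simp add: distrib_right)
  qed (use assms in auto)
qed

text \<open>For |z| \<le> R/4 the k-th term of the difference is at most B / 2^k, and these sum to 2
  B.\<close>

lemma power_series_diff_bound: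
  fixes M :: "complex \<Rightarrow> complex" and c :: "nat \<Rightarrow> complex"
  assumes "M holomorphic_on ball 0 R" "R > 0" "finite K" "\<And>k. k \<notin> K \<Longrightarrow> c k = 0"
    and bd: "\<And>k. norm ((deriv ^^ k) M 0 / fact k - c k) \<le> B * (2 / R) ^ k" and z: "norm z \<le> R / 4"
  shows "norm (M z - (\<Sum>k\<in>K. c k * z ^ k)) \<le> 2 * B"
proof -
  have zR: "z \<in> ball 0 R" using z assms(2) by simp
  have "((\<lambda>k. (deriv ^^ k) M 0 / fact k * (z - 0) ^ k) sums M z)"
    by (rule holomorphic_power_series[OF assms(1) zR])
  hence 1: "((\<lambda>k. (deriv ^^ k) M 0 / fact k * z ^ k) sums M z)" by simp
  have "(\<lambda>k. c k * z ^ k) sums (\<Sum>k\<in>K. c k * z ^ k)"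
    by (rule sums_finite[OF assms(3)]) (simp add: assms(4))
  from sums_diff[OF 1 this]
  have 2: "(\<lambda>k. ((deriv ^^ k) M 0 / fact k - c k) * z ^ k) sums (M z - (\<Sum>k\<in>K. c k * z ^ k))"
    by (simp add: left_diff_distrib)
  have 3: "norm (((deriv ^^ k) M 0 / fact k - c k) * z ^ k) \<le> B * (1 / 2) ^ k" for k
  proof -
    have "norm (((deriv ^^ k) M 0 / fact k - c k) * z ^ k) \<le> B * (2 / R) ^ k * (R / 4) ^ k"
      unfolding norm_mult norm_power using bd[of k] z order_trans[OF norm_ge_zero bd[of k]]
      by (intro mult_mono power_mono) simp_all
    also have "\<dots> = B * ((2 / R) * (R / 4)) ^ k" by (simp only: power_mult_distrib mult.assoc)
    also have "(2 / R) * (R / 4) = 1 / 2" using assms(2) by simp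
    finally show ?thesis .
  qed
  have g: "(\<lambda>k. B * (1 / 2) ^ k) sums (B * (1 / (1 - 1 / 2)))"
    by (intro sums_mult geometric_sums) auto
  have "norm (\<Sum>k. ((deriv ^^ k) M 0 / fact k - c k) * z ^ k) \<le> (\<Sum>k. B * (1 / 2) ^ k)"
    by (rule norm_suminf_le[OF 3]) (use g in \<open>auto simp: sums_iff\<close>)
  thus ?thesis using sums_unique[OF 2] sums_unique[OF g] by simp
qed

lemma coeff_bound:
  assumes "M holomorphic_on ball 0 R" "R > 0" "\<And>z. norm z \<le> R / 2 \<Longrightarrow> norm (M z) \<le> B"
  shows "norm ((deriv ^^ k) M 0 / fact k) \<le> B * (2 / R) ^ k"
proof -
  have "cball 0 (R / 2) \<subseteq> ball (0::complex) R" "ball 0 (R / 2) \<subseteq> ball (0::complex) R" using assms(2) by auto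
  hence "norm ((deriv ^^ k) M 0) \<le> fact k * B / (R / 2) ^ k"
    using assms holomorphic_on_imp_continuous_on[OF assms(1)]
    by (intro Cauchy_inequality) (auto intro: holomorphic_on_subset continuous_on_subset)
  hence "norm ((deriv ^^ k) M 0) / fact k \<le> fact k * B / (R / 2) ^ k / fact k" by (intro divide_right_mono) auto
  also have "\<dots> = B * (2 / R) ^ k" by (simp add: power_divide)
  finally show ?thesis by (simp add: norm_divide)
qed

text \<open>The quotient of two cofactors is a product of factors \<open>1 - z / a\<close>, each at most \<open>2\<close> in modulus.\<close>
lemma cofactor_log_step:
  assumes g: "entire g" "nonnull g" and R: "0 < R" "R \<le> R'"
    and E: "cofactor g R E" "cofactor g R' E'"
    and M: "M holomorphic_on ball 0 R" "M 0 = 0" "\<And>z. norm z < R \<Longrightarrow> E z = E 0 * exp (M z)"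
    and M': "M' holomorphic_on ball 0 R'" "M' 0 = 0" "\<And>z. norm z < R' \<Longrightarrow> E' z = E' 0 * exp (M' z)"
  shows "norm ((deriv ^^ k) M' 0 / fact k - (deriv ^^ k) M 0 / fact k) \<le> 2 * zero_count g R' * (2 / R) ^ k"
proof -
  define H where "H z = M z - M' z" for z
  have holM': "M' holomorphic_on ball 0 R"
    by (rule holomorphic_on_subset[OF M'(1)]) (use R(2) in auto)
  have holH: "H holomorphic_on ball 0 R" unfolding H_def by (intro holomorphic_intros M(1) holM')
  let ?D = "zeros_in g R' - zeros_in g R"
  have fin: "finite (zeros_in g R')" by (rule finite_zeros_in[OF g])
  have nc: "(\<Sum>a\<in>?D. real (zmult g a)) \<le> zero_count g R'"
    unfolding zero_count_def by (rule sum_mono2) (use fin in auto)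
  have ReH: "Re (H z) \<le> zero_count g R' * ln 2" if z: "z \<in> ball 0 R" for z
  proof -
    have zR: "norm z < R" "norm z < R'" using z R by auto
    have E0: "E 0 \<noteq> 0" "E' 0 \<noteq> 0" using cofactorD(3)[OF E(1), of 0] cofactorD(3)[OF E(2), of 0] R by auto
    have s0: "E 0 = (\<Prod>a\<in>?D. (0 - a) ^ zmult g a) * E' 0" by (rule cofactor_step[OF g R(2) E])
    have sz: "E z = (\<Prod>a\<in>?D. (z - a) ^ zmult g a) * E' z" by (rule cofactor_step[OF g R(2) E])
    have eq: "norm (\<Prod>a\<in>?D. (0 - a) ^ zmult g a) * exp (Re (H z)) = norm (\<Prod>a\<in>?D. (z - a) ^ zmult g a)"
    proof -
      have "(\<Prod>a\<in>?D. (0 - a) ^ zmult g a) * E' 0 * exp (M z) = (\<Prod>a\<in>?D. (z - a) ^ zmult g a) * (E' 0 * exp (M' z))"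
        using s0 sz M(3)[OF zR(1)] M'(3)[OF zR(2)] by metis
      hence "(\<Prod>a\<in>?D. (0 - a) ^ zmult g a) * exp (M z) = (\<Prod>a\<in>?D. (z - a) ^ zmult g a) * exp (M' z)"
        using E0(2) by (simp add: mult_ac)
      hence "(\<Prod>a\<in>?D. (0 - a) ^ zmult g a) * exp (H z) = (\<Prod>a\<in>?D. (z - a) ^ zmult g a)"
        by (simp add: H_def exp_diff field_simps)
      thus ?thesis by (metis norm_mult norm_exp_eq_Re)
    qed
    have pos: "norm (\<Prod>a\<in>?D. (0 - a) ^ zmult g a) > 0"
      using E0(1) s0 by auto
    have "norm (\<Prod>a\<in>?D. (z - a) ^ zmult g a) = (\<Prod>a\<in>?D. norm (z - a) ^ zmult g a)"
      by (simp add: prod_norm[symmetric] norm_power)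
    also have "\<dots> \<le> (\<Prod>a\<in>?D. 2 ^ zmult g a * norm (0 - a) ^ zmult g a)"
    proof (intro prod_mono conjI)
      fix a assume a: "a \<in> ?D"
      hence "norm a > R" by (auto simp: zeros_in_def)
      hence "norm (z - a) \<le> 2 * norm (0 - a)" using norm_triangle_ineq4[of z a] zR by simp
      thus "norm (z - a) ^ zmult g a \<le> 2 ^ zmult g a * norm (0 - a) ^ zmult g a"
        unfolding power_mult_distrib[symmetric] by (intro power_mono) auto
    qed auto
    also have "\<dots> = 2 ^ (\<Sum>a\<in>?D. zmult g a) * norm (\<Prod>a\<in>?D. (0 - a) ^ zmult g a)"
      by (simp add: prod.distrib power_sum prod_norm[symmetric] norm_power)
    finally have "norm (\<Prod>a\<in>?D. (0 - a) ^ zmult g a) * exp (Re (H z)) \<le>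
        norm (\<Prod>a\<in>?D. (0 - a) ^ zmult g a) * 2 ^ (\<Sum>a\<in>?D. zmult g a)"
      unfolding eq by (simp only: mult.commute)
    hence "exp (Re (H z)) \<le> 2 ^ (\<Sum>a\<in>?D. zmult g a)" by (rule mult_left_le_imp_le[OF _ pos])
    also have "(2::real) ^ n = exp (real n * ln 2)" for n by (simp add: exp_of_nat_mult)
    finally have "Re (H z) \<le> real (\<Sum>a\<in>?D. zmult g a) * ln 2" by simp
    also have "\<dots> \<le> zero_count g R' * ln 2" using nc by (intro mult_right_mono) auto
    finally show ?thesis .
  qed
  have bH: "norm (H z) \<le> 2 * zero_count g R'" if "norm z \<le> R / 2" for z
  proof -
    have "norm (H z - H 0) \<le> 2 * (zero_count g R' * ln 2 - Re (H 0))"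
      by (rule Borel_Caratheodory[OF holH ReH that R(1)])
    also have "\<dots> = 2 * zero_count g R' * ln 2" using M(2) M'(2) by (simp add: H_def)
    also have "\<dots> \<le> 2 * zero_count g R' * 1" using zero_count_nonneg[of g R'] ln_2_less_1 by (intro mult_left_mono) auto
    finally show ?thesis using M(2) M'(2) by (simp add: H_def)
  qed
  have "norm ((deriv ^^ k) H 0 / fact k) \<le> 2 * zero_count g R' * (2 / R) ^ k"
    by (rule coeff_bound[OF holH R(1) bH])
  moreover have "(deriv ^^ k) H 0 = (deriv ^^ k) M 0 - (deriv ^^ k) M' 0"
    unfolding H_def[abs_def] by (rule higher_deriv_diff[OF M(1) holM']) (use R in auto)
  ultimately show ?thesis by (simp add: diff_divide_distrib norm_minus_commute)
qed

text \<open>The increments are governed by the ratio \<open>q k\<close>, that is 2^(\<sigma> - k).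
  For k \<le> p it exceeds 1 and c k = 0 is good enough; for k > p it is below 1 and the
  coefficients converge; if also k > d, the growth bound forces the limit 0. The ratio 1 cannot
  occur, as \<sigma> lies strictly between p and p + 1.\<close>

lemma Hadamard_coefficients:
  fixes l :: "nat \<Rightarrow> nat \<Rightarrow> complex" and \<sigma> \<tau> :: real
  assumes step: "\<And>j k. j \<ge> j0 \<Longrightarrow> norm (l (Suc j) k - l j k) \<le> A * (2 ^ j) powr \<sigma> * (2 / 2 ^ j) ^ k"
    and top: "\<And>j k. j \<ge> j0 \<Longrightarrow> norm (l j k) \<le> T * (2 ^ j) powr \<tau> * (2 / 2 ^ j) ^ k"
    and l0: "\<And>j. l j 0 = 0" and A: "A \<ge> 0" 
    and \<sigma>: "real p < \<sigma>" "\<sigma> < real p + 1" and \<tau>: "\<tau> < real d + 1"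
  shows "\<exists>c B. B \<ge> 0 \<and> (\<forall>k. k \<notin> {p<..d} \<longrightarrow> c k = 0) \<and>
     (\<forall>j\<ge>j0. \<forall>k. norm (l j k - c k) \<le> B * (2 ^ j) powr \<sigma> * (2 / 2 ^ j) ^ k)"
proof -
  define q where "q k = 2 powr (\<sigma> - real k)" for k
  have q: "q k > 0" for k by (simp add: q_def)
  have qj: "(2 ^ j) powr \<sigma> * (2 / 2 ^ j) ^ k = 2 ^ k * q k ^ j" for j k
  proof -
    have "q k ^ j = 2 powr (real j * \<sigma> - real j * real k)"
      by (simp add: q_def powr_power right_diff_distrib mult.commute)
    also have "\<dots> = (2 ^ j) powr \<sigma> / (2 ^ j) ^ k"
      by (simp add: powr_diff powr_realpow[symmetric] powr_powr power_mult[symmetric] del: powr_realpow)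
    finally show ?thesis by (simp add: power_divide)
  qed
  have step': "norm (l (Suc j) k - l j k) \<le> A * 2 ^ k * q k ^ j" if "j \<ge> j0" for j k
    using step[OF that, of k] qj[of j k] by (simp only: mult.assoc)
  have low: "\<exists>B\<ge>0. \<forall>j\<ge>j0. norm (l j k) \<le> B * q k ^ j" if "k \<le> p" for k
  proof -
    have "q k > 1" using that \<sigma> by (simp add: q_def)
    thus ?thesis using geometric_growth_bound[of j0 "\<lambda>j. l j k" "A * 2 ^ k" "q k"] step' A by auto
  qed
  then obtain B1 where B1: "\<And>k. k \<le> p \<Longrightarrow> B1 k \<ge> 0" "\<And>k j. k \<le> p \<Longrightarrow> j \<ge> j0 \<Longrightarrow> norm (l j k) \<le> B1 k * q k ^ j"
    by metis
  \<comment> \<open>The largest ratio beyond \<open>p\<close>. It bounds 1 / (1 - q k) uniformly in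
    \<open>k\<close>, so that one constant \<open>B\<close> serves all indices.\<close>
  define s where "s = 2 powr (\<sigma> - real (Suc p))"
  have s: "s < 1" "s > 0" using \<sigma> by (auto simp: s_def powr_less_one)
  have qs: "q k \<le> s" if "k > p" for k using that by (simp add: q_def s_def)
  have "\<exists>c. (\<lambda>j. l j k) \<longlonglongrightarrow> c \<and> (\<forall>j\<ge>j0. norm (l j k - c) \<le> A * 2 ^ k * q k ^ j / (1 - q k))" if "k > p" for k
    using geometric_decay_limit[of j0 "\<lambda>j. l j k" "A * 2 ^ k" "q k"] step' q[of k] qs[OF that] s by auto
  then obtain c0 where c0: "\<And>k. k > p \<Longrightarrow> (\<lambda>j. l j k) \<longlonglongrightarrow> c0 k"
    "\<And>k j. k > p \<Longrightarrow> j \<ge> j0 \<Longrightarrow> norm (l j k - c0 k) \<le> A * 2 ^ k * q k ^ j / (1 - q k)" by metis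
  define c where "c k = (if k > p then c0 k else 0)" for k
  have high: "c0 k = 0" if k: "k > p" "k > d" for k
  proof -
    have lt: "\<tau> - real k < 0" using k \<tau> by simp
    have eq: "(2 ^ j) powr \<tau> * (2 / 2 ^ j) ^ k = 2 ^ k * (2 powr (\<tau> - real k)) ^ j" for j
    proof -
      have "(2 powr (\<tau> - real k)) ^ j = 2 powr (real j * \<tau> - real j * real k)"
        by (simp add: powr_power right_diff_distrib mult.commute)
      also have "\<dots> = (2 ^ j) powr \<tau> / (2 ^ j) ^ k"
        by (simp add: powr_diff powr_realpow[symmetric] powr_powr power_mult[symmetric] del: powr_realpow)
      finally show ?thesis by (simp add: power_divide)
    qed
    have "(\<lambda>j. T * (2 ^ k * (2 powr (\<tau> - real k)) ^ j)) \<longlonglongrightarrow> T * (2 ^ k * 0)"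
      using lt by (intro tendsto_intros LIMSEQ_realpow_zero) (auto simp: powr_less_one)
    hence "(\<lambda>j. T * (2 ^ j) powr \<tau> * (2 / 2 ^ j) ^ k) \<longlonglongrightarrow> 0"
      using eq by (simp add: mult.assoc)
    hence "(\<lambda>j. l j k) \<longlonglongrightarrow> 0"
      by (rule Lim_null_comparison[rotated]) (use top in \<open>auto simp: eventually_sequentially\<close>)
    thus ?thesis using c0(1)[OF k(1)] LIMSEQ_unique by blast
  qed
  define B where "B = A / (1 - s) + (\<Sum>k\<le>p. B1 k)"
  have Bs: "(\<Sum>k\<le>p. B1 k) \<ge> 0" by (intro sum_nonneg B1) auto
  have As: "A / (1 - s) \<ge> 0" using A s by simp
  have main: "norm (l j k - c k) \<le> B * (2 ^ j) powr \<sigma> * (2 / 2 ^ j) ^ k" if j: "j \<ge> j0" for j k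
  proof -
    have qp: "q k ^ j \<ge> 0" using q[of k] by simp
    have "norm (l j k - c k) \<le> B * (2 ^ k * q k ^ j)"
    proof (cases "k > p")
      case True
      have "norm (l j k - c k) \<le> A * 2 ^ k * q k ^ j / (1 - q k)" using c0(2)[OF True j] True by (simp add: c_def)
      also have "\<dots> \<le> A * 2 ^ k * q k ^ j / (1 - s)"
        using qs[OF True] s A qp by (intro divide_left_mono mult_nonneg_nonneg mult_pos_pos) auto
      also have "\<dots> = A / (1 - s) * (2 ^ k * q k ^ j)" by simp
      also have "\<dots> \<le> B * (2 ^ k * q k ^ j)" unfolding B_def using Bs qp by (intro mult_right_mono) auto
      finally show ?thesis .
    next
      case False
      have "norm (l j k - c k) \<le> B1 k * q k ^ j" using B1(2)[of k j] False j by (simp add: c_def)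
      also have "\<dots> \<le> B * q k ^ j"
      proof (rule mult_right_mono[OF _ qp])
        have "B1 k \<le> (\<Sum>k\<le>p. B1 k)" using False B1(1) by (intro member_le_sum) auto
        thus "B1 k \<le> B" using As by (simp add: B_def)
      qed
      also have "\<dots> \<le> B * (2 ^ k * q k ^ j)"
        using Bs As qp mult_right_mono[of 1 "2 ^ k" "q k ^ j"] by (intro mult_left_mono) (auto simp: B_def)
      finally show ?thesis .
    qed
    thus ?thesis using qj[of j k] by (simp only: mult.assoc)
  qed
  have "c k = 0" if "k \<notin> {p<..d}" for k using that high[of k] by (auto simp: c_def)
  thus ?thesis using main Bs As by (intro exI[of _ c] exI[of _ B]) (auto simp: B_def)
qed

text \<open>On |z| \<le> R_j / 4, with R_j = 2^j, \<open>f\<close> splits into the product over its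
  zeros, the constant \<open>E j 0\<close> and exp of \<open>M j\<close>. The logarithms of the
  first two have an upper bound O(R_j^\<sigma>) in total once the terms n ln R_j cancel, and
  \<open>M j\<close> differs from the polynomial by O(R_j^\<sigma>).\<close>

lemma Hadamard_few_zeros:
  fixes f :: "complex \<Rightarrow> complex" and \<sigma> \<tau> :: real
  assumes f: "entire f" "nonnull f"
    and grow: "\<And>w. norm w \<ge> R0 \<Longrightarrow> norm (f w) \<le> exp (C * norm w powr \<tau>)" and C: "C \<ge> 0" and R0: "R0 \<ge> 1"
    and count: "\<And>R. R \<ge> R0 \<Longrightarrow> zero_int_count R f \<le> D * R powr \<sigma>" and D: "D \<ge> 0"
    and \<sigma>: "real p < \<sigma>" "\<sigma> < real p + 1" and \<tau>: "\<tau> > 0" "\<tau> < real d + 1"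
  shows "\<exists>c B R1. R1 \<ge> 1 \<and> B \<ge> 0 \<and> (\<forall>z. norm z \<ge> R1 \<longrightarrow>
     norm (f z * exp (- (\<Sum>k\<in>{p<..d}. c k * z ^ k))) \<le> exp (B * norm z powr \<sigma>))"
proof -
  have \<sigma>0: "\<sigma> > 0" using \<sigma>(1) by linarith
  define R where "R j = (2::real) ^ j" for j :: nat
  have R: "R j \<ge> 1" "R j > 0" for j by (auto simp: R_def)
  have "\<forall>j. \<exists>E. cofactor f (R j) E" using cofactor_exists[OF f] by blast
  then obtain E where E: "\<And>j. cofactor f (R j) (E j)" by metis
  have "\<exists>L. L holomorphic_on ball 0 (R j) \<and> (\<forall>z. norm z < R j \<longrightarrow> exp (L z) = E j z) \<and>
     (\<forall>z. norm z < R j \<longrightarrow> ln (norm (E j z)) = Re (L z))" for j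
    using cofactor_log[OF E[of j] R(2)[of j]] by metis
  then obtain L where L: "\<And>j. L j holomorphic_on ball 0 (R j)" "\<And>j z. norm z < R j \<Longrightarrow> exp (L j z) = E j z"
    "\<And>j z. norm z < R j \<Longrightarrow> ln (norm (E j z)) = Re (L j z)" by metis
  define M where "M j z = L j z - L j 0" for j z
  have M0: "M j 0 = 0" for j by (simp add: M_def)
  have Mhol: "M j holomorphic_on ball 0 (R j)" for j
    unfolding M_def[abs_def] by (intro holomorphic_intros L(1))
  have EM: "E j z = E j 0 * exp (M j z)" if "norm z < R j" for j z
  proof -
    have "exp (L j 0) = E j 0" using L(2)[of 0 j] R(2)[of j] by simp
    moreover from this have "E j 0 \<noteq> 0" by (metis exp_not_eq_zero)
    ultimately show ?thesis using L(2)[OF that] by (simp add: M_def exp_diff)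
  qed
  define l where "l j k = (deriv ^^ k) (M j) 0 / fact k" for j k
  obtain j0 where "R0 < 2 ^ j0" using real_arch_pow[of 2 R0] by auto
  hence j0: "R0 \<le> R j0" by (simp add: R_def)
  have Rj: "R0 \<le> R j" if "j \<ge> j0" for j
    using order_trans[OF j0, of "R j"] power_increasing[OF that, of "2::real"] by (simp add: R_def)
  have zc: "zero_count f (R j) \<le> D * exp 1 powr \<sigma> * R j powr \<sigma>" if "j \<ge> j0" for j
  proof -
    have "1 * R j \<le> exp 1 * R j" using R[of j] by (intro mult_right_mono) auto
    hence "R0 \<le> exp 1 * R j" using Rj[OF that] by linarith
    hence "zero_int_count (exp 1 * R j) f \<le> D * (exp 1 * R j) powr \<sigma>" by (rule count)
    thus ?thesis using zero_count_le_int_count[OF f R(1), of j] R(2)[of j] by (simp add: powr_mult)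
  qed
  define T where "T = 2 * (C * 2 powr \<tau> + \<bar>ln (lead f)\<bar>)"
  have top: "norm (l j k) \<le> T * (2 ^ j) powr \<tau> * (2 / 2 ^ j) ^ k" if j: "j \<ge> j0" for j k
    unfolding l_def R_def[symmetric]
  proof (rule coeff_bound[OF Mhol R(2)])
    fix z :: complex assume z: "norm z \<le> R j / 2"
    have "norm (L j z - L j 0) \<le> 2 * (C * (2 * R j) powr \<tau> - ln (lead f))"
    proof (rule cofactor_log_bound[OF f R(1) E _ L(1) L(3) z])
      show "norm (f w) \<le> exp (C * (2 * R j) powr \<tau>)" if "norm w = 2 * R j" for w
        using grow[of w] that Rj[OF j] R(1)[of j] by simp
    qed
    also have "\<dots> \<le> 2 * (C * (2 * R j) powr \<tau> + \<bar>ln (lead f)\<bar> * R j powr \<tau>)"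
    proof -
      have "1 \<le> R j powr \<tau>" using R(1)[of j] \<tau>(1) by (intro ge_one_powr_ge_zero) auto
      hence "\<bar>ln (lead f)\<bar> * 1 \<le> \<bar>ln (lead f)\<bar> * R j powr \<tau>" by (intro mult_left_mono) auto
      thus ?thesis by simp
    qed
    also have "\<dots> = T * R j powr \<tau>" using R(2)[of j] by (simp add: T_def powr_mult algebra_simps)
    finally show "norm (M j z) \<le> T * R j powr \<tau>" by (simp add: M_def)
  qed
  \<comment> \<open>The 2 comes from \<open>cofactor_log_step\<close>, the e from comparing the
    number of zeros with N at an e times larger radius, and the last factor from counting zeros up
    to the next dyadic radius.\<close>
  define A where "A = 2 * (D * exp 1 powr \<sigma> * 2 powr \<sigma>)"
  have step: "norm (l (Suc j) k - l j k) \<le> A * (2 ^ j) powr \<sigma> * (2 / 2 ^ j) ^ k" if j: "j \<ge> j0" for j k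
  proof -
    have "norm (l (Suc j) k - l j k) \<le> 2 * zero_count f (R (Suc j)) * (2 / R j) ^ k"
      unfolding l_def
      by (rule cofactor_log_step[OF f R(2) _ E E Mhol M0 EM Mhol M0 EM]) (auto simp: R_def)
    also have "\<dots> \<le> A * R j powr \<sigma> * (2 / R j) ^ k"
    proof (rule mult_right_mono)
      have "zero_count f (R (Suc j)) \<le> D * exp 1 powr \<sigma> * (2 * R j) powr \<sigma>" using zc[of "Suc j"] j by (simp add: R_def)
      also have "(2 * R j) powr \<sigma> = 2 powr \<sigma> * R j powr \<sigma>" using R(2)[of j] by (simp add: powr_mult)
      finally show "2 * zero_count f (R (Suc j)) \<le> A * R j powr \<sigma>" by (simp add: A_def mult.assoc)
    qed (use R(2)[of j] in auto)
    finally show ?thesis by (simp add: R_def)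
  qed
  have l0: "l j 0 = 0" for j by (simp add: l_def M0)
  have A: "A \<ge> 0" using D by (simp add: A_def)
  obtain c B where c: "B \<ge> 0" "\<forall>k. k \<notin> {p<..d} \<longrightarrow> c k = 0"
     "\<forall>j\<ge>j0. \<forall>k. norm (l j k - c k) \<le> B * (2 ^ j) powr \<sigma> * (2 / 2 ^ j) ^ k"
    using Hadamard_coefficients[OF step top l0 A \<sigma> \<tau>(2)] by blast
  define P where "P z = (\<Sum>k\<in>{p<..d}. c k * z ^ k)" for z
  \<comment> \<open>The summands pay, in this order, for n ln 2, for the leading coefficient, for N,
    and for the distance between \<open>M j\<close> and the polynomial.\<close>
  define B' where "B' = D * exp 1 powr \<sigma> + \<bar>ln (lead f)\<bar> + D + 2 * B"
  have B': "B' \<ge> 0" using D c(1) by (simp add: B'_def)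
  have main: "norm (f z * exp (- P z)) \<le> exp (B' * 8 powr \<sigma> * norm z powr \<sigma>)" if z: "norm z \<ge> R j0" for z
  proof -
    \<comment> \<open>Minimality of the dyadic radius gives \<open>R j\<close> \<le> 8|z|, the
      origin of \<open>8 powr \<sigma>\<close>.\<close>
    define j where "j = (LEAST j. norm z \<le> R j / 4)"
    obtain j' where "4 * norm z < R j'" using real_arch_pow[of 2 "4 * norm z"] by (auto simp: R_def)
    hence "norm z \<le> R j' / 4" by simp
    hence j1: "norm z \<le> R j / 4" unfolding j_def by (rule LeastI)
    have "j \<noteq> 0"
    proof
      assume "j = 0"
      hence "norm z \<le> 1 / 4" using j1 by (simp add: R_def)
      thus False using z R(1)[of j0] by simp
    qed
    hence "\<not> norm z \<le> R (j - 1) / 4" unfolding j_def by (intro not_less_Least) auto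
    moreover have "R j = 2 * R (j - 1)" using \<open>j \<noteq> 0\<close> by (cases j) (auto simp: R_def)
    ultimately have j2: "R j \<le> 8 * norm z" by simp
    have jj0: "j \<ge> j0"
    proof (rule ccontr)
      assume "\<not> j \<ge> j0"
      hence "R j \<le> R j0" by (simp add: R_def)
      thus False using j1 z R(2)[of j0] by simp
    qed
    have bM: "norm (M j z - P z) \<le> 2 * (B * R j powr \<sigma>)"
      unfolding P_def
    proof (rule power_series_diff_bound[OF Mhol R(2) _ _ _ j1])
      show "norm ((deriv ^^ k) (M j) 0 / fact k - c k) \<le> B * R j powr \<sigma> * (2 / R j) ^ k" for k
        using c(3) jj0 unfolding l_def R_def by blast
    qed (use c(2) in auto)
    have zR: "norm z < R j" using j1 R(2)[of j] by simp
    let ?n = "zero_count f (R j)"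
    have E0: "E j 0 \<noteq> 0" using cofactorD(3)[OF E[of j], of 0] R(2)[of j] by simp
    have nE: "norm (E j 0) = exp (ln (lead f) + zero_int_count (R j) f - ?n * ln (R j))"
      using cofactor_centre[OF f R(2) E, of j] E0 by (metis add_diff_cancel_right' exp_ln zero_less_norm_iff)
    have Q: "norm (\<Prod>a\<in>zeros_in f (R j). (z - a) ^ zmult f a) \<le> exp (?n * ln 2 + ?n * ln (R j))"
    proof -
      have "norm (\<Prod>a\<in>zeros_in f (R j). (z - a) ^ zmult f a) = (\<Prod>a\<in>zeros_in f (R j). norm (z - a) ^ zmult f a)"
        by (simp add: prod_norm[symmetric] norm_power)
      also have "\<dots> \<le> (\<Prod>a\<in>zeros_in f (R j). (2 * R j) ^ zmult f a)"
      proof (intro prod_mono conjI power_mono)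
        fix a assume "a \<in> zeros_in f (R j)"
        hence "norm a \<le> R j" by (simp add: zeros_in_def)
        thus "norm (z - a) \<le> 2 * R j" using norm_triangle_ineq4[of z a] zR by simp
      qed auto
      also have "\<dots> = exp (?n * ln (2 * R j))" using R(2)[of j] by (intro prod_zeros_const) simp
      also have "ln (2 * R j) = ln 2 + ln (R j)" using R(2)[of j] by (simp add: ln_mult)
      finally show ?thesis by (simp add: distrib_left)
    qed
    have "f z * exp (- P z) = zero_prod f (R j) z * E j 0 * exp (M j z - P z)"
      unfolding cofactorD(2)[OF E[of j], of z] EM[OF zR] by (simp add: exp_diff exp_minus field_simps)
    hence "norm (f z * exp (- P z)) = norm (\<Prod>a\<in>zeros_in f (R j). (z - a) ^ zmult f a) * norm (E j 0) * exp (Re (M j z - P z))"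
      by (simp only: norm_mult norm_exp_eq_Re)
    also have "\<dots> \<le> exp (?n * ln 2 + ?n * ln (R j)) * exp (ln (lead f) + zero_int_count (R j) f - ?n * ln (R j)) * exp (2 * (B * R j powr \<sigma>))"
      unfolding nE using Q order_trans[OF complex_Re_le_cmod bM]
      by (intro mult_mono) auto
    also have "\<dots> = exp (?n * ln 2 + ln (lead f) + zero_int_count (R j) f + 2 * B * R j powr \<sigma>)"
      unfolding exp_add[symmetric] by (rule arg_cong[of _ _ exp]) simp
    also have "\<dots> \<le> exp (B' * R j powr \<sigma>)"
    proof (rule iffD2[OF exp_le_cancel_iff])
      have "?n * ln 2 \<le> ?n * 1" using zero_count_nonneg[of f "R j"] ln_2_less_1 by (intro mult_left_mono) auto
      hence 1: "?n * ln 2 \<le> D * exp 1 powr \<sigma> * R j powr \<sigma>" using zc[OF jj0] by simp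
      have "1 \<le> R j powr \<sigma>" using R(1)[of j] \<sigma>0 by (intro ge_one_powr_ge_zero) auto
      hence 2: "ln (lead f) \<le> \<bar>ln (lead f)\<bar> * R j powr \<sigma>"
        using mult_left_mono[of 1 "R j powr \<sigma>" "\<bar>ln (lead f)\<bar>"] by simp
      have 3: "zero_int_count (R j) f \<le> D * R j powr \<sigma>" by (rule count[OF Rj[OF jj0]])
      show "?n * ln 2 + ln (lead f) + zero_int_count (R j) f + 2 * B * R j powr \<sigma> \<le> B' * R j powr \<sigma>"
        using 1 2 3 unfolding B'_def distrib_right by linarith
    qed
    also have "\<dots> \<le> exp (B' * (8 powr \<sigma> * norm z powr \<sigma>))"
    proof -
      have "R j powr \<sigma> \<le> (8 * norm z) powr \<sigma>" using j2 R(2)[of j] \<sigma>0 by (intro powr_mono2) auto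
      hence "R j powr \<sigma> \<le> 8 powr \<sigma> * norm z powr \<sigma>" by (simp add: powr_mult)
      thus ?thesis using B' by (simp add: mult_left_mono)
    qed
    finally show ?thesis by (simp add: mult.assoc)
  qed
  show ?thesis
    by (intro exI[of _ c] exI[of _ "B' * 8 powr \<sigma>"] exI[of _ "R j0"] conjI allI impI)
       (use main B' R in \<open>auto simp: P_def\<close>)
qed

section \<open>Orders of growth and the exponential form of f\<close>

lemma Limsup_log_ratio_le:
  assumes "\<forall>\<^sub>F r in at_top. N r \<le> C * r powr t" "t \<ge> 0"
  shows "Limsup at_top (\<lambda>r::real. ereal (log_plus (N r) / ln r)) \<le> ereal t"
proof -
  have "((\<lambda>r::real. ln (1 + \<bar>C\<bar>) / ln r + t) \<longlongrightarrow> 0 + t) at_top"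
    by (intro tendsto_add tendsto_const tendsto_divide_0[OF tendsto_const]
        filterlim_at_top_imp_at_infinity ln_at_top)
  hence "((\<lambda>r::real. ereal (ln (1 + \<bar>C\<bar>) / ln r + t)) \<longlongrightarrow> ereal t) at_top" by simp
  hence lim: "Limsup at_top (\<lambda>r::real. ereal (ln (1 + \<bar>C\<bar>) / ln r + t)) = ereal t"
    by (intro lim_imp_Limsup) auto
  have "\<forall>\<^sub>F r in at_top. ereal (log_plus (N r) / ln r) \<le> ereal (ln (1 + \<bar>C\<bar>) / ln r + t)"
    using assms(1) eventually_ge_at_top[of 2]
  proof eventually_elim
    case (elim r)
    have l: "ln r > 0" using elim by simp
    have 1: "r powr t \<ge> 1" using elim assms(2) by (intro ge_one_powr_ge_zero) auto
    have "C * r powr t \<le> \<bar>C\<bar> * r powr t" by (intro mult_right_mono) auto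
    moreover have "\<bar>C\<bar> * r powr t \<ge> 0" by simp
    ultimately have "max 1 (N r) \<le> (1 + \<bar>C\<bar>) * r powr t" using elim 1 unfolding distrib_right by linarith
    hence "log_plus (N r) \<le> ln ((1 + \<bar>C\<bar>) * r powr t)" unfolding log_plus_def by (intro ln_mono) auto
    also have "\<dots> = ln (1 + \<bar>C\<bar>) + t * ln r" using elim by (simp add: ln_mult ln_powr)
    finally have "log_plus (N r) / ln r \<le> (ln (1 + \<bar>C\<bar>) + t * ln r) / ln r" using l by (intro divide_right_mono) auto
    thus ?case using l by (simp add: add_divide_distrib)
  qed
  from Limsup_mono[OF this] show ?thesis unfolding lim .
qed

lemma Limsup_log_ratio_ge:
  assumes "\<forall>\<^sub>F r in at_top. C * r powr t \<le> N r" "C > 0"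
  shows "ereal t \<le> Limsup at_top (\<lambda>r::real. ereal (log_plus (N r) / ln r))"
proof -
  have "((\<lambda>r::real. ln C / ln r + t) \<longlongrightarrow> 0 + t) at_top"
    by (intro tendsto_add tendsto_const tendsto_divide_0[OF tendsto_const]
        filterlim_at_top_imp_at_infinity ln_at_top)
  hence "((\<lambda>r::real. ereal (ln C / ln r + t)) \<longlongrightarrow> ereal t) at_top" by simp
  hence lim: "Limsup at_top (\<lambda>r::real. ereal (ln C / ln r + t)) = ereal t"
    by (intro lim_imp_Limsup) auto
  have "\<forall>\<^sub>F r in at_top. ereal (ln C / ln r + t) \<le> ereal (log_plus (N r) / ln r)"
    using assms(1) eventually_ge_at_top[of 2]
  proof eventually_elim
    case (elim r)
    have l: "ln r > 0" using elim by simp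
    have p: "C * r powr t > 0" using elim assms(2) by simp
    have "ln C + t * ln r = ln (C * r powr t)" using elim assms(2) by (simp add: ln_mult ln_powr)
    also have "\<dots> \<le> log_plus (N r)" unfolding log_plus_def using p elim by (intro ln_mono) auto
    finally have "(ln C + t * ln r) / ln r \<le> log_plus (N r) / ln r" using l by (intro divide_right_mono) auto
    thus ?case using l by (simp add: add_divide_distrib)
  qed
  from Limsup_mono[OF this] show ?thesis unfolding lim .
qed

lemma proximity_le:
  assumes "entire f" "r > 0" "\<And>z. norm z = r \<Longrightarrow> norm (f z) \<le> exp U" "U \<ge> 0"
  shows "proximity r f \<le> U"
proof -
  have "circle_mean r (\<lambda>z. log_plus (norm (f z))) \<le> circle_mean r (\<lambda>_. U)"
  proof (rule circle_mean_mono[of "{}"])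
    fix z :: complex assume "norm z = r"
    hence "max 1 (norm (f z)) \<le> exp U" using assms(3,4) by simp
    hence "ln (max 1 (norm (f z))) \<le> ln (exp U)" by (intro ln_mono) auto
    thus "log_plus (norm (f z)) \<le> U" by (simp add: log_plus_def)
  qed (use assms log_plus_norm_circle_integrable in auto)
  thus ?thesis by (simp add: proximity_eq_circle_mean)
qed

text \<open>The polynomial from the Hadamard argument has no term of degree above floor \<rho>. Were
  all its degrees below \<rho>, the order of \<open>f\<close> would be below \<rho> as well; hence
  \<rho> is an integer and is the degree.\<close>

lemma borel_exceptional_form:
  assumes f: "entire f" "nonnull f" and ord: "growth_order f = ereal \<rho>"
    and ze: "zero_exponent f < growth_order f"
  obtains q a h where "q \<ge> 1" "\<rho> = real q" "a \<noteq> 0" "small q h" "\<And>z. f z = h z * exp (a * z ^ q)"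
proof -
  obtain s where s: "zero_exponent f < ereal s" "s < \<rho>"
    using ze ord ereal_dense2[of "zero_exponent f" "ereal \<rho>"] by auto
  \<comment> \<open>The quotients in the zero exponent are eventually nonnegative, so any number
    above their limsup is positive.\<close>
  have s0: "s > 0"
  proof (rule ccontr)
    assume "\<not> s > 0"
    have "\<forall>\<^sub>F r in at_top. ereal (log_plus (zero_int_count r f) / ln r) < ereal s"
      using s(1) unfolding zero_exponent_def by (rule Limsup_lessD)
    hence "\<forall>\<^sub>F r::real in at_top. False"
      using eventually_ge_at_top[of 2]
    proof eventually_elim
      case (elim r)
      have "log_plus (zero_int_count r f) / ln r \<ge> 0"
        using elim by (intro divide_nonneg_nonneg log_plus_nonneg) auto
      thus ?case using elim \<open>\<not> s > 0\<close> by simp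
    qed
    thus False by simp
  qed
  define p where "p = nat \<lfloor>s\<rfloor>"
  have p: "real p \<le> s" "s < real p + 1" using s0 by (auto simp: p_def)
  \<comment> \<open>Room above \<open>s\<close> keeps \<sigma> strictly between p and p + 1 even
    when \<open>s\<close> is an integer, and still below \<rho>.\<close>
  obtain \<sigma> where \<sigma>: "s < \<sigma>" "\<sigma> < min \<rho> (real p + 1)" using dense[of s "min \<rho> (real p + 1)"] s p by auto
  define d where "d = nat \<lfloor>\<rho>\<rfloor>"
  have \<rho>0: "\<rho> > 0" using s s0 by simp
  have d: "real d \<le> \<rho>" "\<rho> < real d + 1" using \<rho>0 by (auto simp: d_def)
  obtain \<tau> where \<tau>: "\<rho> < \<tau>" "\<tau> < real d + 1" using dense[OF d(2)] by auto
  obtain C R0 where R0: "C > 0" "R0 \<ge> 1" "\<And>w. norm w \<ge> R0 \<Longrightarrow> norm (f w) \<le> exp (C * norm w powr \<tau>)"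
    using growth_order_bound[OF f(1), of \<tau>] ord \<tau>(1) \<rho>0 by auto
  obtain R2 where R2: "R2 \<ge> 1" "\<And>r. r \<ge> R2 \<Longrightarrow> zero_int_count r f \<le> r powr s"
    using Limsup_log_ratio_bound[OF s(1)[unfolded zero_exponent_def]] by auto
  have "\<exists>c B R1. R1 \<ge> 1 \<and> B \<ge> 0 \<and> (\<forall>z. norm z \<ge> R1 \<longrightarrow>
     norm (f z * exp (- (\<Sum>k\<in>{p<..d}. c k * z ^ k))) \<le> exp (B * norm z powr \<sigma>))"
  proof (rule Hadamard_few_zeros[OF f, of "max R0 R2" C \<tau> 1 \<sigma> p d])
    show "zero_int_count R f \<le> 1 * R powr \<sigma>" if "R \<ge> max R0 R2" for R
    proof -
      have "zero_int_count R f \<le> R powr s" using R2(2) that by simp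
      also have "\<dots> \<le> R powr \<sigma>" using that R2(1) \<sigma>(1) by (intro powr_mono) auto
      finally show ?thesis by simp
    qed
  qed (use R0 R2 p \<sigma> \<tau> \<rho>0 in auto)
  then obtain c B R1 where c: "R1 \<ge> 1" "B \<ge> 0" "\<And>z. norm z \<ge> R1 \<Longrightarrow>
     norm (f z * exp (- (\<Sum>k\<in>{p<..d}. c k * z ^ k))) \<le> exp (B * norm z powr \<sigma>)" by blast
  define P where "P z = (\<Sum>k\<in>{p<..d}. c k * z ^ k)" for z
  have bd: "norm (f z) \<le> exp (B * norm z powr \<sigma> + norm (P z))" if "norm z \<ge> R1" for z
  proof -
    have "f z = f z * exp (- P z) * exp (P z)" by (simp add: exp_minus)
    hence "norm (f z) = norm (f z * exp (- P z)) * exp (Re (P z))" by (metis norm_mult norm_exp_eq_Re)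
    also have "\<dots> \<le> exp (B * norm z powr \<sigma>) * exp (norm (P z))"
      using c(3)[OF that] complex_Re_le_cmod[of "P z"] by (intro mult_mono) (auto simp: P_def)
    finally show ?thesis by (simp add: exp_add)
  qed
  have ex: "\<exists>k\<in>{p<..d}. c k \<noteq> 0 \<and> real k \<ge> \<rho>"
  proof (rule ccontr)
    assume no: "\<not> ?thesis"
    define K where "K = {k\<in>{p<..d}. c k \<noteq> 0}"
    \<comment> \<open>The largest exponent in the bound for ln|f|: it is below \<rho>, since
      \<sigma> and all degrees in \<open>K\<close> are.\<close>
    define t where "t = Max (insert \<sigma> (real ` K))"
    have fin: "finite K" by (simp add: K_def)
    have t: "t < \<rho>" "\<sigma> \<le> t" "\<And>k. k \<in> K \<Longrightarrow> real k \<le> t"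
      using fin no \<sigma> by (auto simp: t_def K_def)
    have t0: "t > 0" using t(2) \<sigma>(1) s0 by linarith
    define C' where "C' = B + (\<Sum>k\<in>K. norm (c k))"
    have C': "C' \<ge> 0" using c(2) by (auto simp: C'_def intro!: add_nonneg_nonneg sum_nonneg)
    have "norm (f z) \<le> exp (C' * norm z powr t)" if z: "norm z \<ge> R1" for z
    proof -
      have z1: "norm z \<ge> 1" using z c(1) by simp
      have "P z = (\<Sum>k\<in>K. c k * z ^ k)"
        unfolding P_def K_def by (rule sum.mono_neutral_right) auto
      hence "norm (P z) \<le> (\<Sum>k\<in>K. norm (c k * z ^ k))" using norm_sum by metis
      also have "\<dots> \<le> (\<Sum>k\<in>K. norm (c k) * norm z powr t)"
      proof (rule sum_mono)
        fix k assume k: "k \<in> K"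
        have "norm z ^ k = norm z powr real k" using z1 by (subst powr_realpow) auto
        also have "\<dots> \<le> norm z powr t" using z1 t(3)[OF k] by (intro powr_mono) auto
        finally show "norm (c k * z ^ k) \<le> norm (c k) * norm z powr t"
          unfolding norm_mult norm_power by (intro mult_left_mono) auto
      qed
      finally have "norm (P z) \<le> (\<Sum>k\<in>K. norm (c k)) * norm z powr t" by (simp add: sum_distrib_right)
      moreover have "B * norm z powr \<sigma> \<le> B * norm z powr t" using z1 t(2) c(2) by (intro mult_left_mono powr_mono) auto
      ultimately have "B * norm z powr \<sigma> + norm (P z) \<le> C' * norm z powr t" by (simp add: C'_def distrib_right)
      thus ?thesis using bd[OF z] order_trans by (metis exp_le_cancel_iff)
    qed
    hence "nev_char r f \<le> C' * r powr t" if "r \<ge> R1" for r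
      unfolding nev_char_entire[OF f(1)] using that c(1) C' by (intro proximity_le[OF f(1)]) auto
    hence "\<forall>\<^sub>F r in at_top. nev_char r f \<le> C' * r powr t" by (auto simp: eventually_at_top_linorder)
    hence "growth_order f \<le> ereal t" unfolding growth_order_def using t0 by (intro Limsup_log_ratio_le) auto
    thus False using ord t(1) by simp
  qed
  then obtain k where k: "k \<in> {p<..d}" "c k \<noteq> 0" "real k \<ge> \<rho>" by blast
  hence kd: "k = d" "\<rho> = real d" using d by auto
  have d1: "d \<ge> 1" using k(1) by auto
  \<comment> \<open>Terms of degree below \<open>d\<close> have small exponentials and move into the
    factor \<open>h\<close>, so that a pure monomial remains in the exponent.\<close>
  define Q where "Q z = (\<Sum>k\<in>{p<..<d}. c k * z ^ k)" for z
  have PQ: "P z = Q z + c d * z ^ d" for z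
  proof -
    have "{p<..d} = insert d {p<..<d}" using k(1) kd(1) by auto
    thus ?thesis unfolding P_def Q_def by simp
  qed
  have holQ: "entire Q" unfolding Q_def by (intro holomorphic_intros)
  have sQ: "small d (\<lambda>z. exp (Q z))"
  proof (rule small_exp[OF holQ d1])
    fix z :: complex assume z: "norm z \<ge> 1"
    have "norm (Q z) \<le> (\<Sum>k\<in>{p<..<d}. norm (c k * z ^ k))" unfolding Q_def by (rule norm_sum)
    also have "\<dots> \<le> (\<Sum>k\<in>{p<..<d}. norm (c k) * norm z ^ (d - 1))"
      unfolding norm_mult norm_power using z by (intro sum_mono mult_left_mono power_increasing) auto
    finally show "norm (Q z) \<le> (\<Sum>k\<in>{p<..<d}. norm (c k)) * norm z ^ (d - 1)" by (simp add: sum_distrib_right)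
  qed
  have sf: "small d (\<lambda>z. f z * exp (- P z))"
  proof (rule smallI)
    show "(\<lambda>z. f z * exp (- P z)) holomorphic_on UNIV"
      unfolding P_def using f(1) by (intro holomorphic_intros)
    fix e :: real assume e: "e > 0"
    have lim: "((\<lambda>r::real. r powr (\<sigma> - real d)) \<longlongrightarrow> 0) at_top"
      using \<sigma>(2) kd(2) by (intro tendsto_neg_powr filterlim_ident) auto
    have "\<forall>\<^sub>F r in at_top. r powr (\<sigma> - real d) < e / (B + 1)"
      using e c(2) by (intro order_tendstoD(2)[OF lim]) auto
    then obtain N where N: "\<And>r. r \<ge> N \<Longrightarrow> r powr (\<sigma> - real d) < e / (B + 1)" by (auto simp: eventually_at_top_linorder)
    show "\<exists>R. \<forall>z. norm z \<ge> R \<longrightarrow> norm (f z * exp (- P z)) \<le> exp (e * norm z ^ d)"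
    proof (intro exI[of _ "max R1 N"] allI impI)
      fix z :: complex assume z: "norm z \<ge> max R1 N"
      have z1: "norm z \<ge> 1" using z c(1) by simp
      have "norm z powr \<sigma> = norm z powr (\<sigma> - real d) * norm z ^ d"
        using z1 by (subst powr_realpow[symmetric]) (auto simp: powr_add[symmetric])
      also have "\<dots> \<le> e / (B + 1) * norm z ^ d" using N[of "norm z"] z by (intro mult_right_mono) auto
      finally have "B * norm z powr \<sigma> \<le> B * (e / (B + 1) * norm z ^ d)" using c(2) by (rule mult_left_mono)
      also have "\<dots> = B / (B + 1) * (e * norm z ^ d)" by simp
      also have "\<dots> \<le> 1 * (e * norm z ^ d)" using c(2) e by (intro mult_right_mono) (auto simp: field_simps)
      finally have "B * norm z powr \<sigma> \<le> e * norm z ^ d" by simp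
      thus "norm (f z * exp (- P z)) \<le> exp (e * norm z ^ d)"
        using c(3)[of z] z unfolding P_def by (meson exp_le_cancel_iff order_trans max.boundedE)
    qed
  qed
  show ?thesis
  proof (rule that[of d "c d" "\<lambda>z. f z * exp (- P z) * exp (Q z)"])
    show "small d (\<lambda>z. f z * exp (- P z) * exp (Q z))" by (rule small_mult[OF sf sQ])
    show "f z = f z * exp (- P z) * exp (Q z) * exp (c d * z ^ d)" for z
    proof -
      have "exp (- P z) * exp (Q z) * exp (c d * z ^ d) = 1"
        unfolding exp_add[symmetric] PQ by simp
      thus ?thesis by (simp only: mult.assoc mult_1_right)
    qed
  qed (use d1 kd k in auto)
qed

section \<open>The differential-difference operator\<close>

text \<open>One derivative replaces the coefficient g by g' + a q z^(q-1) g, and derivatives and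
  polynomial factors preserve \<open>small\<close>.\<close>

lemma higher_deriv_exp_form:
  assumes "\<And>z. f z = h z * exp (a * z ^ q)" "small q h" "q \<ge> 1"
  shows "\<exists>h'. small q h' \<and> (\<forall>z. (deriv ^^ k) f z = h' z * exp (a * z ^ q))"
proof (induction k)
  case 0
  show ?case using assms by auto
next
  case (Suc k)
  then obtain g where g: "small q g" "\<And>z. (deriv ^^ k) f z = g z * exp (a * z ^ q)" by blast
  define g' where "g' z = deriv g z + g z * (a * of_nat q * z ^ (q - 1))" for z
  have "small q (\<lambda>z. a * of_nat q * z ^ (q - 1))"
    by (rule small_polynomial_growth[where C = "norm (a * of_nat q)" and k = "q - 1"])
       (use assms(3) in \<open>auto intro!: holomorphic_intros simp: norm_mult norm_power\<close>)
  hence s: "small q g'"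
    unfolding g'_def by (rule small_add[OF small_deriv[OF g(1)] small_mult[OF g(1)] assms(3)])
  have "(deriv ^^ Suc k) f z = g' z * exp (a * z ^ q)" for z
  proof -
    have d: "(g has_field_derivative deriv g z) (at z)"
      by (rule holomorphic_derivI[OF small_holomorphic[OF g(1)]]) auto
    have "((\<lambda>z. g z * exp (a * z ^ q)) has_field_derivative g' z * exp (a * z ^ q)) (at z)"
      unfolding g'_def by (auto intro!: derivative_eq_intros d simp: algebra_simps)
    moreover have "(deriv ^^ k) f = (\<lambda>z. g z * exp (a * z ^ q))" using g(2) by auto
    ultimately show ?thesis by (simp add: DERIV_imp_deriv)
  qed
  thus ?case using s by blast
qed

text \<open>The two leading terms cancel, so the exponent has degree at most q - 1; factoring x^q -
  y^q makes the bound explicit.\<close>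

lemma shift_exp_form:
  assumes "q \<ge> 1"
  shows "small q (\<lambda>z. exp (a * (z + c) ^ q - a * z ^ q))"
proof (rule small_exp[OF _ assms])
  show "(\<lambda>z. a * (z + c) ^ q - a * z ^ q) holomorphic_on UNIV" by (intro holomorphic_intros)
  fix z :: complex assume z: "norm z \<ge> 1"
  have 1: "norm (z + c) \<le> (1 + norm c) * norm z"
  proof -
    have "norm (z + c) \<le> norm z + norm c * 1" using norm_triangle_ineq[of z c] by simp
    also have "norm c * 1 \<le> norm c * norm z" using z by (intro mult_left_mono) auto
    finally show ?thesis by (simp add: algebra_simps)
  qed
  have 2: "norm z \<le> (1 + norm c) * norm z" using mult_right_mono[of 1 "1 + norm c" "norm z"] by simp
  have "(z + c) ^ q - z ^ q = (z + c - z) * (\<Sum>i<q. z ^ (q - Suc i) * (z + c) ^ i)"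
    by (rule power_diff_sumr2)
  hence eq: "a * (z + c) ^ q - a * z ^ q = a * c * (\<Sum>i<q. z ^ (q - Suc i) * (z + c) ^ i)"
    by (simp add: right_diff_distrib[symmetric] mult.assoc)
  have "norm (\<Sum>i<q. z ^ (q - Suc i) * (z + c) ^ i) \<le> (\<Sum>i<q. ((1 + norm c) * norm z) ^ (q - 1))"
  proof (rule sum_norm_le)
    fix i assume i: "i \<in> {..<q}"
    have "norm (z ^ (q - Suc i) * (z + c) ^ i) \<le> ((1 + norm c) * norm z) ^ (q - Suc i) * ((1 + norm c) * norm z) ^ i"
      unfolding norm_mult norm_power using 1 2 by (intro mult_mono power_mono) auto
    also have "\<dots> = ((1 + norm c) * norm z) ^ (q - 1)" using i by (simp add: power_add[symmetric])
    finally show "norm (z ^ (q - Suc i) * (z + c) ^ i) \<le> ((1 + norm c) * norm z) ^ (q - 1)" .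
  qed
  also have "\<dots> = real q * (1 + norm c) ^ (q - 1) * norm z ^ (q - 1)" by (simp add: power_mult_distrib)
  finally have "norm (a * c) * norm (\<Sum>i<q. z ^ (q - Suc i) * (z + c) ^ i) \<le>
      norm (a * c) * (real q * (1 + norm c) ^ (q - 1) * norm z ^ (q - 1))" by (intro mult_left_mono) auto
  thus "norm (a * (z + c) ^ q - a * z ^ q) \<le> norm (a * c) * (real q * (1 + norm c) ^ (q - 1)) * norm z ^ (q - 1)"
    unfolding eq norm_mult by (simp add: mult.assoc)
qed

lemma diff_difference_op_exp_form:
  assumes "\<And>z. f z = h z * exp (a * z ^ q)" "small q h" "q \<ge> 1" "\<And>j. j \<le> m \<Longrightarrow> small q (b j)"
  shows "\<exists>H. small q H \<and> (\<forall>z. diff_difference_op m b k c f z = H z * exp (a * z ^ q))"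
proof -
  have "\<forall>n. \<exists>h'. small q h' \<and> (\<forall>z. (deriv ^^ n) f z = h' z * exp (a * z ^ q))"
    using higher_deriv_exp_form[OF assms(1-3)] by blast
  then obtain g where g: "\<And>n. small q (g n)" "\<And>n z. (deriv ^^ n) f z = g n z * exp (a * z ^ q)" by metis
  define H where "H z = (\<Sum>j\<le>m. b j z * (g (k j) (z + c j) * exp (a * (z + c j) ^ q - a * z ^ q)))" for z
  have "small q H"
    unfolding H_def
    by (intro small_sum small_mult small_shift[of q "g (k j)" for j] shift_exp_form assms(3,4) g(1)) auto
  moreover have "diff_difference_op m b k c f z = H z * exp (a * z ^ q)" for z
    unfolding diff_difference_op_def H_def sum_distrib_right g(2)
    by (intro sum.cong refl) (simp add: exp_diff)
  ultimately show ?thesis by blast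
qed

section \<open>From \<lambda>-smallness to minimal type\<close>

lemma eventually_at_top_off_mono:
  assumes "eventually P (at_top_off F)" "F \<subseteq> G"
  shows "eventually P (at_top_off G)"
  using assms unfolding eventually_at_top_off by blast

lemma eventually_at_top_imp_off: "eventually P at_top \<Longrightarrow> eventually P (at_top_off F)"
  unfolding eventually_at_top_off eventually_at_top_linorder by blast

lemma eventually_powr_le_power:
  assumes "t < real q" "\<eta> > 0"
  shows "\<forall>\<^sub>F r in at_top. C * r powr t \<le> \<eta> * r ^ q"
proof -
  have lim: "((\<lambda>r::real. r powr (t - real q)) \<longlongrightarrow> 0) at_top"
    using assms by (intro tendsto_neg_powr filterlim_ident) auto
  have "((\<lambda>r::real. C * r powr (t - real q)) \<longlongrightarrow> C * 0) at_top" by (intro tendsto_mult_left lim)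
  hence "\<forall>\<^sub>F r in at_top. C * r powr (t - real q) < \<eta>" using assms(2) by (intro order_tendstoD(2)) auto
  thus ?thesis using eventually_ge_at_top[of 1]
  proof eventually_elim
    case (elim r)
    have "r powr t = r powr (t - real q) * r ^ q"
      using elim by (subst powr_realpow[symmetric]) (auto simp: powr_add[symmetric])
    hence "C * r powr t = C * r powr (t - real q) * r ^ q" by simp
    also have "\<dots> \<le> \<eta> * r ^ q" using elim by (intro mult_right_mono) auto
    finally show ?case .
  qed
qed

text \<open>Both error terms are o(r^q): the power because \<epsilon> leaves lam + \<epsilon> < q,
  and S(r,f) because T(r,f) = O(r^q). Each brings its own exceptional set, and
  \<open>small_of_proximity\<close> disposes of their union.\<close>

lemma lambda_small_imp_small:
  assumes f: "growth_order f = ereal (real q)" and T: "\<forall>\<^sub>F r in at_top. \<bar>nev_char r f\<bar> \<le> C * r ^ q"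
    and lam: "lam < real q" and b: "entire b" "lambda_small lam f b"
  shows "small q b"
proof -
  define \<epsilon> where "\<epsilon> = (real q - lam) / 2"
  have e: "0 < \<epsilon>" "ereal \<epsilon> < growth_order f - ereal lam" "lam + \<epsilon> < real q"
    using lam f by (auto simp: \<epsilon>_def field_simps)
  have "S_lambda_term lam f (\<lambda>r. nev_char r b)" using b(2) by (simp add: lambda_small_def)
  then obtain F u s where F: "finite_log_measure F" and u: "u \<in> O[at_top_off F](\<lambda>r. r powr (lam + \<epsilon>))"
    and s: "S_term f s" and eq: "\<forall>\<^sub>F r in at_top_off F. nev_char r b = u r + s r"
    using e(1,2) unfolding S_lambda_term_def by blast
  obtain F' where F': "finite_log_measure F'" and s: "s \<in> o[at_top_off F'](\<lambda>r. nev_char r f)"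
    using s unfolding S_term_def by blast
  obtain c where c: "\<forall>\<^sub>F r in at_top_off F. norm (u r) \<le> c * norm (r powr (lam + \<epsilon>))"
    using u by (rule landau_o.bigE)
  show ?thesis
  proof (rule small_of_proximity[OF b(1) finite_log_measure_Un[OF F F']])
    fix \<eta> :: real assume \<eta>: "\<eta> > 0"
    define \<delta> where "\<delta> = \<eta> / (2 * (\<bar>C\<bar> + 1))"
    have \<delta>: "\<delta> > 0" using \<eta> by (simp add: \<delta>_def)
    have "\<forall>\<^sub>F r in at_top_off F'. norm (s r) \<le> \<delta> * norm (nev_char r f)"
      using landau_o.smallD[OF s \<delta>] .
    hence "\<forall>\<^sub>F r in at_top_off (F \<union> F'). norm (s r) \<le> \<delta> * norm (nev_char r f)"
      by (rule eventually_at_top_off_mono) auto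
    moreover have "\<forall>\<^sub>F r in at_top_off (F \<union> F'). norm (u r) \<le> c * norm (r powr (lam + \<epsilon>))"
      using c by (rule eventually_at_top_off_mono) auto
    moreover have "\<forall>\<^sub>F r in at_top_off (F \<union> F'). nev_char r b = u r + s r"
      using eq by (rule eventually_at_top_off_mono) auto
    moreover have "\<forall>\<^sub>F r in at_top_off (F \<union> F'). c * r powr (lam + \<epsilon>) \<le> \<eta> / 2 * r ^ q"
      using eventually_powr_le_power[OF e(3), of "\<eta> / 2" c] \<eta> by (intro eventually_at_top_imp_off) auto
    moreover have "\<forall>\<^sub>F r in at_top_off (F \<union> F'). \<bar>nev_char r f\<bar> \<le> C * r ^ q \<and> r \<ge> 0"
      using T by (intro eventually_at_top_imp_off eventually_conj eventually_ge_at_top)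
    ultimately show "\<forall>\<^sub>F r in at_top_off (F \<union> F'). proximity r b \<le> \<eta> * r ^ q"
    proof eventually_elim
      case (elim r)
      have "\<delta> * \<bar>nev_char r f\<bar> \<le> \<delta> * (C * r ^ q)" using elim \<delta> by (intro mult_left_mono) auto
      also have "\<dots> \<le> \<delta> * ((\<bar>C\<bar> + 1) * r ^ q)" using elim \<delta> by (intro mult_left_mono mult_right_mono) auto
      also have "\<dots> = \<eta> / 2 * r ^ q"
      proof -
        have "\<bar>C\<bar> + 1 > 0" by simp
        hence "\<delta> * (\<bar>C\<bar> + 1) = \<eta> / 2" by (simp add: \<delta>_def field_simps)
        thus ?thesis by (metis mult.assoc)
      qed
      finally have "\<bar>s r\<bar> \<le> \<eta> / 2 * r ^ q" using elim by simp
      moreover have "\<bar>u r\<bar> \<le> \<eta> / 2 * r ^ q" using elim by simp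
      ultimately have "u r + s r \<le> \<eta> * r ^ q" by (simp add: abs_le_iff)
      thus ?case using elim by (simp add: nev_char_entire[OF b(1)])
    qed
  qed
qed

section \<open>Circle means of quadratic polynomials in an exponential\<close>

text \<open>Jensen's formula at radius 2 e r bounds N by the growth of \<open>g\<close>; the factor
  e then converts N into the number of zeros in |z| \<le> 2 r.\<close>

lemma zero_count_power_bound:
  assumes g: "entire g" "nonnull g" and C: "C \<ge> 0" "R0 \<ge> 1"
    and grow: "\<And>w. norm w \<ge> R0 \<Longrightarrow> norm (g w) \<le> exp (C * norm w ^ q)"
  shows "\<exists>D\<ge>0. \<forall>r\<ge>R0. zero_count g (2 * r) \<le> D * r ^ q"
proof (intro exI[of _ "C * (exp 1 * 2) ^ q + \<bar>ln (lead g)\<bar>"] conjI allI impI)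
  fix r assume r: "r \<ge> R0"
  define s where "s = exp 1 * (2 * r)"
  have "1 * (2 * r) \<le> exp 1 * (2 * r)" using r C(2) by (intro mult_right_mono) auto
  hence s: "s \<ge> R0" "s > 0" unfolding s_def using r C(2) by linarith+
  have "log_mean s g \<le> circle_mean s (\<lambda>_. C * s ^ q)"
  proof (rule circle_mean_mono[OF finite_zeros_in[OF g, of s] s(2)])
    fix z assume z: "norm z = s" "z \<notin> zeros_in g s"
    hence "g z \<noteq> 0" by (auto simp: zeros_in_def)
    hence "ln (norm (g z)) \<le> ln (exp (C * norm z ^ q))" using grow[of z] z s by (intro ln_mono) auto
    thus "ln (norm (g z)) \<le> C * s ^ q" using z by simp
  qed (use circle_integrable_ln_entire[OF g s(2)] in auto)
  hence "zero_int_count s g \<le> C * s ^ q - ln (lead g)" using Jensen[OF g s(2)] by simp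
  moreover have "zero_count g (2 * r) \<le> zero_int_count s g"
    unfolding s_def by (rule zero_count_le_int_count[OF g]) (use r C(2) in simp)
  moreover have "C * s ^ q = C * (exp 1 * 2) ^ q * r ^ q" by (simp add: s_def power_mult_distrib mult.assoc)
  moreover have "\<bar>ln (lead g)\<bar> * 1 \<le> \<bar>ln (lead g)\<bar> * r ^ q" using r C(2) by (intro mult_left_mono one_le_power) auto
  ultimately show "zero_count g (2 * r) \<le> (C * (exp 1 * 2) ^ q + \<bar>ln (lead g)\<bar>) * r ^ q"
    unfolding distrib_right by linarith
qed (use C in auto)

text \<open>The singular part of -ln|g|: only zeros closer to \<open>z\<close> than \<kappa> r
  contribute. The radius 2 r is that of the cofactor, whose logarithm is controlled on half its
  disc.\<close>

definition peak_sum :: "(complex \<Rightarrow> complex) \<Rightarrow> real \<Rightarrow> real \<Rightarrow> complex \<Rightarrow> real" where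
  "peak_sum g \<kappa> r z = (\<Sum>a\<in>zeros_in g (2 * r). real (zmult g a) * ln (max 1 (\<kappa> * r / norm (z - a))))"

text \<open>Factor \<open>g\<close> over the disc of radius 2 r. Each zero gives ln|z - a| \<ge>
  ln(\<kappa> r) minus its peak, and Borel-Caratheodory bounds the cofactor below on |z| = r. The
  terms n ln r cancel, leaving n ln(\<kappa> / 2), which is O(r^q).\<close>

lemma ln_entire_lower_bound:
  assumes g: "entire g" "nonnull g" and C: "C \<ge> 0" "R0 \<ge> 1"
    and grow: "\<And>w. norm w \<ge> R0 \<Longrightarrow> norm (g w) \<le> exp (C * norm w ^ q)" and \<kappa>: "0 < \<kappa>" "\<kappa> \<le> 1"
  shows "\<exists>K\<ge>0. \<forall>z. norm z \<ge> R0 \<longrightarrow> g z \<noteq> 0 \<longrightarrow> - K * norm z ^ q - peak_sum g \<kappa> (norm z) z \<le> ln (norm (g z))"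
proof -
  obtain D where D: "D \<ge> 0" "\<forall>r\<ge>R0. zero_count g (2 * r) \<le> D * r ^ q"
    using zero_count_power_bound[OF g C grow] by blast
  \<comment> \<open>In order: the loss n |ln(\<kappa> / 2)|; the leading coefficient, once from the
    centre and twice from Borel-Caratheodory; the growth on the circle of radius 4 r.\<close>
  define K where "K = D * \<bar>ln (\<kappa> / 2)\<bar> + 3 * \<bar>ln (lead g)\<bar> + 2 * (C * 4 ^ q)"
  show ?thesis
  proof (intro exI[of _ K] conjI allI impI)
    fix z :: complex assume z: "norm z \<ge> R0" and gz: "g z \<noteq> 0"
    define r where "r = norm z"
    have r: "r \<ge> 1" "r \<ge> R0" "norm z = r" "r > 0" using z C(2) by (auto simp: r_def)
    let ?n = "zero_count g (2 * r)"
    obtain E where E: "cofactor g (2 * r) E" using cofactor_exists[OF g] by blast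
    have R: "2 * r > 0" using r by simp
    obtain L where L: "L holomorphic_on ball 0 (2 * r)" "\<And>z. norm z < 2 * r \<Longrightarrow> exp (L z) = E z"
      "\<And>z. norm z < 2 * r \<Longrightarrow> ln (norm (E z)) = Re (L z)"
      using cofactor_log[OF E R] by blast
    have "norm (L z - L 0) \<le> 2 * (C * (4 * r) ^ q - ln (lead g))"
    proof (rule cofactor_log_bound[OF g _ E _ L(1) L(3)])
      show "norm (g w) \<le> exp (C * (4 * r) ^ q)" if "norm w = 2 * (2 * r)" for w
        using grow[of w] that r by simp
    qed (use r in auto)
    moreover have "Re (L 0 - L z) \<le> norm (L z - L 0)" using complex_Re_le_cmod[of "L 0 - L z"] by (simp add: norm_minus_commute)
    ultimately have 1: "Re (L z) \<ge> Re (L 0) - 2 * (C * (4 * r) ^ q - ln (lead g))" by simp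
    have 2: "ln (norm (E 0)) + ?n * ln (2 * r) = ln (lead g) + zero_int_count (2 * r) g"
      by (rule cofactor_centre[OF g R E])
    have 3: "zero_int_count (2 * r) g \<ge> 0" by (rule int_count_nonneg[OF g]) (use r in simp)
    have 4: "ln (norm (E z)) \<ge> 3 * ln (lead g) - 2 * C * (4 * r) ^ q - ?n * ln (2 * r)"
      using 1 2 3 L(3)[of z] L(3)[of 0] r by (simp add: algebra_simps)
    have 5: "ln (norm (g z)) = (\<Sum>a\<in>zeros_in g (2 * r). real (zmult g a) * ln (norm (z - a))) + ln (norm (E z))"
      by (rule ln_factorization[OF g E gz])
    have "?n * ln (\<kappa> * r) - peak_sum g \<kappa> r z = (\<Sum>a\<in>zeros_in g (2 * r). real (zmult g a) * (ln (\<kappa> * r) - ln (max 1 (\<kappa> * r / norm (z - a)))))"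
      by (simp add: peak_sum_def zero_count_def sum_distrib_right right_diff_distrib sum_subtractf)
    also have "\<dots> \<le> (\<Sum>a\<in>zeros_in g (2 * r). real (zmult g a) * ln (norm (z - a)))"
    proof (intro sum_mono mult_left_mono)
      fix a assume "a \<in> zeros_in g (2 * r)"
      hence "z \<noteq> a" using gz by (auto simp: zeros_in_def)
      hence pos: "norm (z - a) > 0" by simp
      have kr: "\<kappa> * r > 0" using \<kappa> r by simp
      have "ln (\<kappa> * r) - ln (norm (z - a)) = ln (\<kappa> * r / norm (z - a))" using pos kr by (subst ln_div) auto
      also have "\<dots> \<le> ln (max 1 (\<kappa> * r / norm (z - a)))" using pos kr by (intro ln_mono) auto
      finally show "ln (\<kappa> * r) - ln (max 1 (\<kappa> * r / norm (z - a))) \<le> ln (norm (z - a))" by simp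
    qed auto
    finally have 6: "ln (norm (g z)) \<ge> ?n * ln (\<kappa> * r) - peak_sum g \<kappa> r z + 3 * ln (lead g) - 2 * C * (4 * r) ^ q - ?n * ln (2 * r)"
      using 4 5 by linarith
    have 7: "?n * ln (\<kappa> * r) - ?n * ln (2 * r) = ?n * ln (\<kappa> / 2)"
      using \<kappa> r by (simp add: ln_mult ln_div algebra_simps)
    have "- (?n * ln (\<kappa> / 2)) \<le> ?n * \<bar>ln (\<kappa> / 2)\<bar>"
      using zero_count_nonneg[of g "2 * r"] by (metis abs_ge_minus_self abs_mult abs_of_nonneg)
    also have "\<dots> \<le> D * r ^ q * \<bar>ln (\<kappa> / 2)\<bar>" using D(2) r by (intro mult_right_mono) auto
    finally have 8: "?n * ln (\<kappa> / 2) \<ge> - (D * \<bar>ln (\<kappa> / 2)\<bar> * r ^ q)" by (simp add: mult_ac)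
    have "\<bar>ln (lead g)\<bar> * 1 \<le> \<bar>ln (lead g)\<bar> * r ^ q" using r by (intro mult_left_mono one_le_power) auto
    hence 9: "3 * ln (lead g) \<ge> - (3 * \<bar>ln (lead g)\<bar> * r ^ q)" by linarith
    have 10: "2 * C * (4 * r) ^ q = 2 * (C * 4 ^ q) * r ^ q" by (simp add: power_mult_distrib)
    show "- K * norm z ^ q - peak_sum g \<kappa> (norm z) z \<le> ln (norm (g z))"
      using 6 7 8 9 10 unfolding r(3) K_def distrib_right minus_mult_left[symmetric] by linarith
  qed (use D(1) C(1) in \<open>auto simp: K_def\<close>)
qed

lemma peak_sum_mean:
  assumes g: "entire g" "nonnull g" and r: "r > 0"
    and k: "\<And>a r. r > 0 \<Longrightarrow> circle_integrable r (\<lambda>z. ln (max 1 (\<kappa> * r / norm (z - a))))"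
    "\<And>a r. r > 0 \<Longrightarrow> circle_mean r (\<lambda>z. ln (max 1 (\<kappa> * r / norm (z - a)))) \<le> \<epsilon>"
  shows "circle_integrable r (peak_sum g \<kappa> r)" "circle_mean r (peak_sum g \<kappa> r) \<le> zero_count g (2 * r) * \<epsilon>"
proof -
  have fin: "finite (zeros_in g (2 * r))" by (rule finite_zeros_in[OF g])
  have i: "circle_integrable r (\<lambda>z. real (zmult g a) * ln (max 1 (\<kappa> * r / norm (z - a))))" for a
    by (intro circle_integrable_cmult k r)
  show "circle_integrable r (peak_sum g \<kappa> r)"
    unfolding peak_sum_def[abs_def] using fin i by (rule circle_integrable_sum)
  have "circle_mean r (peak_sum g \<kappa> r) = (\<Sum>a\<in>zeros_in g (2 * r). real (zmult g a) * circle_mean r (\<lambda>z. ln (max 1 (\<kappa> * r / norm (z - a)))))"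
    unfolding peak_sum_def[abs_def] by (subst circle_mean_sum[OF fin i]) (simp add: circle_mean_cmult)
  also have "\<dots> \<le> (\<Sum>a\<in>zeros_in g (2 * r). real (zmult g a) * \<epsilon>)"
    by (intro sum_mono mult_left_mono k r) auto
  finally show "circle_mean r (peak_sum g \<kappa> r) \<le> zero_count g (2 * r) * \<epsilon>"
    by (simp add: zero_count_def sum_distrib_right)
qed

section \<open>Means of the positive part of Re(a z^q) and of small coefficients\<close>

lemma circle_integrable_scale:
  "circle_integrable r F \<longleftrightarrow> circle_integrable 1 (\<lambda>z. F (of_real r * z))"
  by (simp add: circle_integrable_def)

lemma circle_mean_scale: "circle_mean r F = circle_mean 1 (\<lambda>z. F (of_real r * z))"
  by (simp add: circle_mean_def)

text \<open>The coefficient of \<open>r\<^sup>q\<close> in \<open>T(r, exp (a z\<^sup>q))\<close>; its value \<open>\<bar>a\<bar> / \<pi>\<close> is irrelevant here.\<close>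
definition indicator_mean :: "complex \<Rightarrow> nat \<Rightarrow> real" where
  "indicator_mean a q = circle_mean 1 (\<lambda>z. max 0 (Re (a * z ^ q)))"

lemma circle_integrable_Re_pos: "r > 0 \<Longrightarrow> circle_integrable r (\<lambda>z. max 0 (Re (a * z ^ q)))"
  by (rule continuous_circle_integrable) (auto intro!: continuous_intros)

lemma circle_mean_Re_pos:
  assumes "r > 0"
  shows "circle_mean r (\<lambda>z. max 0 (Re (a * z ^ q))) = indicator_mean a q * r ^ q"
proof -
  have "max 0 (Re (a * (of_real r * z) ^ q)) = r ^ q * max 0 (Re (a * z ^ q))" for z
  proof -
    have "a * (of_real r * z) ^ q = of_real (r ^ q) * (a * z ^ q)" by (simp add: power_mult_distrib)
    hence "Re (a * (of_real r * z) ^ q) = Re (of_real (r ^ q) * (a * z ^ q))" by (rule arg_cong)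
    also have "\<dots> = r ^ q * Re (a * z ^ q)" by simp
    finally have "Re (a * (of_real r * z) ^ q) = r ^ q * Re (a * z ^ q)" .
    thus ?thesis using assms by (simp add: max_mult_distrib_left)
  qed
  thus ?thesis unfolding indicator_mean_def
    by (subst circle_mean_scale) (simp add: circle_mean_cmult mult.commute)
qed

text \<open>In the direction \<theta> one has a z^q = |a| > 0, and a continuous nonnegative
  integrand that is not identically 0 has positive integral.\<close>

lemma indicator_mean_pos:
  assumes "a \<noteq> 0" "q \<ge> 1"
  shows "indicator_mean a q > 0"
proof -
  let ?F = "\<lambda>\<theta>. max 0 (Re (a * circ 1 \<theta> ^ q))"
  have cont: "continuous_on {0..2*pi} ?F" by (intro continuous_intros)
  define w where "w = cnj a / of_real (norm a)"
  define \<theta> where "\<theta> = Arg2pi w / real q"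
  have nw: "norm w = 1" using assms(1) by (simp add: w_def norm_divide)
  have \<theta>: "\<theta> \<in> {0..2*pi}"
  proof -
    have "0 \<le> Arg2pi w" "Arg2pi w < 2 * pi" using Arg2pi[of w] by auto
    moreover have "Arg2pi w / real q \<le> Arg2pi w / 1" using assms(2) \<open>0 \<le> Arg2pi w\<close> by (intro divide_left_mono) auto
    ultimately show ?thesis by (auto simp: \<theta>_def)
  qed
  have "circ 1 \<theta> ^ q = exp (of_nat q * (\<i> * of_real \<theta>))" by (simp add: exp_of_nat_mult)
  also have "of_nat q * (\<i> * of_real \<theta>) = \<i> * of_real (Arg2pi w)" using assms(2) by (simp add: \<theta>_def)
  also have "exp (\<i> * of_real (Arg2pi w)) = w" using Arg2pi[of w] nw by (simp add: is_Arg_def)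
  finally have "a * circ 1 \<theta> ^ q = a * cnj a / of_real (norm a)" by (simp add: w_def)
  also have "\<dots> = of_real (norm a)" using assms(1) by (simp add: complex_norm_square[symmetric] power2_eq_square)
  finally have "?F \<theta> \<noteq> 0" using assms(1) by simp
  hence "integral {0..2*pi} ?F \<noteq> 0" using \<theta> integral_eq_0_iff[OF cont] by auto
  moreover have "integral {0..2*pi} ?F \<ge> 0" by (rule integral_nonneg[OF integrable_continuous_real[OF cont]]) auto
  ultimately have "integral {0..2*pi} ?F > 0" by simp
  thus ?thesis unfolding indicator_mean_def circle_mean_def by simp
qed

lemma circle_integrable_ln_Re:
  assumes "a \<noteq> 0" "q \<ge> 1"
  shows "circle_integrable 1 (\<lambda>z. ln \<bar>Re (a * z ^ q)\<bar>)" "finite {z. norm z = 1 \<and> Re (a * z ^ q) = 0}"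
proof -
  \<comment> \<open>On the unit circle \<open>\<bar>Re (a z\<^sup>q)\<bar>\<close> is the modulus of a polynomial.\<close>
  define g where "g z = (a\<^sup>2 * z ^ (2 * q) + of_real ((norm a)\<^sup>2)) / of_real (2 * norm a)" for z
  have hol: "entire g" unfolding g_def using assms(1) by (intro holomorphic_intros) auto
  have "g 0 \<noteq> 0" using assms by (simp add: g_def power_0_left)
  hence nz: "nonnull g" by blast
  have eq: "norm (g z) = \<bar>Re (a * z ^ q)\<bar>" if "norm z = 1" for z
  proof -
    define w where "w = a * z ^ q"
    have nw: "norm w = norm a" using that by (simp add: w_def norm_mult norm_power)
    have "a\<^sup>2 * z ^ (2 * q) = w * w" by (simp add: w_def power2_eq_square mult_2 power_add)
    moreover have "of_real ((norm a)\<^sup>2) = w * cnj w" using nw complex_norm_square[of w] by simp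
    ultimately have "g z = w * (w + cnj w) / of_real (2 * norm a)" by (simp add: g_def distrib_left)
    hence "g z = w * of_real (2 * Re w) / of_real (2 * norm a)" by (simp add: complex_add_cnj)
    hence "norm (g z) = norm w * \<bar>2 * Re w\<bar> / (2 * norm a)" by (simp only: norm_mult norm_divide norm_of_real) simp
    thus ?thesis using nw assms(1) by (simp add: w_def abs_mult)
  qed
  show "circle_integrable 1 (\<lambda>z. ln \<bar>Re (a * z ^ q)\<bar>)"
    using circle_integrable_ln_entire[OF hol nz, of 1] circle_spike(1)[of "{}" 1 "\<lambda>z. ln (norm (g z))" "\<lambda>z. ln \<bar>Re (a * z ^ q)\<bar>"] eq
    by simp
  show "finite {z. norm z = 1 \<and> Re (a * z ^ q) = 0}"
    by (rule finite_subset[OF _ finite_zeros_in[OF hol nz, of 1]]) (use eq in \<open>force simp: zeros_in_def\<close>)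
qed

text \<open>Smallness bounds ln|A| above by M = (e/3) r^q, and Jensen's formula bounds its mean
  below by a constant. Since |x| \<le> 2 M - x whenever x \<le> M, the two control the mean of
  |ln|A||.\<close>

lemma small_mean_abs_ln:
  assumes A: "small q A" "nonnull A" and q: "q \<ge> 1" and e: "e > 0"
  shows "\<exists>R\<ge>1. \<forall>r\<ge>R. circle_mean r (\<lambda>z. \<bar>ln (norm (A z))\<bar>) \<le> e * r ^ q"
proof -
  note hol = small_holomorphic[OF A(1)]
  have e3: "e / 3 > 0" using e by simp
  obtain R1 where R1: "R1 \<ge> 1" "\<And>z. norm z \<ge> R1 \<Longrightarrow> norm (A z) \<le> exp (e / 3 * norm z ^ q)"
    using smallE[OF A(1) e3] by blast
  obtain R2 where R2: "\<And>r::real. r \<ge> R2 \<Longrightarrow> - ln (lead A) \<le> e / 3 * r ^ q"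
    using const_le_power[OF e3 q] by blast
  show ?thesis
  proof (intro exI[of _ "max R1 R2"] conjI allI impI)
    fix r assume r: "r \<ge> max R1 R2"
    have r0: "r > 0" "r \<ge> 1" using r R1(1) by auto
    have int: "circle_integrable r (\<lambda>z. ln (norm (A z)))" by (rule circle_integrable_ln_entire[OF hol A(2) r0(1)])
    have "circle_mean r (\<lambda>z. \<bar>ln (norm (A z))\<bar>) \<le> circle_mean r (\<lambda>z. 2 * (e / 3) * r ^ q - ln (norm (A z)))"
    proof (rule circle_mean_mono[of "{}"])
      fix z :: complex assume z: "norm z = r"
      have "ln (norm (A z)) \<le> e / 3 * r ^ q"
      proof (cases "A z = 0")
        case True thus ?thesis using e r0 by simp
      next
        case False
        hence "ln (norm (A z)) \<le> ln (exp (e / 3 * r ^ q))" using R1(2)[of z] z r by (intro ln_mono) auto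
        thus ?thesis by simp
      qed
      moreover have "e / 3 * r ^ q \<ge> 0" using e r0 by simp
      ultimately show "\<bar>ln (norm (A z))\<bar> \<le> 2 * (e / 3) * r ^ q - ln (norm (A z))" by (simp add: abs_if)
    qed (use r0 int circle_integrable_abs circle_integrable_diff in auto)
    also have "\<dots> = 2 * (e / 3) * r ^ q - (ln (lead A) + zero_int_count r A)"
      using circle_mean_diff[OF _ int, of "\<lambda>_. 2 * (e / 3) * r ^ q"] Jensen[OF hol A(2) r0(1)] by simp
    also have "\<dots> \<le> e * r ^ q" using int_count_nonneg[OF hol A(2) r0(2)] R2[of r] r by simp
    finally show "circle_mean r (\<lambda>z. \<bar>ln (norm (A z))\<bar>) \<le> e * r ^ q" .
  qed (use R1 in auto)
qed

text \<open>The condition Re w > 4 t brings both lower terms below exp(2 Re w - 3 t), against a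
  leading term of at least exp(2 Re w - t). The assumption t \<ge> ln 2 leaves room for two such
  errors.\<close>

lemma dominant_top:
  assumes t: "t \<ge> ln 2" and x: "exp (- t) \<le> norm x2" "norm x1 \<le> exp t" "norm x0 \<le> exp t" and p: "Re w > 4 * t"
  shows "2 * Re w - 2 * t \<le> ln (norm (x0 + x1 * exp w + x2 * exp (2 * w)))"
proof -
  let ?p = "Re w"
  have t0: "t > 0" using t ln_gt_zero[of 2] by linarith
  have "exp (- t) \<le> exp (- ln 2)" using t by simp
  hence h: "exp (- t) \<le> 1 / 2" by (simp add: exp_minus)
  have "norm (x2 * exp (2 * w)) \<le> norm (x0 + x1 * exp w + x2 * exp (2 * w)) + norm (x0 + x1 * exp w)"
    by (metis add_diff_cancel_left' norm_triangle_ineq4)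
  moreover have "norm (x0 + x1 * exp w) \<le> exp t + exp t * exp ?p"
    using x by (intro order_trans[OF norm_triangle_ineq] add_mono) (auto simp: norm_mult norm_exp_eq_Re mult_right_mono)
  moreover have "exp (- t) * exp (2 * ?p) \<le> norm (x2 * exp (2 * w))"
    using x by (simp add: norm_mult norm_exp_eq_Re mult_right_mono)
  ultimately have 1: "norm (x0 + x1 * exp w + x2 * exp (2 * w)) \<ge> exp (2 * ?p - t) - exp t - exp (?p + t)"
  proof -
    have "exp (- t) * exp (2 * ?p) = exp (2 * ?p - t)" "exp t * exp ?p = exp (?p + t)"
      by (simp_all add: exp_add[symmetric] add.commute)
    with \<open>norm (x2 * exp (2 * w)) \<le> _\<close> \<open>norm (x0 + x1 * exp w) \<le> _\<close> \<open>exp (- t) * exp (2 * ?p) \<le> _\<close>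
    show ?thesis by linarith
  qed
  have "exp t \<le> exp (2 * ?p - 3 * t)" "exp (?p + t) \<le> exp (2 * ?p - 3 * t)" using p t0 by auto
  moreover have "exp (2 * ?p - 3 * t) = exp (2 * ?p - t) * (exp (- t))\<^sup>2"
    by (simp add: power2_eq_square exp_add[symmetric])
  moreover have "exp (2 * ?p - 2 * t) = exp (2 * ?p - t) * exp (- t)" by (simp add: exp_add[symmetric])
  moreover have "exp (2 * ?p - t) * exp (- t) \<le> exp (2 * ?p - t) - 2 * (exp (2 * ?p - t) * (exp (- t))\<^sup>2)"
  proof -
    \<comment> \<open>With y = exp(-t) \<le> 1/2 this is 1 - y - 2 y^2 \<ge> 0 in factored
      form.\<close>
    have "(1 - 2 * exp (- t)) * (1 + exp (- t)) \<ge> 0" using h by (intro mult_nonneg_nonneg) auto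
    hence "exp (- t) \<le> 1 - 2 * (exp (- t))\<^sup>2" by (simp add: power2_eq_square algebra_simps)
    hence "exp (2 * ?p - t) * exp (- t) \<le> exp (2 * ?p - t) * (1 - 2 * (exp (- t))\<^sup>2)"
      by (rule mult_left_mono) simp
    thus ?thesis by (simp only: right_diff_distrib mult_1_right mult.left_commute)
  qed
  ultimately have "exp (2 * ?p - 2 * t) \<le> norm (x0 + x1 * exp w + x2 * exp (2 * w))"
    using 1 by linarith
  hence "ln (exp (2 * ?p - 2 * t)) \<le> ln (norm (x0 + x1 * exp w + x2 * exp (2 * w)))" by (intro ln_mono) auto
  thus ?thesis by simp
qed

text \<open>Replacing \<open>w\<close> by -w and factoring out exp(2 w) exchanges the outer
  coefficients, which reduces this to \<open>dominant_top\<close>.\<close>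

lemma dominant_bottom:
  assumes t: "t \<ge> ln 2" and x: "exp (- t) \<le> norm x0" "norm x1 \<le> exp t" "norm x2 \<le> exp t" and p: "Re w < - 4 * t"
  shows "- 2 * t \<le> ln (norm (x0 + x1 * exp w + x2 * exp (2 * w)))"
proof -
  have "2 * Re (- w) - 2 * t \<le> ln (norm (x2 + x1 * exp (- w) + x0 * exp (2 * (- w))))"
    using assms by (intro dominant_top) auto
  moreover have "x0 + x1 * exp w + x2 * exp (2 * w) = (x2 + x1 * exp (- w) + x0 * exp (2 * (- w))) * exp (2 * w)"
    by (simp add: algebra_simps exp_add[symmetric] mult.assoc flip: exp_double)
  ultimately show ?thesis
  proof (cases "x2 + x1 * exp (- w) + x0 * exp (2 * (- w)) = 0")
    \<comment> \<open>The reflected sum cannot vanish: \<open>ln 0 = 0\<close> would contradict its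
      positive lower bound.\<close>
    case True
    have "t > 0" using t ln_gt_zero[of 2] by linarith
    hence "2 * Re (- w) - 2 * t > 0" using p by simp
    thus ?thesis using True \<open>2 * Re (- w) - 2 * t \<le> _\<close> by simp
  next
    case False
    assume a: "2 * Re (- w) - 2 * t \<le> ln (norm (x2 + x1 * exp (- w) + x0 * exp (2 * (- w))))"
      and eq: "x0 + x1 * exp w + x2 * exp (2 * w) = (x2 + x1 * exp (- w) + x0 * exp (2 * (- w))) * exp (2 * w)"
    have "ln (norm (x0 + x1 * exp w + x2 * exp (2 * w))) = ln (norm (x2 + x1 * exp (- w) + x0 * exp (2 * (- w)))) + 2 * Re w"
      unfolding eq norm_mult norm_exp_eq_Re using False by (subst ln_mult) auto
    thus ?thesis using a by simp
  qed
qed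

section \<open>Quadratics in an exponential: growth, non-vanishing, upper mean\<close>

lemma eventually_const_le_power: "q \<ge> 1 \<Longrightarrow> e > 0 \<Longrightarrow> \<forall>\<^sub>F r::real in at_top. c \<le> e * r ^ q"
  using const_le_power[of e q c] by (auto simp: eventually_at_top_linorder)

context
  fixes a :: complex and q :: nat and A0 A1 A2 G :: "complex \<Rightarrow> complex"
  assumes a: "a \<noteq> 0" and q: "q \<ge> 1"
    and small: "small q A0" "small q A1" "small q A2"
    and nz: "nonnull A0" "nonnull A2"
    and G: "\<And>z. G z = A0 z + A1 z * exp (a * z ^ q) + A2 z * exp (2 * (a * z ^ q))"
begin

lemma exp_quadratic_holomorphic: "entire G"
proof -
  have "(\<lambda>z. A0 z + A1 z * exp (a * z ^ q) + A2 z * exp (2 * (a * z ^ q))) holomorphic_on UNIV"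
    by (intro holomorphic_intros small_holomorphic[OF small(1)] small_holomorphic[OF small(2)] small_holomorphic[OF small(3)])
  moreover have "G = (\<lambda>z. A0 z + A1 z * exp (a * z ^ q) + A2 z * exp (2 * (a * z ^ q)))"
    using G by (rule ext)
  ultimately show ?thesis by (simp only:)
qed

lemma small_simultaneous:
  assumes "e > 0"
  shows "\<exists>R\<ge>1. \<forall>z. norm z \<ge> R \<longrightarrow> norm (A0 z) \<le> exp (e * norm z ^ q) \<and>
    norm (A1 z) \<le> exp (e * norm z ^ q) \<and> norm (A2 z) \<le> exp (e * norm z ^ q)"
proof -
  obtain R0 where R0: "R0 \<ge> 1" "\<And>z. norm z \<ge> R0 \<Longrightarrow> norm (A0 z) \<le> exp (e * norm z ^ q)" using smallE[OF small(1) assms] by blast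
  obtain R1 where R1: "R1 \<ge> 1" "\<And>z. norm z \<ge> R1 \<Longrightarrow> norm (A1 z) \<le> exp (e * norm z ^ q)" using smallE[OF small(2) assms] by blast
  obtain R2 where R2: "R2 \<ge> 1" "\<And>z. norm z \<ge> R2 \<Longrightarrow> norm (A2 z) \<le> exp (e * norm z ^ q)" using smallE[OF small(3) assms] by blast
  show ?thesis by (intro exI[of _ "max R0 (max R1 R2)"] conjI allI impI) (use R0 R1 R2 in auto)
qed

lemma exp_quadratic_bound:
  assumes "e > 0"
  shows "\<exists>R\<ge>1. \<forall>z. norm z \<ge> R \<longrightarrow> norm (G z) \<le> exp (e * norm z ^ q + 2 * max 0 (Re (a * z ^ q)))"
proof -
  have e2: "e / 2 > 0" using assms by simp
  obtain R where R: "R \<ge> 1" "\<And>z. norm z \<ge> R \<Longrightarrow> norm (A0 z) \<le> exp (e / 2 * norm z ^ q) \<and>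
    norm (A1 z) \<le> exp (e / 2 * norm z ^ q) \<and> norm (A2 z) \<le> exp (e / 2 * norm z ^ q)" using small_simultaneous[OF e2] by blast
  obtain R3 where R3: "\<And>r::real. r \<ge> R3 \<Longrightarrow> ln 3 \<le> e / 2 * r ^ q" using const_le_power[OF e2 q] by blast
  show ?thesis
  proof (intro exI[of _ "max R R3"] conjI allI impI)
    fix z :: complex assume z: "norm z \<ge> max R R3"
    let ?t = "e / 2 * norm z ^ q" and ?p = "Re (a * z ^ q)"
    have m: "norm (x * y) \<le> exp ?t * exp (2 * max 0 ?p)" if "norm x \<le> exp ?t" "norm y \<le> exp (2 * max 0 ?p)" for x y :: complex
      unfolding norm_mult using that by (intro mult_mono) auto
    have "norm (A0 z * 1) \<le> exp ?t * exp (2 * max 0 ?p)" using R(2)[of z] z by (intro m) auto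
    moreover have "norm (A1 z * exp (a * z ^ q)) \<le> exp ?t * exp (2 * max 0 ?p) \<and>
      norm (A2 z * exp (2 * (a * z ^ q))) \<le> exp ?t * exp (2 * max 0 ?p)"
    proof -
      have mx: "x \<le> 2 * max 0 x" "2 * x \<le> 2 * max 0 x" for x :: real by auto
      have "norm (exp (a * z ^ q)) \<le> exp (2 * max 0 ?p)" "norm (exp (2 * (a * z ^ q))) \<le> exp (2 * max 0 ?p)"
        using mx[of ?p] by (simp_all only: norm_exp_eq_Re exp_le_cancel_iff) simp
      thus ?thesis using R(2)[of z] z m by simp
    qed
    moreover have "norm (G z) \<le> norm (A0 z) + norm (A1 z * exp (a * z ^ q)) + norm (A2 z * exp (2 * (a * z ^ q)))"
      unfolding G by (intro order_trans[OF norm_triangle_ineq] add_mono norm_triangle_ineq order_refl)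
    ultimately have "norm (G z) \<le> 3 * (exp ?t * exp (2 * max 0 ?p))" by simp
    also have "\<dots> = exp (ln 3 + (?t + 2 * max 0 ?p))" by (simp add: exp_add)
    also have "\<dots> \<le> exp (e * norm z ^ q + 2 * max 0 ?p)" using R3[of "norm z"] z by simp
    finally show "norm (G z) \<le> exp (e * norm z ^ q + 2 * max 0 (Re (a * z ^ q)))" .
  qed (use R in auto)
qed

lemma exp_quadratic_growth: "\<exists>R\<ge>1. \<forall>z. norm z \<ge> R \<longrightarrow> norm (G z) \<le> exp ((1 + 2 * norm a) * norm z ^ q)"
proof -
  obtain R where R: "R \<ge> 1" "\<And>z. norm z \<ge> R \<Longrightarrow> norm (G z) \<le> exp (1 * norm z ^ q + 2 * max 0 (Re (a * z ^ q)))"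
    using exp_quadratic_bound[of 1] by auto
  have "max 0 (Re (a * z ^ q)) \<le> norm a * norm z ^ q" for z
    using complex_Re_le_cmod[of "a * z ^ q"] by (simp add: norm_mult norm_power)
  hence "exp (1 * norm z ^ q + 2 * max 0 (Re (a * z ^ q))) \<le> exp ((1 + 2 * norm a) * norm z ^ q)" for z
    by (simp add: distrib_right mult.assoc del: max.bounded_iff)
  thus ?thesis using R by (meson order_trans)
qed

text \<open>If \<open>G\<close> vanished identically, |A2| would be at most exp(-Re(a z^q)), up to
  small factors, wherever that real part is positive. Its logarithmic mean would tend to minus
  infinity, against Jensen's formula.\<close>

lemma exp_quadratic_nonzero: "nonnull G"
proof (rule ccontr)
  assume "\<not> ?thesis"
  hence G0: "A0 z + A1 z * exp (a * z ^ q) + A2 z * exp (2 * (a * z ^ q)) = 0" for z using G by simp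
  define \<kappa>0 where "\<kappa>0 = indicator_mean a q"
  have k0: "\<kappa>0 / 4 > 0" using indicator_mean_pos[OF a q] by (simp add: \<kappa>0_def)
  obtain R where R: "R \<ge> 1" "\<And>z. norm z \<ge> R \<Longrightarrow> norm (A0 z) \<le> exp (\<kappa>0 / 4 * norm z ^ q) \<and>
    norm (A1 z) \<le> exp (\<kappa>0 / 4 * norm z ^ q) \<and> norm (A2 z) \<le> exp (\<kappa>0 / 4 * norm z ^ q)" using small_simultaneous[OF k0] by blast
  note hol = small_holomorphic[OF small(3)]
  have "\<forall>\<^sub>F r in at_top. ln 2 + 1 - ln (lead A2) \<le> \<kappa>0 / 4 * r ^ q" by (rule eventually_const_le_power[OF q k0])
  then obtain R2 where R2: "\<And>r. r \<ge> R2 \<Longrightarrow> ln 2 + 1 - ln (lead A2) \<le> \<kappa>0 / 4 * r ^ q" by (auto simp: eventually_at_top_linorder)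
  define r where "r = max R R2"
  have r: "r \<ge> R" "r \<ge> R2" "r > 0" "r \<ge> 1" using R(1) by (auto simp: r_def)
  have "log_mean r A2 \<le> circle_mean r (\<lambda>z. (ln 2 + \<kappa>0 / 4 * r ^ q) - max 0 (Re (a * z ^ q)))"
  proof (rule circle_mean_mono[OF finite_zeros_in[OF hol nz(2), of r] r(3)])
    fix z assume z: "norm z = r" "z \<notin> zeros_in A2 r"
    hence A2: "A2 z \<noteq> 0" by (auto simp: zeros_in_def)
    let ?t = "\<kappa>0 / 4 * r ^ q" and ?p = "Re (a * z ^ q)"
    have bd: "norm (A0 z) \<le> exp ?t" "norm (A1 z) \<le> exp ?t" "norm (A2 z) \<le> exp ?t" using R(2)[of z] z r(1) by auto
    have "norm (A2 z) \<le> 2 * exp ?t * exp (- max 0 ?p)"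
    proof (cases "?p > 0")
      case False
      have "max 0 ?p = 0" using False by simp
      hence "2 * exp ?t * exp (- max 0 ?p) = 2 * exp ?t" by (simp only:) simp
      thus ?thesis using bd(3) exp_ge_zero[of ?t] by linarith
    next
      case True
      have "A2 z * exp (2 * (a * z ^ q)) = - (A0 z + A1 z * exp (a * z ^ q))" using G0[of z] by (simp only: add_eq_0_iff)
      hence "norm (A2 z * exp (2 * (a * z ^ q))) = norm (A0 z + A1 z * exp (a * z ^ q))" by (metis norm_minus_cancel)
      moreover have "norm (A2 z * exp (2 * (a * z ^ q))) = norm (A2 z) * exp (2 * ?p)"
        by (simp only: norm_mult norm_exp_eq_Re) simp
      ultimately have "norm (A2 z) * exp (2 * ?p) = norm (A0 z + A1 z * exp (a * z ^ q))" by simp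
      also have "\<dots> \<le> norm (A0 z) + norm (A1 z) * exp ?p" by (metis norm_triangle_ineq norm_mult norm_exp_eq_Re)
      also have "\<dots> \<le> exp ?t * exp ?p + exp ?t * exp ?p"
      proof (rule add_mono)
        have "exp ?t * 1 \<le> exp ?t * exp ?p" using True by (intro mult_left_mono) auto
        thus "norm (A0 z) \<le> exp ?t * exp ?p" using bd(1) by linarith
        show "norm (A1 z) * exp ?p \<le> exp ?t * exp ?p" by (rule mult_right_mono[OF bd(2)]) simp
      qed
      finally have "norm (A2 z) * exp (2 * ?p) \<le> 2 * exp ?t * exp ?p" by simp
      hence "norm (A2 z) * exp (2 * ?p) * exp (- (2 * ?p)) \<le> 2 * exp ?t * exp ?p * exp (- (2 * ?p))" by (intro mult_right_mono) auto
      moreover have "exp (2 * x) * exp (- (2 * x)) = 1" "exp x * exp (- (2 * x)) = exp (- x)" for x :: real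
        by (simp_all add: exp_add[symmetric])
      ultimately have "norm (A2 z) \<le> 2 * exp ?t * exp (- ?p)" by (simp only: mult.assoc mult_1_right)
      moreover have "max 0 ?p = ?p" using True by simp
      ultimately show ?thesis by (simp only:)
    qed
    hence "ln (norm (A2 z)) \<le> ln (2 * exp ?t * exp (- max 0 ?p))" using A2 by (intro ln_mono) auto
    also have "\<dots> = ln 2 + ?t - max 0 ?p" by (simp add: ln_mult)
    finally show "ln (norm (A2 z)) \<le> (ln 2 + ?t) - max 0 ?p" .
  qed (use circle_integrable_ln_entire[OF hol nz(2) r(3)] circle_integrable_diff circle_integrable_Re_pos[OF r(3)] in auto)
  also have "\<dots> = ln 2 + \<kappa>0 / 4 * r ^ q - \<kappa>0 * r ^ q"
    using circle_mean_diff[OF _ circle_integrable_Re_pos[OF r(3)], of "\<lambda>_. ln 2 + \<kappa>0 / 4 * r ^ q"] circle_mean_Re_pos[OF r(3)]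
    by (simp add: \<kappa>0_def)
  finally have "ln (lead A2) + zero_int_count r A2 \<le> ln 2 - 3 * (\<kappa>0 / 4 * r ^ q)"
    using Jensen[OF hol nz(2) r(3)] by simp
  moreover have "zero_int_count r A2 \<ge> 0" by (rule int_count_nonneg[OF hol nz(2) r(4)])
  moreover have "\<kappa>0 / 4 * r ^ q \<ge> 0" using k0 r by simp
  ultimately show False using R2[OF r(2)] by linarith
qed

lemma exp_quadratic_mean_upper:
  assumes "\<eta> > 0"
  shows "\<forall>\<^sub>F r in at_top. log_mean r G \<le> (2 * indicator_mean a q + \<eta>) * r ^ q"
proof -
  obtain R where R: "R \<ge> 1" "\<And>z. norm z \<ge> R \<Longrightarrow> norm (G z) \<le> exp (\<eta> * norm z ^ q + 2 * max 0 (Re (a * z ^ q)))"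
    using exp_quadratic_bound[OF assms] by auto
  show ?thesis
    using eventually_ge_at_top[of R]
  proof eventually_elim
    case (elim r)
    have r: "r > 0" using elim R(1) by simp
    have "log_mean r G \<le> circle_mean r (\<lambda>z. \<eta> * r ^ q + 2 * max 0 (Re (a * z ^ q)))"
    proof (rule circle_mean_mono[OF finite_zeros_in[OF exp_quadratic_holomorphic exp_quadratic_nonzero, of r] r])
      fix z assume z: "norm z = r" "z \<notin> zeros_in G r"
      hence "G z \<noteq> 0" by (auto simp: zeros_in_def)
      hence "ln (norm (G z)) \<le> ln (exp (\<eta> * r ^ q + 2 * max 0 (Re (a * z ^ q))))" using R(2)[of z] z elim by (intro ln_mono) auto
      thus "ln (norm (G z)) \<le> \<eta> * r ^ q + 2 * max 0 (Re (a * z ^ q))" by simp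
    qed (intro circle_integrable_ln_entire[OF exp_quadratic_holomorphic exp_quadratic_nonzero r] circle_integrable_add circle_integrable_const
           circle_integrable_cmult circle_integrable_Re_pos[OF r])+
    also have "\<dots> = \<eta> * r ^ q + 2 * (indicator_mean a q * r ^ q)"
      using circle_mean_add[OF circle_integrable_const circle_integrable_cmult[OF circle_integrable_Re_pos[OF r]]]
        circle_mean_Re_pos[OF r] by (simp add: circle_mean_cmult)
    finally show ?case by (simp add: algebra_simps)
  qed
qed

end

text \<open>A Chebyshev argument in pointwise form. Where \<open>A0\<close> and \<open>A2\<close>
  are not too small and Re(a z^q) is not near 0, one outer term dominates. Elsewhere the crude bound
  of \<open>ln_entire_lower_bound\<close> is used and its loss is charged to penalties with small
  mean.\<close>

lemma exp_quadratic_mean_lower: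
  fixes a :: complex and q :: nat and A0 A1 A2 G :: "complex \<Rightarrow> complex"
  assumes a: "a \<noteq> 0" and q: "q \<ge> 1"
    and small: "small q A0" "small q A1" "small q A2"
    and nz: "nonnull A0" "nonnull A2"
    and G: "\<And>z. G z = A0 z + A1 z * exp (a * z ^ q) + A2 z * exp (2 * (a * z ^ q))"
    and \<eta>: "\<eta> > 0"
  shows "\<forall>\<^sub>F r in at_top. (2 * indicator_mean a q - \<eta>) * r ^ q \<le> log_mean r G"
proof -
  note holG = exp_quadratic_holomorphic[OF a q small nz G] and nzG = exp_quadratic_nonzero[OF a q small nz G]
  note hol0 = small_holomorphic[OF small(1)] and hol2 = small_holomorphic[OF small(3)]
  define C where "C = 1 + 2 * norm a"
  have C: "C \<ge> 0" by (simp add: C_def)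
  obtain R0 where R0: "R0 \<ge> 1" "\<And>w. norm w \<ge> R0 \<Longrightarrow> norm (G w) \<le> exp (C * norm w ^ q)"
    using exp_quadratic_growth[OF a q small nz G] unfolding C_def by blast
  obtain D where D: "D \<ge> 0" "\<And>r. r \<ge> R0 \<Longrightarrow> zero_count G (2 * r) \<le> D * r ^ q"
    using zero_count_power_bound[OF holG nzG C R0(1) R0(2)] by blast
  \<comment> \<open>With at most D r^q zeros near the circle, this level per peak keeps the mean of
    all peaks below (\<eta>/4) r^q.\<close>
  have pos: "\<eta> / (4 * (D + 1)) > 0" using \<eta> D(1) by simp
  obtain \<kappa> where \<kappa>: "0 < \<kappa>" "\<kappa> \<le> 1"
    and kint: "\<And>a r. r > 0 \<Longrightarrow> circle_integrable r (\<lambda>z. ln (max 1 (\<kappa> * r / norm (z - a))))"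
    and kmean: "\<And>a r. r > 0 \<Longrightarrow> circle_mean r (\<lambda>z. ln (max 1 (\<kappa> * r / norm (z - a)))) \<le> \<eta> / (4 * (D + 1))"
    using circle_log_peak_uniform[OF pos] by blast
  obtain K where K: "K \<ge> 0"
    "\<And>z. norm z \<ge> R0 \<Longrightarrow> G z \<noteq> 0 \<Longrightarrow> - K * norm z ^ q - peak_sum G \<kappa> (norm z) z \<le> ln (norm (G z))"
    using ln_entire_lower_bound[OF holG nzG C R0(1) R0(2) \<kappa>] by blast
  \<comment> \<open>B r^q bounds the loss, peaks aside, in passing from 2 max 0 Re(a z^q) to the
    crude bound -K r^q.\<close>
  define B where "B = 2 * norm a + K"
  have B: "B \<ge> 0" using K(1) by (simp add: B_def)
  define J where "J = circle_mean 1 (\<lambda>z. \<bar>ln \<bar>Re (a * z ^ q)\<bar>\<bar>)"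
  \<comment> \<open>Makes the penalty for directions with Re(a z^q) near 0 cost at most (\<eta>/4)
    r^q in mean, \<open>J\<close> being the mean of the logarithm involved.\<close>
  define Mb where "Mb = 4 * B * \<bar>J\<bar> / \<eta> + 1"
  have Mb: "Mb \<ge> 1" using B \<eta> by (simp add: Mb_def)
  \<comment> \<open>Keeps the error 2 \<mu> r^q below (\<eta>/4) r^q, and makes |u| \<le> 4 \<mu>
    imply |ln|u|| \<ge> \<open>Mb\<close>. The 4 is the one in \<open>dominant_top\<close>.\<close>
  define \<mu> where "\<mu> = min (\<eta> / 8) (exp (- Mb) / 4)"
  have \<mu>: "\<mu> > 0" "8 * \<mu> \<le> \<eta>" "4 * \<mu> \<le> exp (- Mb)" using \<eta> by (auto simp: \<mu>_def)
  \<comment> \<open>Chosen so that \<open>B / \<mu>\<close> times this mean is at most \<eta>/8,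
    once for each outer coefficient.\<close>
  define e2 where "e2 = \<eta> * \<mu> / (8 * (B + 1))"
  have e2: "e2 > 0" using \<eta> \<mu> B by (simp add: e2_def)
  obtain R1 where R1: "\<And>r. r \<ge> R1 \<Longrightarrow> circle_mean r (\<lambda>z. \<bar>ln (norm (A0 z))\<bar>) \<le> e2 * r ^ q"
    using small_mean_abs_ln[OF small(1) nz(1) q e2] by blast
  obtain R2 where R2: "\<And>r. r \<ge> R2 \<Longrightarrow> circle_mean r (\<lambda>z. \<bar>ln (norm (A2 z))\<bar>) \<le> e2 * r ^ q"
    using small_mean_abs_ln[OF small(3) nz(2) q e2] by blast
  obtain R3 where R3: "\<And>z. norm z \<ge> R3 \<Longrightarrow> norm (A0 z) \<le> exp (\<mu> * norm z ^ q) \<and>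
    norm (A1 z) \<le> exp (\<mu> * norm z ^ q) \<and> norm (A2 z) \<le> exp (\<mu> * norm z ^ q)"
    using small_simultaneous[OF a q small nz G \<mu>(1)] by blast
  obtain R4 where R4: "\<And>r::real. r \<ge> R4 \<Longrightarrow> ln 2 \<le> \<mu> * r ^ q"
    using const_le_power[OF \<mu>(1) q] by blast
  define RR where "RR = max R0 (max R1 (max R2 (max R3 R4)))"
  have "(2 * indicator_mean a q - \<eta>) * r ^ q \<le> log_mean r G" if rR: "r \<ge> RR" for r
  proof -
    have r: "r \<ge> R0" "r \<ge> R1" "r \<ge> R2" "r \<ge> R3" "r \<ge> R4" "r \<ge> 1" "r > 0" using rR R0(1) by (auto simp: RR_def)
    define s where "s = r ^ q"
    have s: "s > 0" using r by (simp add: s_def)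
    define u where "u z = Re (a * (z / of_real r) ^ q)" for z
    have su: "Re (a * z ^ q) = s * u z" for z
    proof -
      have "a * z ^ q = of_real s * (a * (z / of_real r) ^ q)" using r by (simp add: s_def power_divide)
      hence "Re (a * z ^ q) = Re (of_real s * (a * (z / of_real r) ^ q))" by (rule arg_cong)
      thus ?thesis by (simp add: u_def)
    qed
    define W where "W = peak_sum G \<kappa> r"
    have W0: "W z \<ge> 0" for z unfolding W_def peak_sum_def by (intro sum_nonneg mult_nonneg_nonneg ln_ge_zero) auto
    \<comment> \<open>Each penalty is at least \<open>B * s\<close> wherever its own condition
      fails: |ln|A0|| or |ln|A2|| above \<mu> s, or |u| at most 4 \<mu>.\<close>
    define low where "low z = 2 * max 0 (Re (a * z ^ q)) - 2 * \<mu> * s - B / \<mu> * \<bar>ln (norm (A0 z))\<bar>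
        - B / \<mu> * \<bar>ln (norm (A2 z))\<bar> - B * s / Mb * \<bar>ln \<bar>u z\<bar>\<bar> - W z" for z
    \<comment> \<open>The points of the circle where one of the logarithms would take the default
      value \<open>ln 0 = 0\<close>.\<close>
    define S where "S = zeros_in G r \<union> zeros_in A0 r \<union> zeros_in A2 r \<union>
        (\<lambda>z. of_real r * z) ` {z. norm z = 1 \<and> Re (a * z ^ q) = 0}"
    have finS: "finite S" unfolding S_def
      by (intro finite_UnI finite_imageI finite_zeros_in holG nzG hol0 hol2 nz circle_integrable_ln_Re(2)[OF a q])
    have pw: "low z \<le> ln (norm (G z))" if z: "norm z = r" "z \<notin> S" for z
    proof -
      have nzs: "G z \<noteq> 0" "A0 z \<noteq> 0" "A2 z \<noteq> 0" using z by (auto simp: S_def zeros_in_def)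
      have u0: "u z \<noteq> 0"
      proof
        assume "u z = 0"
        hence "z / of_real r \<in> {z. norm z = 1 \<and> Re (a * z ^ q) = 0}" using z r by (simp add: u_def norm_divide)
        hence "of_real r * (z / of_real r) \<in> S" unfolding S_def by blast
        thus False using z r by simp
      qed
      have b1: "B / \<mu> * \<bar>ln (norm (A0 z))\<bar> \<ge> 0" "B / \<mu> * \<bar>ln (norm (A2 z))\<bar> \<ge> 0" "B * s / Mb * \<bar>ln \<bar>u z\<bar>\<bar> \<ge> 0"
        using B \<mu>(1) s Mb by auto
      have Pa: "max 0 (Re (a * z ^ q)) \<le> norm a * s"
        using complex_Re_le_cmod[of "a * z ^ q"] z s by (auto simp: norm_mult norm_power s_def)
      show ?thesis
      proof (cases "\<bar>ln (norm (A0 z))\<bar> \<le> \<mu> * s \<and> \<bar>ln (norm (A2 z))\<bar> \<le> \<mu> * s \<and> \<bar>u z\<bar> > 4 * \<mu>")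
        case False
        have ge: "B * s \<le> B / \<mu> * \<bar>ln (norm (A0 z))\<bar> + B / \<mu> * \<bar>ln (norm (A2 z))\<bar> + B * s / Mb * \<bar>ln \<bar>u z\<bar>\<bar>"
        proof -
          have t1: "B * s \<le> B / \<mu> * x" if "\<mu> * s < x" for x
          proof -
            have "B / \<mu> * (\<mu> * s) \<le> B / \<mu> * x" using that B \<mu>(1) by (intro mult_left_mono) auto
            thus ?thesis using \<mu>(1) by simp
          qed
          have t2: "B * s \<le> B * s / Mb * \<bar>ln \<bar>u z\<bar>\<bar>" if "\<bar>u z\<bar> \<le> 4 * \<mu>"
          proof -
            have "ln \<bar>u z\<bar> \<le> ln (exp (- Mb))" using that \<mu>(3) u0 by (intro ln_mono) auto
            hence "Mb \<le> \<bar>ln \<bar>u z\<bar>\<bar>" by simp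
            hence "B * s / Mb * Mb \<le> B * s / Mb * \<bar>ln \<bar>u z\<bar>\<bar>" using B s Mb by (intro mult_left_mono) auto
            thus ?thesis using Mb by simp
          qed
          from False consider "\<mu> * s < \<bar>ln (norm (A0 z))\<bar>" | "\<mu> * s < \<bar>ln (norm (A2 z))\<bar>" | "\<bar>u z\<bar> \<le> 4 * \<mu>" by linarith
          thus ?thesis
          proof cases
            case 1 thus ?thesis using t1[OF 1] b1 by linarith
          next
            case 2 thus ?thesis using t1[OF 2] b1 by linarith
          next
            case 3 thus ?thesis using t2[OF 3] b1 by linarith
          qed
        qed
        have "- K * s - W z \<le> ln (norm (G z))" using K(2)[of z] nzs(1) z r by (simp add: s_def W_def)
        moreover have "\<mu> * s \<ge> 0" using \<mu>(1) s by simp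
        moreover have "B * s = 2 * (norm a * s) + K * s" by (simp add: B_def distrib_right)
        ultimately show ?thesis unfolding low_def using ge Pa by linarith
      next
        case True
        define t where "t = \<mu> * s"
        have t: "t \<ge> ln 2" using R4[OF r(5)] by (simp add: t_def s_def)
        have up: "norm (A0 z) \<le> exp t" "norm (A1 z) \<le> exp t" "norm (A2 z) \<le> exp t"
          using R3[of z] z r(4) by (auto simp: t_def s_def)
        have dn: "exp (- t) \<le> norm (A0 z)" "exp (- t) \<le> norm (A2 z)"
        proof -
          have "exp (- t) \<le> exp (ln (norm (A0 z)))" "exp (- t) \<le> exp (ln (norm (A2 z)))"
            using True by (auto simp: t_def abs_le_iff)
          thus "exp (- t) \<le> norm (A0 z)" "exp (- t) \<le> norm (A2 z)" using nzs by simp_all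
        qed
        have main: "2 * max 0 (Re (a * z ^ q)) - 2 * t \<le> ln (norm (G z))"
        proof (cases "u z > 0")
          case up0: True
          have "4 * \<mu> * s < u z * s" using True up0 s by (intro mult_strict_right_mono) auto
          hence p: "Re (a * z ^ q) > 4 * t" unfolding su by (simp add: t_def mult_ac)
          have t0: "t > 0" using t ln_gt_zero[of 2] by linarith
          have "2 * Re (a * z ^ q) - 2 * t \<le> ln (norm (G z))"
            unfolding G by (rule dominant_top[OF t dn(2) up(2,1) p])
          moreover have "max 0 (Re (a * z ^ q)) = Re (a * z ^ q)" using p t0 by linarith
          ultimately show ?thesis by (simp only:)
        next
          case False
          have "4 * \<mu> * s < (- u z) * s" using True False s by (intro mult_strict_right_mono) auto
          hence p: "Re (a * z ^ q) < - 4 * t" unfolding su by (simp add: t_def mult_ac)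
          have t0: "t > 0" using t ln_gt_zero[of 2] by linarith
          have "- 2 * t \<le> ln (norm (G z))"
            unfolding G by (rule dominant_bottom[OF t dn(1) up(2,3) p])
          moreover have "max 0 (Re (a * z ^ q)) = 0" using p t0 by linarith
          ultimately show ?thesis by linarith
        qed
        thus ?thesis unfolding low_def using b1 W0[of z] by (simp add: t_def)
      qed
    qed
    have i1: "circle_integrable r (\<lambda>z. 2 * max 0 (Re (a * z ^ q)))" by (intro circle_integrable_cmult circle_integrable_Re_pos r)
    have i0: "circle_integrable r (\<lambda>z. B / \<mu> * \<bar>ln (norm (A0 z))\<bar>)"
      by (intro circle_integrable_cmult circle_integrable_abs circle_integrable_ln_entire hol0 nz r)
    have i2: "circle_integrable r (\<lambda>z. B / \<mu> * \<bar>ln (norm (A2 z))\<bar>)"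
      by (intro circle_integrable_cmult circle_integrable_abs circle_integrable_ln_entire hol2 nz r)
    have u1: "u (of_real r * z) = Re (a * z ^ q)" for z using r by (simp add: u_def)
    have i3: "circle_integrable r (\<lambda>z. B * s / Mb * \<bar>ln \<bar>u z\<bar>\<bar>)"
      unfolding circle_integrable_scale[of r] u1
      by (intro circle_integrable_cmult circle_integrable_abs circle_integrable_ln_Re(1)[OF a q])
    have m3: "circle_mean r (\<lambda>z. B * s / Mb * \<bar>ln \<bar>u z\<bar>\<bar>) = B * s / Mb * J"
      unfolding circle_mean_cmult by (subst circle_mean_scale) (simp only: u1 J_def)
    note Wm = peak_sum_mean[OF holG nzG r(7) kint kmean, folded W_def]
    have iL: "circle_integrable r low"
      unfolding low_def by (intro circle_integrable_diff i1 circle_integrable_const i0 i2 i3 Wm(1))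
    have mL: "circle_mean r low = 2 * (indicator_mean a q * s) - 2 * \<mu> * s - B / \<mu> * circle_mean r (\<lambda>z. \<bar>ln (norm (A0 z))\<bar>)
        - B / \<mu> * circle_mean r (\<lambda>z. \<bar>ln (norm (A2 z))\<bar>) - B * s / Mb * J - circle_mean r W"
      unfolding low_def
      by (simp only: circle_mean_diff circle_integrable_diff i1 circle_integrable_const i0 i2 i3 Wm(1) m3)
         (simp only: circle_mean_cmult circle_mean_const circle_mean_Re_pos[OF r(7)] s_def)
    \<comment> \<open>The budget in units of \<eta> s: 1/4 for 2 \<mu>, 1/8 for each outer
      coefficient, 1/4 for small |u|, 1/4 for the peaks.\<close>
    have "circle_mean r low \<le> log_mean r G"
      by (rule circle_mean_mono[OF finS r(7) pw iL circle_integrable_ln_entire[OF holG nzG r(7)]])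
    moreover have "2 * \<mu> * s \<le> \<eta> / 4 * s" using \<mu>(2) s by (intro mult_right_mono) auto
    moreover have "B / \<mu> * circle_mean r (\<lambda>z. \<bar>ln (norm (A0 z))\<bar>) \<le> \<eta> / 8 * s"
      and "B / \<mu> * circle_mean r (\<lambda>z. \<bar>ln (norm (A2 z))\<bar>) \<le> \<eta> / 8 * s"
    proof -
      have Bm: "B / \<mu> * (e2 * s) \<le> \<eta> / 8 * s"
      proof -
        have "B / \<mu> * e2 = \<eta> / 8 * (B / (B + 1))" using \<mu>(1) B by (simp add: e2_def field_simps)
        also have "\<dots> \<le> \<eta> / 8 * 1" using \<eta> B by (intro mult_left_mono) auto
        finally show ?thesis using s by (simp only: mult.assoc[symmetric]) (intro mult_right_mono, auto)
      qed
      have Bp: "B / \<mu> \<ge> 0" using B \<mu> by simp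
      show "B / \<mu> * circle_mean r (\<lambda>z. \<bar>ln (norm (A0 z))\<bar>) \<le> \<eta> / 8 * s"
        using mult_left_mono[OF R1[OF r(2)] Bp] Bm unfolding s_def by linarith
      show "B / \<mu> * circle_mean r (\<lambda>z. \<bar>ln (norm (A2 z))\<bar>) \<le> \<eta> / 8 * s"
        using mult_left_mono[OF R2[OF r(3)] Bp] Bm unfolding s_def by linarith
    qed
    moreover have "B * s / Mb * J \<le> \<eta> / 4 * s"
    proof -
      have "B * J \<le> B * \<bar>J\<bar>" using B by (intro mult_left_mono) auto
      also have "\<dots> \<le> \<eta> / 4 * Mb" using \<eta> by (simp add: Mb_def field_simps)
      finally have "B * J / Mb \<le> \<eta> / 4" using Mb by (simp add: field_simps)
      hence "B * J / Mb * s \<le> \<eta> / 4 * s" using s by (intro mult_right_mono) auto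
      thus ?thesis by (simp add: mult_ac)
    qed
    moreover have "circle_mean r W \<le> \<eta> / 4 * s"
    proof -
      have "zero_count G (2 * r) * (\<eta> / (4 * (D + 1))) \<le> D * s * (\<eta> / (4 * (D + 1)))"
        using D(2)[OF r(1)] pos unfolding s_def by (intro mult_right_mono) auto
      also have "\<dots> = D / (D + 1) * (\<eta> / 4 * s)" using D(1) by (simp add: field_simps)
      also have "\<dots> \<le> 1 * (\<eta> / 4 * s)" using D(1) \<eta> s by (intro mult_right_mono) auto
      finally show ?thesis using Wm(2) by linarith
    qed
    ultimately have "2 * (indicator_mean a q * s) - \<eta> * s \<le> log_mean r G"
      unfolding mL by linarith
    thus ?thesis by (simp add: s_def algebra_simps)
  qed
  thus ?thesis by (auto simp: eventually_at_top_linorder)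
qed

section \<open>Asymptotics of T and N\<close>

lemma proximity_exp_form:
  assumes f: "\<And>z. f z = h z * exp (a * z ^ q)" and h: "small q h" "nonnull h" and q: "q \<ge> 1" and \<eta>: "\<eta> > 0"
  shows "\<forall>\<^sub>F r in at_top. \<bar>proximity r f - indicator_mean a q * r ^ q\<bar> \<le> \<eta> * r ^ q"
proof -
  note hol = small_holomorphic[OF h(1)]
  have "(\<lambda>z. h z * exp (a * z ^ q)) holomorphic_on UNIV" by (intro holomorphic_intros hol)
  moreover have "f = (\<lambda>z. h z * exp (a * z ^ q))" using f by (rule ext)
  ultimately have holf: "entire f" by (simp only:)
  obtain R where R: "R \<ge> 1" "\<And>r. r \<ge> R \<Longrightarrow> circle_mean r (\<lambda>z. \<bar>ln (norm (h z))\<bar>) \<le> \<eta> * r ^ q"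
    using small_mean_abs_ln[OF h q \<eta>] by blast
  have "\<bar>proximity r f - indicator_mean a q * r ^ q\<bar> \<le> \<eta> * r ^ q" if "r \<ge> R" for r
  proof -
    have r: "r > 0" using that R(1) by simp
    have fin: "finite (zeros_in h r)" by (rule finite_zeros_in[OF hol h(2)])
    \<comment> \<open>The map taking x to max 0 x is 1-Lipschitz; it is applied to ln|f| and Re(a
      z^q), which differ by ln|h|.\<close>
    have key: "\<bar>log_plus (norm (f z)) - max 0 (Re (a * z ^ q))\<bar> \<le> \<bar>ln (norm (h z))\<bar>" if z: "norm z = r" "z \<notin> zeros_in h r" for z
    proof -
      have h0: "h z \<noteq> 0" using z by (auto simp: zeros_in_def)
      have "ln (norm (f z)) = ln (norm (h z)) + Re (a * z ^ q)"
        unfolding f norm_mult norm_exp_eq_Re using h0 by (subst ln_mult) auto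
      moreover have "log_plus (norm (f z)) = max 0 (ln (norm (f z)))"
        using h0 f[of z] by (auto simp: log_plus_def max_def)
      ultimately show ?thesis by linarith
    qed
    have i1: "circle_integrable r (\<lambda>z. log_plus (norm (f z)))" by (rule log_plus_norm_circle_integrable[OF holf r])
    have i2: "circle_integrable r (\<lambda>z. max 0 (Re (a * z ^ q)))" by (rule circle_integrable_Re_pos[OF r])
    have i3: "circle_integrable r (\<lambda>z. \<bar>ln (norm (h z))\<bar>)"
      by (intro circle_integrable_abs circle_integrable_ln_entire hol h(2) r)
    have m: "circle_mean r (\<lambda>z. log_plus (norm (f z)) - max 0 (Re (a * z ^ q))) = proximity r f - indicator_mean a q * r ^ q"
      using circle_mean_diff[OF i1 i2] circle_mean_Re_pos[OF r] by (simp add: proximity_eq_circle_mean)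
    have m': "circle_mean r (\<lambda>z. max 0 (Re (a * z ^ q)) - log_plus (norm (f z))) = indicator_mean a q * r ^ q - proximity r f"
      using circle_mean_diff[OF i2 i1] circle_mean_Re_pos[OF r] by (simp add: proximity_eq_circle_mean)
    have "proximity r f - indicator_mean a q * r ^ q \<le> circle_mean r (\<lambda>z. \<bar>ln (norm (h z))\<bar>)"
      unfolding m[symmetric] by (rule circle_mean_mono[OF fin r _ circle_integrable_diff[OF i1 i2] i3]) (use key in \<open>auto simp: abs_le_iff\<close>)
    moreover have "indicator_mean a q * r ^ q - proximity r f \<le> circle_mean r (\<lambda>z. \<bar>ln (norm (h z))\<bar>)"
      unfolding m'[symmetric] by (rule circle_mean_mono[OF fin r _ circle_integrable_diff[OF i2 i1] i3]) (use key in \<open>auto simp: abs_le_iff\<close>)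
    ultimately show ?thesis using R(2)[OF that] by (simp add: abs_le_iff)
  qed
  thus ?thesis by (auto simp: eventually_at_top_linorder)
qed

lemma int_count_asymptotic:
  assumes g: "entire g" "nonnull g" and q: "q \<ge> 1"
    and up: "\<And>\<eta>. \<eta> > 0 \<Longrightarrow> \<forall>\<^sub>F r in at_top. log_mean r g \<le> (K + \<eta>) * r ^ q"
    and low: "\<And>\<eta>. \<eta> > 0 \<Longrightarrow> \<forall>\<^sub>F r in at_top. (K - \<eta>) * r ^ q \<le> log_mean r g"
    and \<eta>: "\<eta> > 0"
  shows "\<forall>\<^sub>F r in at_top. \<bar>zero_int_count r g - K * r ^ q\<bar> \<le> \<eta> * r ^ q"
proof -
  have e: "\<eta> / 2 > 0" using \<eta> by simp
  show ?thesis
    using up[OF e] low[OF e] eventually_const_le_power[OF q e, of "\<bar>ln (lead g)\<bar>"] eventually_gt_at_top[of 0]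
  proof eventually_elim
    case (elim r)
    have J: "log_mean r g = ln (lead g) + zero_int_count r g"
      by (rule Jensen[OF g elim(4)])
    show ?case using elim(1-3) unfolding J distrib_right left_diff_distrib by linarith
  qed
qed

lemma Limsup_log_ratio_eq:
  assumes K: "K > 0" and asym: "\<And>\<eta>. \<eta> > 0 \<Longrightarrow> \<forall>\<^sub>F r in at_top. \<bar>N r - K * r ^ q\<bar> \<le> \<eta> * r ^ q"
  shows "Limsup at_top (\<lambda>r::real. ereal (log_plus (N r) / ln r)) = ereal (real q)"
proof (rule antisym)
  have K2: "K / 2 > 0" using K by simp
  have *: "\<forall>\<^sub>F r in at_top. N r \<le> 2 * K * r powr real q \<and> K / 2 * r powr real q \<le> N r"
    using asym[OF K2] eventually_gt_at_top[of 0]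
  proof eventually_elim
    case (elim r)
    have "K * r ^ q \<ge> 0" using K elim by simp
    moreover have "r powr real q = r ^ q" using elim by (simp add: powr_realpow)
    ultimately show ?case using elim(1) by (simp only:) linarith
  qed
  show "Limsup at_top (\<lambda>r::real. ereal (log_plus (N r) / ln r)) \<le> ereal (real q)"
    by (rule Limsup_log_ratio_le[of _ "2 * K"]) (use * in \<open>auto elim: eventually_mono\<close>)
  show "ereal (real q) \<le> Limsup at_top (\<lambda>r::real. ereal (log_plus (N r) / ln r))"
    by (rule Limsup_log_ratio_ge[of "K / 2"]) (use * K in \<open>auto elim: eventually_mono\<close>)
qed

lemma circle_mean_Re_monomial:
  assumes "q \<ge> 1" "r > 0"
  shows "circle_mean r (\<lambda>z. Re (a * z ^ q)) = 0" "circle_integrable r (\<lambda>z. Re (a * z ^ q))"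
proof -
  have "circle_mean r (\<lambda>z. Re (a * z ^ q)) = Re (a * 0 ^ q)"
    by (rule mean_value_circle) (use assms in \<open>auto intro!: continuous_intros holomorphic_intros\<close>)
  thus "circle_mean r (\<lambda>z. Re (a * z ^ q)) = 0" using assms by (simp add: power_0_left)
  show "circle_integrable r (\<lambda>z. Re (a * z ^ q))"
    by (rule continuous_circle_integrable) (use assms in \<open>auto intro!: continuous_intros\<close>)
qed

lemma indicator_mean_half: "2 * indicator_mean (a / 2) q = indicator_mean a q"
proof -
  have "max 0 (Re (a * z ^ q)) = 2 * max 0 (Re (a / 2 * z ^ q))" for z
  proof -
    have "a * z ^ q = of_real 2 * (a / 2 * z ^ q)" by simp
    hence "Re (a * z ^ q) = Re (of_real 2 * (a / 2 * z ^ q))" by (rule arg_cong)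
    hence "Re (a * z ^ q) = 2 * Re (a / 2 * z ^ q)" by simp
    thus ?thesis by (simp only: max_mult_distrib_left) auto
  qed
  thus ?thesis unfolding indicator_mean_def by (simp only: circle_mean_cmult)
qed

text \<open>The nonzero constant term keeps ln|G| near 0 where Re(a z^q) is negative, so the mean is
  that of 2 max 0 Re(a z^q).\<close>

lemma int_count_inhomogeneous:
  assumes "a \<noteq> 0" "q \<ge> 1" "small q A0" "small q A1" "small q A2" "nonnull A0" "nonnull A2"
    and G: "\<And>z. G z = A0 z + A1 z * exp (a * z ^ q) + A2 z * exp (2 * (a * z ^ q))" and \<eta>: "\<eta> > 0"
  shows "\<forall>\<^sub>F r in at_top. \<bar>zero_int_count r G - 2 * indicator_mean a q * r ^ q\<bar> \<le> \<eta> * r ^ q"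
  by (rule int_count_asymptotic[OF exp_quadratic_holomorphic[OF assms(1-7) G] exp_quadratic_nonzero[OF assms(1-7) G] assms(2)
      exp_quadratic_mean_upper[OF assms(1-7) G] exp_quadratic_mean_lower[OF assms(1-7) G] \<eta>])

text \<open>With P / 2 as exponent, the quotient by exp(a z^q) is a quadratic with middle
  coefficient 0. Halving \<open>a\<close> halves \<open>indicator_mean\<close>, so the factor 2 of
  the inhomogeneous case disappears.\<close>

lemma int_count_homogeneous:
  assumes "a \<noteq> 0" "q \<ge> 1" "small q A0" "small q A1" "nonnull A0" "nonnull A1"
    and \<Phi>: "\<And>z. \<Phi> z = A0 z * exp (a * z ^ q) + A1 z * exp (2 * (a * z ^ q))" and \<eta>: "\<eta> > 0"
  shows "\<forall>\<^sub>F r in at_top. \<bar>zero_int_count r \<Phi> - indicator_mean a q * r ^ q\<bar> \<le> \<eta> * r ^ q"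
proof -
  have a2: "a / 2 \<noteq> 0" using assms(1) by simp
  define G where "G z = A0 z + 0 * exp (a / 2 * z ^ q) + A1 z * exp (2 * (a / 2 * z ^ q))" for z
  note hyp = a2 assms(2,3) small_const[OF assms(2), of 0] assms(4,5,6) G_def
  have eq: "\<Phi> z = exp (a * z ^ q) * G z" for z
  proof -
    have "exp (2 * (a * z ^ q)) = exp (a * z ^ q) * exp (a * z ^ q)" by (simp add: exp_add[symmetric])
    thus ?thesis unfolding \<Phi> G_def by (simp add: algebra_simps)
  qed
  have "(\<lambda>z. exp (a * z ^ q) * G z) holomorphic_on UNIV" by (intro holomorphic_intros exp_quadratic_holomorphic[OF hyp])
  moreover have "\<Phi> = (\<lambda>z. exp (a * z ^ q) * G z)" using eq by (rule ext)
  ultimately have hol: "entire \<Phi>" by (simp only:)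
  have nz: "nonnull \<Phi>" using exp_quadratic_nonzero[OF hyp] eq by auto
  have mean: "log_mean r \<Phi> = log_mean r G" if r: "r > 0" for r
  proof -
    have "log_mean r \<Phi> = circle_mean r (\<lambda>z. Re (a * z ^ q) + ln (norm (G z)))"
    proof (rule circle_spike(2)[OF finite_zeros_in[OF exp_quadratic_holomorphic[OF hyp] exp_quadratic_nonzero[OF hyp], of r] r])
      fix z assume "norm z = r" "z \<notin> zeros_in G r"
      hence "G z \<noteq> 0" by (auto simp: zeros_in_def)
      thus "ln (norm (\<Phi> z)) = Re (a * z ^ q) + ln (norm (G z))"
        unfolding eq norm_mult norm_exp_eq_Re by (subst ln_mult) auto
    qed
    also have "\<dots> = log_mean r G"
      using circle_mean_add[OF circle_mean_Re_monomial(2)[OF assms(2) r] circle_integrable_ln_entire[OF exp_quadratic_holomorphic[OF hyp] exp_quadratic_nonzero[OF hyp] r]]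
        circle_mean_Re_monomial(1)[OF assms(2) r] by simp
    finally show ?thesis .
  qed
  show ?thesis
  proof (rule int_count_asymptotic[OF hol nz assms(2) _ _ \<eta>])
    fix e :: real assume e: "e > 0"
    show "\<forall>\<^sub>F r in at_top. log_mean r \<Phi> \<le> (indicator_mean a q + e) * r ^ q"
      using exp_quadratic_mean_upper[OF hyp e] eventually_gt_at_top[of 0]
      by eventually_elim (simp add: mean indicator_mean_half)
    show "\<forall>\<^sub>F r in at_top. (indicator_mean a q - e) * r ^ q \<le> log_mean r \<Phi>"
      using exp_quadratic_mean_lower[OF hyp e] eventually_gt_at_top[of 0]
      by eventually_elim (simp add: mean indicator_mean_half)
  qed
qed

text \<open>Equal leading terms make N - T = o(T), so the whole difference goes into S(r,f), with
  power term 0 and empty exceptional set.\<close>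

lemma S_lambda_term_of_asymptotic:
  assumes K: "K > 0" and T: "\<And>\<eta>. \<eta> > 0 \<Longrightarrow> \<forall>\<^sub>F r in at_top. \<bar>nev_char r f - K * r ^ q\<bar> \<le> \<eta> * r ^ q"
    and N: "\<And>\<eta>. \<eta> > 0 \<Longrightarrow> \<forall>\<^sub>F r in at_top. \<bar>N r - K * r ^ q\<bar> \<le> \<eta> * r ^ q"
  shows "S_lambda_term lam f (\<lambda>r. N r - nev_char r f)"
proof -
  have "(\<lambda>r. N r - nev_char r f) \<in> o[at_top_off {}](\<lambda>r. nev_char r f)"
  proof (rule landau_o.smallI)
    fix c :: real assume c: "c > 0"
    \<comment> \<open>The bound K / 2 gives T \<ge> (K/2) r^q, and c K / 4 keeps the two errors
      together below c times that.\<close>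
    have e: "min (c * K / 4) (K / 2) > 0" using c K by simp
    have "\<forall>\<^sub>F r in at_top. norm (N r - nev_char r f) \<le> c * norm (nev_char r f)"
      using T[OF e] N[OF e] eventually_gt_at_top[of 0]
    proof eventually_elim
      case (elim r)
      let ?e = "min (c * K / 4) (K / 2)"
      have 1: "?e * r ^ q \<le> c * K / 4 * r ^ q" "?e * r ^ q \<le> K / 2 * r ^ q" using elim by (auto intro!: mult_right_mono)
      have "K / 2 * r ^ q \<le> \<bar>nev_char r f\<bar>" using elim 1(2) by linarith
      hence "c * (K / 2 * r ^ q) \<le> c * \<bar>nev_char r f\<bar>" using c by (intro mult_left_mono) auto
      moreover have "\<bar>N r - nev_char r f\<bar> \<le> 2 * (?e * r ^ q)" using elim by linarith
      ultimately show ?case using 1(1) by simp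
    qed
    thus "\<forall>\<^sub>F r in at_top_off {}. norm (N r - nev_char r f) \<le> c * norm (nev_char r f)"
      by (rule eventually_at_top_imp_off)
  qed
  hence S: "S_term f (\<lambda>r. N r - nev_char r f)" unfolding S_term_def by (intro exI[of _ "{}"]) simp
  show ?thesis unfolding S_lambda_term_def
    by (intro allI impI exI[of _ "{}"] exI[of _ "\<lambda>_. 0"] exI[of _ "\<lambda>r. N r - nev_char r f"] conjI S) simp_all
qed

theorem theorem1p4:
  fixes f \<beta> :: "complex \<Rightarrow> complex" and \<alpha> :: complex
    and m :: nat and b :: "nat \<Rightarrow> complex \<Rightarrow> complex"
    and k :: "nat \<Rightarrow> nat" and c :: "nat \<Rightarrow> complex"
    and \<rho> lam :: real
  assumes "transcendental_entire f"
    and "growth_order f = ereal \<rho>"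
    and "borel_exceptional_zero f"
    and "lam < \<rho>"
    and "\<alpha> \<noteq> 0"
    and "\<beta> holomorphic_on UNIV" and "lambda_small lam f \<beta>"
    and "\<And>j. j \<le> m \<Longrightarrow> b j holomorphic_on UNIV"
    and "\<And>j. j \<le> m \<Longrightarrow> lambda_small lam f (b j)"
    and "inj_on c {..m}"
    and "\<exists>z. diff_difference_op m b k c f z \<noteq> 0"
  shows "zero_exponent (\<lambda>z. Phi2 m b k c \<alpha> f z - \<beta> z) = ereal \<rho> \<and>
         ((\<forall>z. \<beta> z = 0) \<longrightarrow>
            S_lambda_term lam f
              (\<lambda>r. int_count r (\<lambda>z. 1 / Phi2 m b k c \<alpha> f z) - nev_char r f))"
proof -
  have holf: "entire f" using assms(1) by (simp add: transcendental_entire_def)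
  have nzf: "nonnull f"
  proof (rule ccontr)
    assume "\<not> ?thesis"
    hence "\<forall>z. f z = poly 0 z" by simp
    thus False using assms(1) unfolding transcendental_entire_def by blast
  qed
  obtain q a h where q: "q \<ge> 1" and \<rho>: "\<rho> = real q" and a: "a \<noteq> 0" and h: "small q h"
    and f: "\<And>z. f z = h z * exp (a * z ^ q)"
    using borel_exceptional_form[OF holf nzf assms(2)] assms(3) unfolding borel_exceptional_zero_def by blast
  have nzh: "nonnull h" using nzf f by auto
  define K where "K = indicator_mean a q"
  have K: "K > 0" unfolding K_def by (rule indicator_mean_pos[OF a q])
  have T: "\<forall>\<^sub>F r in at_top. \<bar>nev_char r f - K * r ^ q\<bar> \<le> \<eta> * r ^ q" if "\<eta> > 0" for \<eta>
    unfolding nev_char_entire[OF holf] K_def by (rule proximity_exp_form[OF f h nzh q that])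
  have T': "\<forall>\<^sub>F r in at_top. \<bar>nev_char r f\<bar> \<le> (K + 1) * r ^ q"
    using T[OF zero_less_one] eventually_gt_at_top[of 0]
  proof eventually_elim
    case (elim r)
    have "K * r ^ q \<ge> 0" using K elim by simp
    thus ?case using elim(1) unfolding distrib_right by linarith
  qed
  note lambda_small = lambda_small_imp_small[OF assms(2)[unfolded \<rho>] T' assms(4)[unfolded \<rho>]]
  have s\<beta>: "small q \<beta>" by (rule lambda_small[OF assms(6,7)])
  have sb: "small q (b j)" if "j \<le> m" for j by (rule lambda_small[OF assms(8)[OF that] assms(9)[OF that]])
  obtain H where H: "small q H" and L: "\<And>z. diff_difference_op m b k c f z = H z * exp (a * z ^ q)"
    using diff_difference_op_exp_form[where b = b and m = m, OF f h q sb] by blast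
  have nzH: "nonnull H" using assms(11) L by auto
  define A where "A z = - \<alpha> * (h z * h z)" for z
  have sA: "small q A" unfolding A_def by (intro small_mult small_const q h)
  have nzA: "nonnull A" using nzh assms(5) by (auto simp: A_def)
  have Phi: "Phi2 m b k c \<alpha> f z = H z * exp (a * z ^ q) + A z * exp (2 * (a * z ^ q))" for z
  proof -
    have "exp (2 * (a * z ^ q)) = exp (a * z ^ q) * exp (a * z ^ q)" by (simp add: exp_add[symmetric])
    thus ?thesis unfolding Phi2_def L f[of z] A_def power2_eq_square by (simp only:) (simp add: algebra_simps)
  qed
  note hom = int_count_homogeneous[OF a q H sA nzH nzA Phi]
  show ?thesis
  proof (cases "\<forall>z. \<beta> z = 0")
    case True
    have "zero_exponent (\<lambda>z. Phi2 m b k c \<alpha> f z - \<beta> z) = ereal \<rho>"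
      using Limsup_log_ratio_eq[OF K hom[folded K_def]] True by (simp add: zero_exponent_def \<rho>)
    moreover have "S_lambda_term lam f (\<lambda>r. int_count r (\<lambda>z. 1 / Phi2 m b k c \<alpha> f z) - nev_char r f)"
      by (rule S_lambda_term_of_asymptotic[OF K T hom[folded K_def]])
    ultimately show ?thesis by simp
  next
    case False
    have "small q (\<lambda>z. (- 1) * \<beta> z)" by (intro small_mult small_const q s\<beta>)
    hence s\<beta>': "small q (\<lambda>z. - \<beta> z)" by simp
    have nz\<beta>: "\<exists>z. - \<beta> z \<noteq> 0" using False by auto
    have G: "Phi2 m b k c \<alpha> f z - \<beta> z = - \<beta> z + H z * exp (a * z ^ q) + A z * exp (2 * (a * z ^ q))" for z
      by (simp add: Phi)
    have K2: "2 * K > 0" using K by simp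
    have "zero_exponent (\<lambda>z. Phi2 m b k c \<alpha> f z - \<beta> z) = ereal \<rho>"
      unfolding zero_exponent_def \<rho>
      by (rule Limsup_log_ratio_eq[OF K2]) (unfold K_def, rule int_count_inhomogeneous[OF a q s\<beta>' H sA nz\<beta> nzA G])
    thus ?thesis using False by blast
  qed
qed

end
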